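(* Consider the problem, setting and Majorized ADMM described in the context, with $\sigma>0$, $\tau>0$ and self-adjoint positive semidefinite $\mathcal{S},\mathcal{T}$. Suppose that the solution set of the problem is nonempty, let $(\bar u,\bar v)$ be an optimal solution, and suppose there exists $(\hat u,\hat v)\in\mathrm{ri}(\mathrm{dom}(p)\times\mathrm{dom}(q))$ with $\mathcal{A}^*\hat u+\mathcal{B}^*\hat v=c$. Suppose $\mathcal{Q}_{11}+\sigma\mathcal{A}\mathcal{A}^*+\mathcal{S}\succ0$ and $\mathcal{Q}_{22}+\sigma\mathcal{B}\mathcal{B}^*+\mathcal{T}\succ0$. Assume either (a) $\tau\in(0,1]$ and for every $w=(u,v)$, $\langle w,[\mathcal{Q}+\mathrm{Diag}(\mathcal{S}+(1-\tau)\sigma\mathcal{A}\mathcal{A}^*,\ \mathcal{T}+(1-\tau)\sigma\mathcal{B}\mathcal{B}^* )]w\rangle=0$ implies $\|u\|\|v\|=0$; or (b) $\tau\in(0,\frac{1+\sqrt5}{2})$, $\mathcal{M}:=\frac14\mathcal{Q}+\mathrm{Diag}(\mathcal{S}-\eta\mathcal{D}_1,\mathcal{T}-\eta\mathcal{D}_2)\succeq0$, $\frac14\mathcal{Q}_{11}+\mathcal{S}+\sigma\mathcal{A}\mathcal{A}^*-\eta\mathcal{D}_1\succ0$, $\frac14\mathcal{Q}_{22}+\mathcal{T}+\sigma\mathcal{B}\mathcal{B}^*-\eta\mathcal{D}_2\succ0$, and for every $w=(u,v)$, $\langle w,[\mathcal{M}+\sigma\mathrm{Diag}(\mathcal{A}\mathcal{A}^*,\mathcal{B}\mathcal{B}^*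 )]w\rangle=0$ implies $\|u\|\|v\|=0$. Then there exist constants $D_1,D_2,D_3$, depending only on the initial point and the optimal solution set (independent of $k$), such that for all $k\ge1$: (i) $\|\mathcal{A}^*\hat u^k+\mathcal{B}^*\hat v^k-c\|\le D_1/k$; (ii) for all $(u,v,x)\in B_k:=\{(u,v,x):\|(u,v,x)-(\hat u^k,\hat v^k,\hat x^k)\|\le1\}$, with $w=(u,v)$, $$(p(\hat u^k)+q(\hat v^k))-(p(u)+q(v))+\langle\hat w^k-w,\nabla\phi(w)\rangle+\langle\hat u^k-u,\mathcal{A}x\rangle+\langle\hat v^k-v,\mathcal{B}x\rangle-\langle\hat x^k-x,\mathcal{A}^*u+\mathcal{B}^*v-c\rangle\le D_2/k;$$ (iii) in case (a), and in case (b) under the additional assumption $\mathcal{S}-\eta\mathcal{D}_1\succeq0$ and $\mathcal{T}-\eta\mathcal{D}_2\succeq0$, $|\theta(\hat u^k,\hat v^k)-\theta(\bar u,\bar v)|\le D_3/k$.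
   Context: $\mathcal{U},\mathcal{V},\mathcal{X}$ are real finite-dimensional Euclidean spaces. $p:\mathcal{U}\to(-\infty,\infty]$ and $q:\mathcal{V}\to(-\infty,\infty]$ are closed proper convex functions; $\phi:\mathcal{U}\times\mathcal{V}\to\mathbb{R}$ is a smooth convex function with globally Lipschitz continuous gradient; $\mathcal{A}:\mathcal{X}\to\mathcal{U}$, $\mathcal{B}:\mathcal{X}\to\mathcal{V}$ are linear, $c\in\mathcal{X}$. The problem is $\min_{u,v}\ \theta(u,v):=p(u)+q(v)+\phi(u,v)$ subject to $\mathcal{A}^*u+\mathcal{B}^*v=c$. Write $w=(u,v)$. For self-adjoint positive semidefinite $\mathcal{G}$, $\|z\|_{\mathcal{G}}^2=\langle z,\mathcal{G}z\rangle$. $\partial^2\phi(w)$ is Clarke's generalized Hessian (convex hull of limits of $\nabla^2\phi(w^j)$, $w^j\to w$, at points where $\nabla^2\phi$ exists). $\mathcal{Q},\mathcal{H}$ are self-adjoint positive semidefinite operators on $\mathcal{U}\times\mathcal{V}$ with $\mathcal{Q}\preceq\mathcal{W}\preceq\mathcal{Q}+\mathcal{H}$ for all $\mathcal{W}\in\partial^2\phi(w)$, all $w$; $\mathcal{H}=\mathrm{Diag}(\mathcal{D}_1,\mathcal{D}_2)$ with $\mathcal{D}_1,\mathcal{D}_2$ self-adjoint positive semidefinite. Blocks: $\mathcal{Q}=\begin{pmatrix}\mathcal{Q}_{11}&\mathcal{Q}_{12}\\ \mathcal{Q}_{12}^*&\mathcal{Q}_{22}\end{pmatrix}$, similarly for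 $\mathcal{W}$. $\eta\in[0,1]$ is a constant with $|\langle u,(\mathcal{W}_{12}-\mathcal{Q}_{12})v\rangle|\le\frac{\eta}{2}(\|u\|_{\mathcal{D}_1}^2+\|v\|_{\mathcal{D}_2}^2)$ for all $\mathcal{W}\in\partial^2\phi(z)$, all $z$, all $u\in\mathcal{U},v\in\mathcal{V}$. Majorized ADMM: $\hat\phi(w;w')=\phi(w')+\langle\nabla\phi(w'),w-w'\rangle+\frac12\|w-w'\|^2_{\mathcal{Q}+\mathcal{H}}$, $\widehat{\mathcal{L}}_\sigma(w;(x,w'))=p(u)+q(v)+\hat\phi(w;w')+\langle x,\mathcal{A}^*u+\mathcal{B}^*v-c\rangle+\frac{\sigma}{2}\|\mathcal{A}^*u+\mathcal{B}^*v-c\|^2$. Given $(u^0,v^0,x^0)\in\mathrm{dom}(p)\times\mathrm{dom}(q)\times\mathcal{X}$, for $k=0,1,\dots$: $u^{k+1}=\arg\min_u\{\widehat{\mathcal{L}}_\sigma(u,v^k;(x^k,w^k))+\frac12\|u-u^k\|_{\mathcal{S}}^2\}$; $v^{k+1}=\arg\min_v\{\widehat{\mathcal{L}}_\sigma(u^{k+1},v;(x^k,w^k))+\frac12\|v-v^k\|_{\mathcal{T}}^2\}$; $x^{k+1}=x^k+\tau\sigma(\mathcal{A}^*u^{k+1}+\mathcal{B}^*v^{k+1}-c)$. Ergodic averages: $\tilde x^{i+1}=x^i+\sigma(\mathcal{A}^*u^{i+1}+\mathcal{B}^*v^{i+1}-c)$, $\hat x^k=\frac1k\sum_{i=1}^k\tilde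 x^{i+1}$, $\hat u^k=\frac1k\sum_{i=1}^k u^{i+1}$, $\hat v^k=\frac1k\sum_{i=1}^k v^{i+1}$, $\hat w^k=(\hat u^k,\hat v^k)$. *)

theory Defs
  imports "HOL-Analysis.Analysis"
begin

text \<open>A closed proper convex function with values in (-inf,+inf] is represented by its
  (effective) domain D and its real values on D; outside D the function is +infinity.\<close>
definition closed_proper_convex :: "'a::euclidean_space set \<Rightarrow> ('a \<Rightarrow> real) \<Rightarrow> bool" where
  "closed_proper_convex D f \<longleftrightarrow> D \<noteq> {} \<and> convex D \<and> convex_on D f \<and>
     closed {(z, t). z \<in> D \<and> f z \<le> t}"

definition self_adj :: "('a::euclidean_space \<Rightarrow> 'a) \<Rightarrow> bool" where
  "self_adj M \<longleftrightarrow> linear M \<and> (\<forall>a b. M a \<bullet> b = a \<bullet> M b)"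

definition psd :: "('a::euclidean_space \<Rightarrow> 'a) \<Rightarrow> bool" where
  "psd M \<longleftrightarrow> (\<forall>z. 0 \<le> z \<bullet> M z)"

definition pd :: "('a::euclidean_space \<Rightarrow> 'a) \<Rightarrow> bool" where
  "pd M \<longleftrightarrow> (\<forall>z. z \<noteq> 0 \<longrightarrow> 0 < z \<bullet> M z)"

definition sqn :: "('a::euclidean_space \<Rightarrow> 'a) \<Rightarrow> 'a \<Rightarrow> real" where
  "sqn M z = z \<bullet> M z"

definition Diag :: "('u::euclidean_space \<Rightarrow> 'u) \<Rightarrow> ('v::euclidean_space \<Rightarrow> 'v) \<Rightarrow> ('u \<times> 'v \<Rightarrow> 'u \<times> 'v)" where
  "Diag M1 M2 = (\<lambda>(a, b). (M1 a, M2 b))"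

definition blk11 :: "('u::euclidean_space \<times> 'v::euclidean_space \<Rightarrow> 'u \<times> 'v) \<Rightarrow> 'u \<Rightarrow> 'u" where
  "blk11 M a = fst (M (a, 0))"
definition blk12 :: "('u::euclidean_space \<times> 'v::euclidean_space \<Rightarrow> 'u \<times> 'v) \<Rightarrow> 'v \<Rightarrow> 'u" where
  "blk12 M b = fst (M (0, b))"
definition blk22 :: "('u::euclidean_space \<times> 'v::euclidean_space \<Rightarrow> 'u \<times> 'v) \<Rightarrow> 'v \<Rightarrow> 'v" where
  "blk22 M b = snd (M (0, b))"

text \<open>Clarke's generalized Hessian of a function whose gradient is G: convex hull of all
  limits of Hessians (derivatives of G) along sequences of points of differentiability of G
  converging to w.\<close>
definition clarke_hessian :: "('a::euclidean_space \<Rightarrow> 'a) \<Rightarrow> 'a \<Rightarrow> ('a \<Rightarrow>\<^sub>L 'a) set" where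
  "clarke_hessian G w = convex hull
     {W. \<exists>ws Ws. (\<forall>j. (G has_derivative blinfun_apply (Ws j)) (at (ws j))) \<and>
                 ws \<longlonglongrightarrow> w \<and> Ws \<longlonglongrightarrow> W}"

definition phihat :: "('a::euclidean_space \<Rightarrow> real) \<Rightarrow> ('a \<Rightarrow> 'a) \<Rightarrow> ('a \<Rightarrow> 'a) \<Rightarrow> 'a \<Rightarrow> 'a \<Rightarrow> real" where
  "phihat phi G QH w w' = phi w' + G w' \<bullet> (w - w') + 1/2 * sqn QH (w - w')"

definition Lhat ::
  "('u::euclidean_space \<Rightarrow> real) \<Rightarrow> ('v::euclidean_space \<Rightarrow> real) \<Rightarrow> ('u \<times> 'v \<Rightarrow> real) \<Rightarrow>
   ('u \<times> 'v \<Rightarrow> 'u \<times> 'v) \<Rightarrow> ('u \<times> 'v \<Rightarrow> 'u \<times> 'v) \<Rightarrow>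
   ('x::euclidean_space \<Rightarrow> 'u) \<Rightarrow> ('x \<Rightarrow> 'v) \<Rightarrow> 'x \<Rightarrow> real \<Rightarrow>
   'u \<times> 'v \<Rightarrow> 'x \<Rightarrow> 'u \<times> 'v \<Rightarrow> real" where
  "Lhat p q phi G QH A B c \<sigma> w x w' =
     p (fst w) + q (snd w) + phihat phi G QH w w'
     + x \<bullet> (adjoint A (fst w) + adjoint B (snd w) - c)
     + \<sigma> / 2 * (norm (adjoint A (fst w) + adjoint B (snd w) - c))\<^sup>2"

end

theory Submission
  imports Defs
begin

text \<open>Testing the optimality conditions of the two subproblems at a point \<open>(z, y)\<close> and adding them
  shows that every iteration decreases a quadratic Lyapunov function centred at \<open>(z, y)\<close> by at least
  the gap of that iterate. Summing over the iterations and applying Jensen's inequality gives the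
  ergodic rates; centring at a KKT point, where the gap is nonnegative, shows that the iterates are
  bounded. The smooth part enters only through quadratic bounds for \<open>\<phi>\<close> and one bound for a partial
  increment of its gradient.

  To derive these from hypotheses on Clarke's generalized Hessian one must know that the gradient is
  differentiable almost everywhere, that is, Rademacher's theorem. In one variable it follows from
  the Radon-Nikodym theorem and Lebesgue differentiation. In general, near a density point of a closed
  set on which the partial difference quotients are uniformly close to a fixed vector, one can move
  along the coordinate axes starting from points of the set; this makes the function nearly linear.\<close>

section \<open>Rademacher's theorem\<close>

text \<open>The u-step freezes v at its old value, so adding the optimality conditions leaves two
  products that do not telescope: \<sigma> times the residual against \<open>Bs\<close> of the
  v-increment, and the off-diagonal block of \<open>Q\<close> applied to the v-increment. For \<tau>
  \<le> 1 Young's inequality absorbs both. For \<tau> > 1 the weight (1 - \<tau>/2)\<sigma> of the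
  squared residual drops below \<sigma>/2, and the first product is instead rewritten by comparing
  two consecutive v-subproblems. Only this comparison needs a partial gradient increment; it creates
  the terms with \<eta>, and its leftover quadratic form is nonnegative when \<tau>^2 \<le> \<tau> +
  1, whence the golden ratio. The quarter of \<open>Q\<close> in case (b) is paid by the quadratic
  term that separates \<phi> from its linearisation at the centre. The centre in (ii) may be
  infeasible, which adds a linear term without sign to the Lyapunov function; bounded iterates
  confine the centres to a fixed ball, where this term is harmless. The \<eta>-condition concerns
  the upper right block, the v-subproblem meets the lower left one; hence derivatives of a gradient
  are shown to be symmetric.\<close>

lemma AE_lborel_translate:
  fixes a :: "'a::euclidean_space"
  assumes [measurable]: "Measurable.pred borel P"
  shows "(AE x in lborel. P (a + x)) \<longleftrightarrow> (AE x in lborel. P x)"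
proof -
  have "(AE x in lborel. P x) \<longleftrightarrow> (AE x in distr lborel borel ((+) a). P x)"
    by (subst lborel_distr_plus) (rule refl)
  also have "\<dots> \<longleftrightarrow> (AE x in lborel. P (a + x))"
    by (rule AE_distr_iff) auto
  finally show ?thesis ..
qed

text \<open>Fubini without coordinates, for an arbitrary direction: after the quantifiers are
  exchanged, each fixed t only translates the exceptional set, which preserves its measure.\<close>

lemma AE_lborel_lines:
  fixes d :: "'a::euclidean_space"
  assumes P[measurable]: "Measurable.pred borel P"
  shows "(AE y in lborel. AE t in lborel. P (y + (t::real) *\<^sub>R d)) \<longleftrightarrow> (AE x in lborel. P x)"
proof -
  have "(AE y in lborel. AE t in lborel. P (y + (t::real) *\<^sub>R d)) \<longleftrightarrow>
      (AE t::real in lborel. AE y in lborel. P (y + t *\<^sub>R d))"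
    by (rule lborel_pair.AE_commute) measurable
  also have "\<dots> \<longleftrightarrow> (AE t::real in lborel. AE y in lborel. P y)"
  proof -
    have "(AE y in lborel. P (y + t *\<^sub>R d)) \<longleftrightarrow> (AE y in lborel. P y)" for t :: real
      using AE_lborel_translate[OF P, of "t *\<^sub>R d"] by (simp add: add.commute)
    then show ?thesis by (simp only:)
  qed
  also have "\<dots> \<longleftrightarrow> (AE x in lborel. P x)"
    by (simp add: trivial_limit_def[symmetric] ae_filter_eq_bot_iff eventually_const_iff)
  finally show ?thesis .
qed

section \<open>Lipschitz functions of one real variable\<close>

lemma lipschitz_real_density:
  fixes g :: "real \<Rightarrow> real"
  assumes lip: "\<And>x y. \<bar>g x - g y\<bar> \<le> L * \<bar>x - y\<bar>"
  obtains h N where "negligible N"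
    "\<And>a b. a \<le> b \<Longrightarrow> (h has_integral (g b - g a)) {a..b}"
    "\<And>x e. x \<notin> N \<Longrightarrow> 0 < e \<Longrightarrow> \<exists>d>0. \<forall>t. 0 < t \<and> t < d \<longrightarrow> \<bar>(g (x + t) - g x) / t - h x\<bar> < e"
proof -
  have L0: "0 \<le> L" using lip[of 1 0] by auto
  define F where "F = (\<lambda>x. g x + (L + 1) * x)"
  have F_low: "y - x \<le> F y - F x" and F_up: "F y - F x \<le> (2*L+1) * (y - x)" if "x \<le> y" for x y
    using lip[of y x] that by (auto simp: F_def algebra_simps abs_le_iff)
  have F_mono: "F x \<le> F y \<longleftrightarrow> x \<le> y" for x y
    using F_low[of x y] F_low[of y x] by linarith
  have F_lip: "\<bar>F y - F x\<bar> \<le> (2*L+1) * \<bar>y - x\<bar>" for x y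
    using F_low[of x y] F_low[of y x] F_up[of x y] F_up[of y x] by (cases "x \<le> y") (auto simp: algebra_simps)
  have F_cont: "continuous_on S F" for S
    using lipschitz_on_continuous_on[of "2*L+1" S F] F_lip L0
    by (auto simp: lipschitz_on_def dist_real_def)
  have surj: "\<exists>x. F x = y" for y
  proof -
    define m where "m = \<bar>y - F 0\<bar>"
    have "F (-m) \<le> y" "y \<le> F m" "-m \<le> m"
      using F_low[of 0 m] F_low[of "-m" 0] by (auto simp: m_def)
    then show ?thesis using IVT'[of F "-m" y m] F_cont by blast
  qed
  define K where "K = inv F"
  have FK: "F (K y) = y" for y using surj by (metis K_def f_inv_into_f rangeI)
  have KF: "K (F x) = x" for x using FK[of "F x"] F_mono by (metis dual_order.eq_iff)
  have "\<bar>K y - K x\<bar> \<le> \<bar>y - x\<bar>" for x y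
    using F_low[of "K x" "K y"] F_low[of "K y" "K x"] by (simp add: FK abs_le_iff) linarith
  then have "continuous_on UNIV K"
    using lipschitz_on_continuous_on[of 1 UNIV K] by (auto simp: lipschitz_on_def dist_real_def)
  then have K_meas[measurable]: "K \<in> borel_measurable borel"
    by (rule borel_measurable_continuous_onI)
  define \<mu> where "\<mu> = distr lborel borel K"
  have sets_mu[simp]: "sets \<mu> = sets lborel" by (simp add: \<mu>_def)
  have vimage: "K -` S = F ` S" for S
    using FK KF by (auto simp: image_iff) metis
  have ac: "absolutely_continuous lborel \<mu>"
    unfolding absolutely_continuous_def
  proof
    fix S :: "real set" assume S: "S \<in> null_sets lborel"
    then have [measurable]: "S \<in> sets borel" by auto
    have "negligible S"
      using S by (simp add: negligible_iff_null_sets null_sets_completionI)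
    then have "negligible (F ` S)"
      by (rule negligible_locally_Lipschitz_image[OF order_refl])
        (use F_lip in \<open>auto intro!: exI[of _ UNIV] exI[of _ "2*L+1"]\<close>)
    then have "emeasure lebesgue (K -` S) = 0"
      by (simp add: negligible_iff_null_sets vimage null_setsD1)
    moreover have "K -` S \<in> sets borel"
      using measurable_sets[OF K_meas, of S] by simp
    ultimately have "emeasure \<mu> S = 0"
      by (simp add: \<mu>_def emeasure_distr)
    then show "S \<in> null_sets \<mu>" by (auto simp: null_sets_def)
  qed
  define \<rho> where "\<rho> = RN_deriv lborel \<mu>"
  have [measurable]: "\<rho> \<in> borel_measurable borel"
    by (simp add: \<rho>_def borel_measurable_RN_deriv)
  have dens: "density lborel \<rho> = \<mu>"
    unfolding \<rho>_def by (rule sigma_finite_measure.density_RN_deriv[OF sigma_finite_lborel]) (use ac in auto)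
  have nn: "(\<integral>\<^sup>+x. \<rho> x * indicator {a..b} x \<partial>lborel) = ennreal (F b - F a)" if "a \<le> b" for a b
  proof -
    have "(\<integral>\<^sup>+x. \<rho> x * indicator {a..b} x \<partial>lborel) = emeasure \<mu> {a..b}"
      unfolding dens[symmetric] by (simp add: emeasure_density)
    also have "\<dots> = emeasure lborel (K -` {a..b})"
      by (simp add: \<mu>_def emeasure_distr)
    also have "K -` {a..b} = {F a..F b}"
      using FK F_mono by (auto simp: set_eq_iff) (metis FK F_mono)+
    finally show ?thesis using that by (simp add: F_mono)
  qed
  \<comment> \<open>Every interval [-n, n] has finite mass, so passing to real values by
    \<open>enn2real\<close> below loses nothing almost everywhere.\<close>
  have fin: "AE x in lborel. \<rho> x \<noteq> \<infinity>"
  proof -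
    have "AE x in lborel. \<rho> x * indicator {-real n..real n} x \<noteq> \<infinity>" for n
      by (rule nn_integral_noteq_infinite) (auto simp: nn)
    then have "AE x in lborel. \<forall>n. \<rho> x * indicator {-real n..real n} x \<noteq> \<infinity>"
      by (simp add: AE_all_countable)
    then show ?thesis
    proof eventually_elim
      case (elim x)
      obtain n where "\<bar>x\<bar> \<le> real n" using real_arch_simple by blast
      then show ?case using elim[rule_format, of n] by (auto simp: indicator_def abs_le_iff split: if_splits)
    qed
  qed
  define h0 where "h0 = (\<lambda>x. enn2real (\<rho> x))"
  have h0_int: "(h0 has_integral (F b - F a)) {a..b}" if "a \<le> b" for a b
  proof -
    have "((\<lambda>x. h0 x * indicator {a..b} x) has_integral (F b - F a)) UNIV"
    proof (rule nn_integral_has_integral)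
      have "(\<integral>\<^sup>+x. ennreal (h0 x * indicator {a..b} x) \<partial>lborel) = (\<integral>\<^sup>+x. \<rho> x * indicator {a..b} x \<partial>lborel)"
        by (rule nn_integral_cong_AE)
          (use fin in \<open>eventually_elim, auto simp: h0_def indicator_def less_top\<close>)
      then show "(\<integral>\<^sup>+x. ennreal (h0 x * indicator {a..b} x) \<partial>lborel) = ennreal (F b - F a)"
        using nn[OF that] by simp
    qed (use that in \<open>auto simp: h0_def F_mono\<close>)
    moreover have "(\<lambda>x. h0 x * indicator {a..b} x) = (\<lambda>x. if x \<in> {a..b} then h0 x else 0)"
      by auto
    ultimately show ?thesis by (simp only: has_integral_restrict_UNIV)
  qed
  define h where "h = (\<lambda>x. h0 x - (L + 1))"
  have h_int: "(h has_integral (g b - g a)) {a..b}" if "a \<le> b" for a b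
  proof -
    have "((\<lambda>x. h0 x - (L + 1)) has_integral (F b - F a - (b - a) *\<^sub>R (L + 1))) {a..b}"
      by (intro has_integral_diff h0_int that) (use has_integral_const_real[of "L+1" a b] that in simp)
    then show ?thesis by (simp add: h_def F_def algebra_simps)
  qed
  have "h integrable_on cbox a b" for a b
    using h_int[of a b] by (cases "a \<le> b") (auto simp: integrable_on_def)
  from integrable_ccontinuous_explicit[OF this] obtain N where N: "negligible N"
       "\<And>x e. \<lbrakk>x \<notin> N; 0 < e\<rbrakk> \<Longrightarrow> \<exists>d>0. \<forall>t. 0 < t \<and> t < d \<longrightarrow>
            norm(integral (cbox x (x + t *\<^sub>R One)) h /\<^sub>R t ^ DIM(real) - h x) < e"
    by metis
  show thesis
  proof (rule that[OF N(1)])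
    show "(h has_integral g b - g a) {a..b}" if "a \<le> b" for a b by (rule h_int[OF that])
    show "\<exists>d>0. \<forall>t. 0 < t \<and> t < d \<longrightarrow> \<bar>(g (x + t) - g x) / t - h x\<bar> < e" if x: "x \<notin> N" and e: "0 < e" for x e
    proof -
      obtain d where "d > 0" and d: "\<And>t. 0 < t \<Longrightarrow> t < d \<Longrightarrow>
            norm(integral (cbox x (x + t *\<^sub>R One)) h /\<^sub>R t ^ DIM(real) - h x) < e"
        using N(2)[OF x e] by blast
      have "\<bar>(g (x + t) - g x) / t - h x\<bar> < e" if "0 < t" "t < d" for t
        using d[OF that] integral_unique[OF h_int[of x "x+t"]] that by (simp add: divide_inverse mult.commute)
      then show ?thesis using \<open>d > 0\<close> by blast
    qed
  qed
qed

section \<open>Density points of closed sets\<close>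

text \<open>At a density point, a small corner cube of side h cannot have a hole of fixed relative
  size: a subcube of side \<open>\<rho> * h\<close> missed by \<open>E\<close> would remove the
  fraction \<rho>^n of the measure.\<close>

lemma closed_dense_in_corner_cubes:
  fixes E :: "'a::euclidean_space set"
  assumes "closed E"
  obtains N where "negligible N"
    "\<And>x e. x \<in> E \<Longrightarrow> x \<notin> N \<Longrightarrow> 0 < e \<Longrightarrow>
       \<exists>d>0. \<forall>h y. 0 < h \<and> h < d \<and> y \<in> cbox x (x + h *\<^sub>R One) \<longrightarrow> (\<exists>z\<in>E. norm (z - y) \<le> e * h)"
proof -
  let ?n = "DIM('a)"
  have meas: "E \<inter> cbox a b \<in> lmeasurable" for a b
    using assms by (simp add: lmeasurable_compact closed_Int_compact)
  have int: "(indicat_real E has_integral measure lebesgue (E \<inter> cbox a b)) (cbox a b)" for a b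
  proof -
    have "(indicat_real (E \<inter> cbox a b) has_integral measure lebesgue (E \<inter> cbox a b)) UNIV"
      using meas[of a b] by (simp add: lmeasurable_iff_has_integral)
    moreover have "indicat_real (E \<inter> cbox a b) = (\<lambda>x. if x \<in> cbox a b then indicat_real E x else 0)"
      by (auto simp: indicator_def)
    ultimately show ?thesis by (simp only: has_integral_restrict_UNIV)
  qed
  have "indicat_real E integrable_on cbox a b" for a b
    using int by (auto simp: integrable_on_def)
  then obtain N where N: "negligible N"
       "\<And>x e. \<lbrakk>x \<notin> N; 0 < e\<rbrakk> \<Longrightarrow> \<exists>d>0. \<forall>t. 0 < t \<and> t < d \<longrightarrow>
            norm(integral (cbox x (x + t *\<^sub>R One)) (indicat_real E) /\<^sub>R t ^ ?n - indicat_real E x) < e"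
    by (rule integrable_ccontinuous_explicit[where f="indicat_real E"]) blast+
  show thesis
  proof (rule that[OF N(1)])
    fix x :: 'a and e :: real assume x: "x \<in> E" "x \<notin> N" and e: "0 < e"
    \<comment> \<open>The norm is estimated by the sum of the n coordinates, which costs the factor
      n.\<close>
    define \<rho> where "\<rho> = min 1 (e / ?n)"
    have \<rho>: "0 < \<rho>" "\<rho> \<le> 1" "\<rho> * ?n \<le> e" using e by (auto simp: \<rho>_def min_def field_simps)
    obtain d where d: "d > 0" "\<And>t. 0 < t \<Longrightarrow> t < d \<Longrightarrow>
        norm(integral (cbox x (x + t *\<^sub>R One)) (indicat_real E) /\<^sub>R t ^ ?n - indicat_real E x) < \<rho> ^ ?n"
      using N(2)[OF x(2), of "\<rho> ^ ?n"] \<rho> by auto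
    have "\<exists>z\<in>E. norm (z - y) \<le> e * h" if h: "0 < h" "h < d" and y: "y \<in> cbox x (x + h *\<^sub>R One)" for h y
    proof (rule ccontr)
      assume contra: "\<not> ?thesis"
      \<comment> \<open>\<open>K\<close> below is the image of the corner cube under the homothety
        with centre y and ratio \<rho>; hence it contains y and stays inside the cube.\<close>
      define l where "l = x + (1 - \<rho>) *\<^sub>R (y - x)"
      define K where "K = cbox l (l + (\<rho> * h) *\<^sub>R One)"
      let ?C = "cbox x (x + h *\<^sub>R One)"
      have yi: "0 \<le> (y - x) \<bullet> i" "(y - x) \<bullet> i \<le> h" if "i \<in> Basis" for i
        using y that by (auto simp: mem_box inner_simps)
      have KC: "K \<subseteq> ?C"
      proof -
        have "0 \<le> (1 - \<rho>) * ((y - x) \<bullet> i)" "(1 - \<rho>) * ((y - x) \<bullet> i) + \<rho> * h \<le> h" if "i \<in> Basis" for i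
        proof -
          show "0 \<le> (1 - \<rho>) * ((y - x) \<bullet> i)" using yi[OF that] \<rho> by auto
          have "(1 - \<rho>) * ((y - x) \<bullet> i) \<le> (1 - \<rho>) * h" using yi[OF that] \<rho> by (intro mult_left_mono) auto
          then show "(1 - \<rho>) * ((y - x) \<bullet> i) + \<rho> * h \<le> h" by (simp add: algebra_simps)
        qed
        then show ?thesis unfolding K_def l_def
          by (intro subset_box_imp) (auto simp: inner_simps)
      qed
      have KE: "K \<inter> E = {}"
      proof -
        have "norm (z - y) \<le> e * h" if z: "z \<in> K" for z
        proof -
          have "\<bar>(z - y) \<bullet> i\<bar> \<le> \<rho> * h" if i: "i \<in> Basis" for i
          proof -
            have 1: "l \<bullet> i \<le> z \<bullet> i" "z \<bullet> i \<le> l \<bullet> i + \<rho> * h"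
              using z i by (auto simp: K_def mem_box inner_simps)
            have 2: "y \<bullet> i = l \<bullet> i + \<rho> * ((y - x) \<bullet> i)"
              by (simp add: l_def inner_simps algebra_simps)
            have "\<rho> * ((y - x) \<bullet> i) \<le> \<rho> * h" "0 \<le> \<rho> * ((y - x) \<bullet> i)"
              using yi[OF i] \<rho> by (auto intro: mult_left_mono)
            then show ?thesis unfolding inner_diff_left[of z y] abs_le_iff using 1 2 by linarith
          qed
          then have "(\<Sum>i\<in>Basis. \<bar>(z - y) \<bullet> i\<bar>) \<le> (\<Sum>i\<in>(Basis::'a set). \<rho> * h)"
            by (rule sum_mono)
          then have "norm (z - y) \<le> (\<Sum>i\<in>(Basis::'a set). \<rho> * h)"
            by (rule order_trans[OF norm_le_l1])
          also have "\<dots> = (\<rho> * ?n) * h" by simp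
          also have "\<dots> \<le> e * h" using \<rho>(3) h by (intro mult_right_mono) auto
          finally show ?thesis .
        qed
        then show ?thesis using contra by auto
      qed
      have "measure lebesgue (E \<inter> ?C) + measure lebesgue K = measure lebesgue ((E \<inter> ?C) \<union> K)"
      proof -
        have "(E \<inter> ?C) \<inter> K = {}" using KE by auto
        moreover have "K \<in> lmeasurable" by (simp add: K_def)
        ultimately show ?thesis
          using meas[of x "x + h *\<^sub>R One"] measure_Un3[of "E \<inter> ?C" lebesgue K] by simp
      qed
      also have "\<dots> \<le> measure lebesgue ?C"
        using KC meas by (intro measure_mono_fmeasurable) (auto simp: K_def)
      also have "measure lebesgue ?C = h ^ ?n"
        using h by (simp add: content_cbox_if box_ne_empty inner_simps)
      also have "measure lebesgue K = (\<rho> * h) ^ ?n"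
        using h \<rho> by (simp add: K_def content_cbox_if box_ne_empty inner_simps)
      finally have "measure lebesgue (E \<inter> ?C) / h ^ ?n \<le> 1 - \<rho> ^ ?n"
        using h by (simp add: field_simps power_mult_distrib)
      moreover have "\<bar>measure lebesgue (E \<inter> ?C) / h ^ ?n - 1\<bar> < \<rho> ^ ?n"
        using d(2)[OF h] x(1) integral_unique[OF int] by (simp add: divide_inverse mult.commute)
      ultimately show False by linarith
    qed
    then show "\<exists>d>0. \<forall>h y. 0 < h \<and> h < d \<and> y \<in> cbox x (x + h *\<^sub>R One) \<longrightarrow> (\<exists>z\<in>E. norm (z - y) \<le> e * h)"
      using d(1) by blast
  qed
qed

text \<open>The previous lemma for the reflected set. Both orientations are needed: walks along the
  axes go forward from x, while general increments are reached from a base point lying below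
  x.\<close>

lemma closed_dense_in_corner_cubes_reflected:
  fixes E :: "'a::euclidean_space set"
  assumes "closed E"
  obtains N where "negligible N"
    "\<And>x e. x \<in> E \<Longrightarrow> x \<notin> N \<Longrightarrow> 0 < e \<Longrightarrow>
       \<exists>d>0. \<forall>h y. 0 < h \<and> h < d \<and> y \<in> cbox (x - h *\<^sub>R One) x \<longrightarrow> (\<exists>z\<in>E. norm (z - y) \<le> e * h)"
proof -
  have "closed (uminus ` E)" using assms by (rule closed_negations)
  then obtain N where N: "negligible N"
    "\<And>x e. x \<in> uminus ` E \<Longrightarrow> x \<notin> N \<Longrightarrow> 0 < e \<Longrightarrow>
       \<exists>d>0. \<forall>h y. 0 < h \<and> h < d \<and> y \<in> cbox x (x + h *\<^sub>R One) \<longrightarrow> (\<exists>z\<in>uminus ` E. norm (z - y) \<le> e * h)"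
    by (rule closed_dense_in_corner_cubes) metis
  show thesis
  proof
    show "negligible (uminus ` N)"
      by (rule negligible_locally_Lipschitz_image[OF order_refl N(1)])
        (auto intro!: exI[of _ UNIV] exI[of _ 1] simp: norm_minus_commute)
    fix x :: 'a and e :: real assume x: "x \<in> E" "x \<notin> uminus ` N" and e: "0 < e"
    then obtain d where d: "d > 0" "\<And>h y. 0 < h \<Longrightarrow> h < d \<Longrightarrow> y \<in> cbox (-x) (-x + h *\<^sub>R One) \<Longrightarrow>
        \<exists>z\<in>uminus ` E. norm (z - y) \<le> e * h"
      using N(2)[of "-x" e] by (metis image_eqI minus_minus)
    have "\<exists>z\<in>E. norm (z - y) \<le> e * h" if h: "0 < h" "h < d" and y: "y \<in> cbox (x - h *\<^sub>R One) x" for h y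
    proof -
      have "- y \<in> cbox (-x) (-x + h *\<^sub>R One)"
        using y by (force simp: mem_box inner_simps)
      then obtain z where "z \<in> E" "norm (- z - (- y)) \<le> e * h" using d(2)[OF h] by blast
      then show ?thesis by (metis minus_diff_minus norm_minus_cancel)
    qed
    then show "\<exists>d>0. \<forall>h y. 0 < h \<and> h < d \<and> y \<in> cbox (x - h *\<^sub>R One) x \<longrightarrow> (\<exists>z\<in>E. norm (z - y) \<le> e * h)"
      using d(1) by blast
  qed
qed

text \<open>Freezing the approximate partial derivatives \<open>q\<close> on a closed set and moving along the
  coordinate axes from nearby points of that set, which exist at almost all of its points, turns
  one-sided partial differentiability into an estimate in all directions.\<close>

lemma uniform_partials_imp_approx_derivative:
  fixes f :: "'a::euclidean_space \<Rightarrow> real" and q :: 'a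
  assumes lip: "\<And>x y. \<bar>f x - f y\<bar> \<le> L * norm (x - y)" and "0 < \<epsilon>" "0 < \<delta>"
  defines "n \<equiv> real DIM('a)"
  shows "negligible {x. (\<forall>i\<in>Basis. \<forall>t\<in>{0..\<delta>}. \<bar>f (x + t *\<^sub>R i) - f x - t * (q \<bullet> i)\<bar> \<le> \<epsilon> * t) \<and>
     \<not> (\<exists>d>0. \<forall>h. norm h < d \<longrightarrow> \<bar>f (x + h) - f x - q \<bullet> h\<bar> \<le> ((4*n+3)*n*(2*L+1)) * \<epsilon> * norm h)}"
proof -
  have L0: "0 \<le> L" using lip[of "One" 0] norm_ge_zero[of "One::'a"]
    by (smt (verit, best) mult_neg_pos nonzero_Basis norm_eq_zero diff_zero One_non_0)
  have contf: "continuous_on S f" for S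
    using lipschitz_on_continuous_on[of L S f] lip L0 by (auto simp: lipschitz_on_def dist_norm)
  have contf': "continuous_on UNIV (\<lambda>x. f (g x))" if "continuous_on UNIV g" for g :: "'a \<Rightarrow> 'a"
    using continuous_on_compose2[OF contf[of UNIV] that] by simp
  define E where "E = {x. \<forall>i\<in>Basis. \<forall>t\<in>{0..\<delta>}. \<bar>f (x + t *\<^sub>R i) - f x - t * (q \<bullet> i)\<bar> \<le> \<epsilon> * t}"
  define K where "K = n * (2*L+1)"
  \<comment> \<open>The intermediate stage: the estimate for increments in the nonnegative orthant
    only. These sets are closed again, so density points can be used a second time.\<close>
  define E' where "E' d = {x. \<forall>h. (\<forall>i\<in>Basis. 0 \<le> h \<bullet> i) \<and> norm h \<le> d \<longrightarrow>
     \<bar>f (x + h) - f x - q \<bullet> h\<bar> \<le> K * \<epsilon> * norm h}" for d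
  have "E = (\<Inter>i\<in>Basis. \<Inter>t\<in>{0..\<delta>}. {x. \<bar>f (x + t *\<^sub>R i) - f x - t * (q \<bullet> i)\<bar> \<le> \<epsilon> * t})"
    by (auto simp: E_def)
  also have "closed \<dots>"
    by (intro closed_INT ballI closed_Collect_le continuous_intros contf' contf)
  finally have "closed E" .
  then obtain N where N: "negligible N"
    "\<And>x e. x \<in> E \<Longrightarrow> x \<notin> N \<Longrightarrow> 0 < e \<Longrightarrow>
       \<exists>d>0. \<forall>h y. 0 < h \<and> h < d \<and> y \<in> cbox x (x + h *\<^sub>R One) \<longrightarrow> (\<exists>z\<in>E. norm (z - y) \<le> e * h)"
    by (rule closed_dense_in_corner_cubes) metis
  have "closed (E' d)" for d
  proof -
    have "E' d = (\<Inter>h\<in>{h. (\<forall>i\<in>Basis. 0 \<le> h \<bullet> i) \<and> norm h \<le> d}.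
        {x. \<bar>f (x + h) - f x - q \<bullet> h\<bar> \<le> K * \<epsilon> * norm h})"
      by (auto simp: E'_def)
    also have "closed \<dots>"
      by (intro closed_INT ballI closed_Collect_le continuous_intros contf' contf)
    finally show ?thesis .
  qed
  then have "\<exists>N. negligible N \<and> (\<forall>x e. x \<in> E' d \<longrightarrow> x \<notin> N \<longrightarrow> 0 < e \<longrightarrow>
       (\<exists>\<delta>>0. \<forall>h y. 0 < h \<and> h < \<delta> \<and> y \<in> cbox (x - h *\<^sub>R One) x \<longrightarrow> (\<exists>z\<in>E' d. norm (z - y) \<le> e * h)))" for d
    by (rule closed_dense_in_corner_cubes_reflected[where E="E' d"]) metis
  then obtain N' where N': "\<And>d. negligible (N' d)"
    "\<And>d x e. x \<in> E' d \<Longrightarrow> x \<notin> N' d \<Longrightarrow> 0 < e \<Longrightarrow>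
       \<exists>\<delta>>0. \<forall>h y. 0 < h \<and> h < \<delta> \<and> y \<in> cbox (x - h *\<^sub>R One) x \<longrightarrow> (\<exists>z\<in>E' d. norm (z - y) \<le> e * h)"
    by metis
  have inE': "\<exists>d>0. x \<in> E' d" if x: "x \<in> E" "x \<notin> N" for x
  proof -
    obtain d where d: "d > 0" "\<And>h y. 0 < h \<Longrightarrow> h < d \<Longrightarrow> y \<in> cbox x (x + h *\<^sub>R One) \<Longrightarrow>
        \<exists>z\<in>E. norm (z - y) \<le> \<epsilon> * h"
      using N(2)[OF x \<open>0 < \<epsilon>\<close>] by blast
    define d' where "d' = min \<delta> (d/2)"
    have d': "0 < d'" "d' \<le> \<delta>" "d' < d" using d(1) \<open>0 < \<delta>\<close> by (auto simp: d'_def)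
    have "\<bar>f (x + h) - f x - q \<bullet> h\<bar> \<le> K * \<epsilon> * norm h"
      if h: "\<forall>i\<in>Basis. 0 \<le> h \<bullet> i" "norm h \<le> d'" for h
    proof (cases "h = 0")
      case False
      then have hp: "0 < norm h" by simp
      have hi: "h \<bullet> i \<le> norm h" if "i \<in> Basis" for i
        using Basis_le_norm[OF that, of h] by linarith
      \<comment> \<open>The corner reached after the axes in J. It need not lie in \<open>E\<close>,
        so the next move is compared with one from a point of \<open>E\<close> at distance at most
        \<epsilon> |h|; the exchange at both ends costs 2 L \<epsilon> |h|, the move itself
        \<epsilon> |h|.\<close>
      define y where "y J = x + (\<Sum>i\<in>J. (h \<bullet> i) *\<^sub>R i)" for J :: "'a set"
      have "\<bar>f (y J) - f x - (\<Sum>i\<in>J. (h \<bullet> i) * (q \<bullet> i))\<bar> \<le> real (card J) * ((2*L+1) * \<epsilon> * norm h)"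
        if "J \<subseteq> Basis" for J
      proof -
        have "finite J" using that finite_subset finite_Basis by blast
        then show ?thesis using that
        proof (induction J)
          case empty then show ?case by (simp add: y_def)
        next
          case (insert i J)
          have iB: "i \<in> Basis" and JB: "J \<subseteq> Basis" using insert by auto
          have yb: "y J \<bullet> b = x \<bullet> b + (if b \<in> J then h \<bullet> b else 0)" if "b \<in> Basis" for b
          proof -
            have "(\<Sum>i\<in>J. (h \<bullet> i) *\<^sub>R i) \<bullet> b = (\<Sum>i\<in>J. (h \<bullet> i) * (if i = b then 1 else 0))"
              unfolding inner_sum_left using JB that by (intro sum.cong) (auto simp: inner_Basis)
            then show ?thesis using insert.hyps(1) by (simp add: y_def inner_simps if_distrib sum.delta cong: if_cong)
          qed
          have "y J \<in> cbox x (x + norm h *\<^sub>R One)"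
            using h(1) hi by (auto simp: mem_box yb inner_simps)
          then obtain z where z: "z \<in> E" "norm (z - y J) \<le> \<epsilon> * norm h"
            using d(2)[OF hp] h(2) d' by fastforce
          have ins: "y (insert i J) = y J + (h \<bullet> i) *\<^sub>R i"
            using insert.hyps by (simp add: y_def algebra_simps)
          have 1: "\<bar>f (z + (h \<bullet> i) *\<^sub>R i) - f z - (h \<bullet> i) * (q \<bullet> i)\<bar> \<le> \<epsilon> * (h \<bullet> i)"
            using z(1) iB h hi[OF iB] d' unfolding E_def by force
          have 2: "\<bar>f (y J + (h \<bullet> i) *\<^sub>R i) - f (z + (h \<bullet> i) *\<^sub>R i)\<bar> \<le> L * (\<epsilon> * norm h)"
             "\<bar>f (y J) - f z\<bar> \<le> L * (\<epsilon> * norm h)"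
            using lip[of "y J + (h \<bullet> i) *\<^sub>R i" "z + (h \<bullet> i) *\<^sub>R i"] lip[of "y J" z]
              mult_left_mono[OF z(2) L0] by (auto simp: norm_minus_commute)
          have 3: "\<epsilon> * (h \<bullet> i) \<le> \<epsilon> * norm h" using hi[OF iB] \<open>0 < \<epsilon>\<close> by simp
          have "\<bar>f (y (insert i J)) - f x - (\<Sum>i\<in>insert i J. (h \<bullet> i) * (q \<bullet> i))\<bar>
              \<le> \<bar>f (y J) - f x - (\<Sum>i\<in>J. (h \<bullet> i) * (q \<bullet> i))\<bar> + (2*L+1) * \<epsilon> * norm h"
            using 1 2 3 insert.hyps unfolding ins by (simp add: algebra_simps abs_le_iff) argo
          also have "\<dots> \<le> real (card J) * ((2*L+1) * \<epsilon> * norm h) + (2*L+1) * \<epsilon> * norm h"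
            using insert.IH[OF JB] by simp
          finally show ?case using insert.hyps by (simp add: algebra_simps)
        qed
      qed
      moreover have "(\<Sum>i\<in>Basis. (h \<bullet> i) * (q \<bullet> i)) = q \<bullet> h"
        by (subst euclidean_inner) (simp add: mult.commute)
      ultimately show ?thesis
        using order_refl[of "Basis::'a set"] by (fastforce simp: y_def euclidean_representation K_def n_def mult.assoc)
    qed auto
    then show ?thesis using d'(1) by (auto simp: E'_def)
  qed
  have mono: "E' d \<subseteq> E' d'" if "d' \<le> d" for d d' using that by (auto simp: E'_def)
  have "{x. (\<forall>i\<in>Basis. \<forall>t\<in>{0..\<delta>}. \<bar>f (x + t *\<^sub>R i) - f x - t * (q \<bullet> i)\<bar> \<le> \<epsilon> * t) \<and>
     \<not> (\<exists>d>0. \<forall>h. norm h < d \<longrightarrow> \<bar>f (x + h) - f x - q \<bullet> h\<bar> \<le> ((4*n+3)*n*(2*L+1)) * \<epsilon> * norm h)}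
     \<subseteq> N \<union> (\<Union>m. N' (inverse (real (Suc m))))"
  proof (rule subsetI, rule ccontr)
    fix x assume "x \<in> {x. (\<forall>i\<in>Basis. \<forall>t\<in>{0..\<delta>}. \<bar>f (x + t *\<^sub>R i) - f x - t * (q \<bullet> i)\<bar> \<le> \<epsilon> * t) \<and>
     \<not> (\<exists>d>0. \<forall>h. norm h < d \<longrightarrow> \<bar>f (x + h) - f x - q \<bullet> h\<bar> \<le> ((4*n+3)*n*(2*L+1)) * \<epsilon> * norm h)}"
    then have xE: "x \<in> E" and
      contra: "\<not> (\<exists>d>0. \<forall>h. norm h < d \<longrightarrow> \<bar>f (x + h) - f x - q \<bullet> h\<bar> \<le> ((4*n+3)*n*(2*L+1)) * \<epsilon> * norm h)"
      by (auto simp: E_def)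
    assume xN: "x \<notin> N \<union> (\<Union>m. N' (inverse (real (Suc m))))"
    obtain d0 where "d0 > 0" "x \<in> E' d0" using inE'[OF xE] xN by auto
    \<comment> \<open>\<open>E'\<close> grows as the radius shrinks, so the radii 1/(m+1) suffice
      and keep the union of null sets countable.\<close>
    then obtain m where m: "inverse (real (Suc m)) < d0" using reals_Archimedean by blast
    define D where "D = inverse (real (Suc m))"
    have D0: "0 < D" by (simp add: D_def)
    have xE': "x \<in> E' D" using mono[of D d0] m \<open>x \<in> E' d0\<close> by (auto simp: D_def)
    have "x \<notin> N' D" using xN by (auto simp: D_def)
    then obtain d where d: "d > 0" "\<And>h y. 0 < h \<Longrightarrow> h < d \<Longrightarrow> y \<in> cbox (x - h *\<^sub>R One) x \<Longrightarrow>
        \<exists>z\<in>E' D. norm (z - y) \<le> 1/2 * h"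
      using N'(2)[OF xE', of "1/2"] by auto
    define d' where "d' = min (d/2) (D / (2*n+2))"
    have n0: "0 < n" by (simp add: n_def)
    have d': "0 < d'" using d(1) D0 n0 by (simp add: d'_def)
    have "\<bar>f (x + h) - f x - q \<bullet> h\<bar> \<le> ((4*n+3)*n*(2*L+1)) * \<epsilon> * norm h" if h: "norm h < d'" for h
    proof (cases "h = 0")
      case False
      then have hp: "0 < norm h" by simp
      \<comment> \<open>The base point z is sought near x - 2|h| (1,...,1): then x - z and x + h - z
        both lie in the nonnegative orthant, with lengths at most (2n+1)|h| and (2n+2)|h|. The sum
        of these is the factor 4n+3.\<close>
      have "2 * norm h < d" using h by (auto simp: d'_def)
      moreover have "x - (2 * norm h) *\<^sub>R One \<in> cbox (x - (2 * norm h) *\<^sub>R One) x"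
        by (auto simp: mem_box inner_simps)
      ultimately obtain z where z: "z \<in> E' D" "norm (z - (x - (2 * norm h) *\<^sub>R One)) \<le> norm h"
        using d(2)[of "2 * norm h"] hp by auto
      define s where "s = z - (x - (2 * norm h) *\<^sub>R One)"
      have zx: "x - z = (2 * norm h) *\<^sub>R One - s" by (simp add: s_def)
      have s: "norm s \<le> norm h" using z by (simp add: s_def)
      have si: "s \<bullet> i \<le> norm h" "- norm h \<le> h \<bullet> i" if "i \<in> Basis" for i
        using Basis_le_norm[OF that, of s] Basis_le_norm[OF that, of h] s by linarith+
      have zxi: "x \<bullet> i - z \<bullet> i = 2 * norm h - s \<bullet> i" if "i \<in> Basis" for i
        using arg_cong[OF zx, of "\<lambda>v. v \<bullet> i"] that by (simp add: inner_diff_left)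
      have pos: "\<forall>i\<in>Basis. 0 \<le> (x - z) \<bullet> i" "\<forall>i\<in>Basis. 0 \<le> (x + h - z) \<bullet> i"
        using si zxi by (auto simp: inner_diff_left inner_add_left) (smt (verit) norm_ge_zero)+
      have "norm (One::'a) \<le> n"
        unfolding n_def using norm_sum[of "\<lambda>i. i" "Basis::'a set"] by simp
      then have "(2 * norm h) * norm (One::'a) \<le> (2 * norm h) * n" by (intro mult_left_mono) auto
      then have nx: "norm (x - z) \<le> (2*n+1) * norm h"
        using norm_triangle_ineq4[of "(2 * norm h) *\<^sub>R One" s] s by (simp add: zx algebra_simps)
      then have nxh: "norm (x + h - z) \<le> (2*n+2) * norm h"
        using norm_triangle_ineq[of "x - z" h] by (simp add: algebra_simps)
      have "(2*n+2) * norm h \<le> D"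
        using h n0 by (simp add: d'_def field_simps)
      moreover have "(2*n+1) * norm h \<le> (2*n+2) * norm h" by (rule mult_right_mono) auto
      ultimately have "norm (x - z) \<le> D" "norm (x + h - z) \<le> D"
        using nx nxh by linarith+
      then have "\<bar>f (z + (x - z)) - f z - q \<bullet> (x - z)\<bar> \<le> K * \<epsilon> * norm (x - z)"
        "\<bar>f (z + (x + h - z)) - f z - q \<bullet> (x + h - z)\<bar> \<le> K * \<epsilon> * norm (x + h - z)"
        using z(1) pos unfolding E'_def by blast+
      moreover have "K * \<epsilon> * norm (x - z) \<le> K * \<epsilon> * ((2*n+1) * norm h)"
        "K * \<epsilon> * norm (x + h - z) \<le> K * \<epsilon> * ((2*n+2) * norm h)"
        using nx nxh L0 n0 \<open>0 < \<epsilon>\<close> by (auto simp: K_def intro: mult_left_mono)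
      moreover have "K * \<epsilon> * ((2*n+1) * norm h) + K * \<epsilon> * ((2*n+2) * norm h) = ((4*n+3)*n*(2*L+1)) * \<epsilon> * norm h"
        by (simp add: K_def algebra_simps)
      moreover have "q \<bullet> (x + h - z) - q \<bullet> (x - z) = q \<bullet> h" by (simp add: inner_simps)
      ultimately show ?thesis by (simp only: add_diff_cancel_left' diff_add_cancel add.commute[of z])
    qed auto
    then show False using contra d' by blast
  qed
  moreover have "negligible (N \<union> (\<Union>m. N' (inverse (real (Suc m)))))"
    using N(1) N'(1) by (intro negligible_Un negligible_countable_Union) auto
  ultimately show ?thesis by (rule negligible_subset[rotated])
qed

section \<open>Differentiability almost everywhere\<close>

text \<open>The slope may depend on the accuracy e, which is all that freezing approximate partial
  derivatives provides. Slopes for two accuracies differ by at most the sum of these, so they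
  converge, and the limit is the gradient.\<close>

lemma differentiable_if_approx_derivatives:
  fixes f :: "'a::euclidean_space \<Rightarrow> real"
  assumes approx: "\<And>e. 0 < e \<Longrightarrow> \<exists>q. \<exists>d>0. \<forall>h. norm h < d \<longrightarrow> \<bar>f (x + h) - f x - q \<bullet> h\<bar> \<le> e * norm h"
  shows "f differentiable (at x)"
proof -
  define \<epsilon> where "\<epsilon> m = inverse (real (Suc m))" for m
  have \<epsilon>: "0 < \<epsilon> m" for m by (simp add: \<epsilon>_def)
  have \<epsilon>0: "\<epsilon> \<longlonglongrightarrow> 0" unfolding \<epsilon>_def by (rule LIMSEQ_inverse_real_of_nat)
  obtain q d where d: "\<And>m. 0 < d m"
    and q: "\<And>m h. norm h < d m \<Longrightarrow> \<bar>f (x + h) - f x - q m \<bullet> h\<bar> \<le> \<epsilon> m * norm h"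
    using approx[OF \<epsilon>] by metis
  have dist: "norm (q m - q k) \<le> \<epsilon> m + \<epsilon> k" for m k
  proof (cases "q m = q k")
    case False
    \<comment> \<open>Both approximations are tested in the direction of the difference of their
      slopes.\<close>
    define v where "v = q m - q k"
    define t where "t = min (d m) (d k) / (2 * norm v)"
    have v: "0 < norm v" using False by (simp add: v_def)
    have t: "0 < t" using d v by (simp add: t_def)
    have tm: "norm (t *\<^sub>R v) < d m" and tk: "norm (t *\<^sub>R v) < d k"
      using d[of m] d[of k] v by (auto simp: t_def min_def)
    have "\<bar>(q m - q k) \<bullet> (t *\<^sub>R v)\<bar> \<le> (\<epsilon> m + \<epsilon> k) * norm (t *\<^sub>R v)"
      unfolding inner_diff_left distrib_right using q[OF tm] q[OF tk] by linarith
    then have "t * (norm v * norm v) \<le> (\<epsilon> m + \<epsilon> k) * (t * norm v)"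
      using t by (simp add: v_def[symmetric] dot_square_norm power2_eq_square)
    then have "(t * norm v) * norm v \<le> (t * norm v) * (\<epsilon> m + \<epsilon> k)" by (simp add: algebra_simps)
    then show ?thesis using t v by (simp add: v_def)
  qed (use \<epsilon>[of m] \<epsilon>[of k] in simp)
  have "Cauchy q"
  proof (rule metric_CauchyI)
    fix e :: real assume "0 < e"
    then have "\<forall>\<^sub>F m in sequentially. \<epsilon> m < e / 2" using \<epsilon>0 by (intro order_tendstoD) auto
    then obtain M where "\<And>m. m \<ge> M \<Longrightarrow> \<epsilon> m < e / 2" by (auto simp: eventually_sequentially)
    then show "\<exists>M. \<forall>m\<ge>M. \<forall>n\<ge>M. dist (q m) (q n) < e"
      using dist unfolding dist_norm by (smt (verit) field_sum_of_halves)
  qed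
  then obtain Q where Q: "q \<longlonglongrightarrow> Q" using Cauchy_convergent_iff convergent_def by blast
  have near: "norm (q m - Q) \<le> \<epsilon> m" for m
  proof (rule LIMSEQ_le)
    show "(\<lambda>k. norm (q m - q k)) \<longlonglongrightarrow> norm (q m - Q)" by (intro tendsto_intros Q)
    show "(\<lambda>k. \<epsilon> m + \<epsilon> k) \<longlonglongrightarrow> \<epsilon> m" using tendsto_add[OF tendsto_const \<epsilon>0, of "\<epsilon> m"] by simp
  qed (use dist in auto)
  have "(f has_derivative (\<lambda>h. Q \<bullet> h)) (at x)"
    unfolding has_derivative_at_alt
  proof (intro conjI allI impI)
    show "bounded_linear ((\<bullet>) Q)" by (rule bounded_linear_inner_right)
    fix e :: real assume "0 < e"
    then obtain m where m: "\<epsilon> m < e / 2" using reals_Archimedean[of "e/2"] by (auto simp: \<epsilon>_def)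
    have "norm (f y - f x - Q \<bullet> (y - x)) \<le> e * norm (y - x)" if "norm (y - x) < d m" for y
    proof -
      have "\<bar>f (x + (y - x)) - f x - q m \<bullet> (y - x)\<bar> \<le> \<epsilon> m * norm (y - x)" by (rule q[OF that])
      moreover have "\<bar>(q m - Q) \<bullet> (y - x)\<bar> \<le> \<epsilon> m * norm (y - x)"
        by (rule order_trans[OF Cauchy_Schwarz_ineq2]) (simp add: near mult_right_mono)
      moreover have "\<epsilon> m * norm (y - x) + \<epsilon> m * norm (y - x) \<le> e * norm (y - x)"
        unfolding distrib_right[symmetric] using m by (intro mult_right_mono) auto
      ultimately show ?thesis by (simp add: inner_diff_left)
    qed
    then show "\<exists>d>0. \<forall>y. norm (y - x) < d \<longrightarrow> norm (f y - f x - Q \<bullet> (y - x)) \<le> e * norm (y - x)"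
      using d by blast
  qed
  then show ?thesis by (auto simp: differentiable_def)
qed

text \<open>Rational slopes and the scales 1/(m+1) make all data countable: almost every point lies,
  for each axis and accuracy, in one of the sets \<open>E i m q n\<close>, and the exceptional sets
  \<open>Z q m n\<close> of the axis-walking argument form a countable family.\<close>

theorem rademacher_real:
  fixes f :: "'a::euclidean_space \<Rightarrow> real"
  assumes lip: "\<And>x y. \<bar>f x - f y\<bar> \<le> L * norm (x - y)"
  shows "negligible {x. \<not> f differentiable (at x)}"
proof -
  obtain b :: 'a where "b \<in> Basis" using nonempty_Basis by blast
  then have L0: "0 \<le> L" using lip[of b 0] by auto
  have contf: "continuous_on S f" for S
    using lipschitz_on_continuous_on[of L S f] lip L0 by (auto simp: lipschitz_on_def dist_norm)
  have contf': "continuous_on UNIV (\<lambda>x. f (g x))" if "continuous_on UNIV g" for g :: "'a \<Rightarrow> 'a"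
    using continuous_on_compose2[OF contf[of UNIV] that] by simp
  define \<epsilon> where "\<epsilon> m = inverse (real (Suc m))" for m
  have \<epsilon>: "0 < \<epsilon> m" for m by (simp add: \<epsilon>_def)
  define E where "E i m q n = {x. \<forall>t\<in>{0..\<epsilon> n}. \<bar>f (x + t *\<^sub>R i) - f x - t * q\<bar> \<le> \<epsilon> m * t}" for i m q n
  define P where "P i x \<longleftrightarrow> (\<forall>m. \<exists>q\<in>\<rat>. \<exists>n. x \<in> E i m q n)" for i x
  have "closed (E i m q n)" for i m q n
  proof -
    have "E i m q n = (\<Inter>t\<in>{0..\<epsilon> n}. {x. \<bar>f (x + t *\<^sub>R i) - f x - t * q\<bar> \<le> \<epsilon> m * t})"
      by (auto simp: E_def)
    also have "closed \<dots>"
      by (intro closed_INT ballI closed_Collect_le continuous_intros contf' contf)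
    finally show ?thesis .
  qed
  then have [measurable]: "E i m q n \<in> sets borel" for i m q n by (rule borel_closed)
  have P_meas: "Measurable.pred borel (P i)" for i
  proof -
    have "{x. P i x} = (\<Inter>m. \<Union>q\<in>\<rat>. \<Union>n. E i m q n)" by (auto simp: P_def)
    also have "\<dots> \<in> sets borel"
    proof (rule sets.countable_INT'')
      show "(\<Union>q\<in>\<rat>. \<Union>n. E i m q n) \<in> sets borel" for m
        by (rule sets.countable_UN''[OF countable_rat]) auto
    qed auto
    finally show ?thesis by (simp add: pred_def)
  qed
  \<comment> \<open>On each line parallel to i the function is Lipschitz in one variable, where
    right-hand quotients converge for almost every parameter.\<close>
  have "AE x in lborel. P i x" for i
    unfolding AE_lborel_lines[OF P_meas, of i i, symmetric]
  proof (rule AE_I2)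
    fix y :: 'a
    have "\<bar>f (y + s *\<^sub>R i) - f (y + t *\<^sub>R i)\<bar> \<le> L * norm i * \<bar>s - t\<bar>" for s t
      using lip[of "y + s *\<^sub>R i" "y + t *\<^sub>R i"] by (simp add: scaleR_diff_left[symmetric] mult_ac)
    then obtain h N where N: "negligible N" and h: "\<And>t e. t \<notin> N \<Longrightarrow> 0 < e \<Longrightarrow>
        \<exists>d>0. \<forall>s. 0 < s \<and> s < d \<longrightarrow> \<bar>(f (y + (t + s) *\<^sub>R i) - f (y + t *\<^sub>R i)) / s - h t\<bar> < e"
      by (rule lipschitz_real_density) metis
    have "P i (y + t *\<^sub>R i)" if t: "t \<notin> N" for t
      unfolding P_def
    proof
      fix m
      obtain d where d: "d > 0"
        "\<And>s. 0 < s \<Longrightarrow> s < d \<Longrightarrow> \<bar>(f (y + (t + s) *\<^sub>R i) - f (y + t *\<^sub>R i)) / s - h t\<bar> < \<epsilon> m / 2"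
        using h[OF t, of "\<epsilon> m / 2"] \<epsilon>[of m] by auto
      obtain q where q: "q \<in> \<rat>" "h t < q" "q < h t + \<epsilon> m / 2"
        using Rats_dense_in_real[of "h t" "h t + \<epsilon> m / 2"] \<epsilon>[of m] by auto
      obtain n where n: "\<epsilon> n < d" using reals_Archimedean[OF d(1)] by (auto simp: \<epsilon>_def)
      have "\<bar>f (y + t *\<^sub>R i + s *\<^sub>R i) - f (y + t *\<^sub>R i) - s * q\<bar> \<le> \<epsilon> m * s" if s: "0 \<le> s" "s \<le> \<epsilon> n" for s
      proof (cases "s = 0")
        case False
        then have s0: "0 < s" using s by simp
        let ?X = "f (y + (t + s) *\<^sub>R i) - f (y + t *\<^sub>R i)"
        have "\<bar>?X / s - q\<bar> \<le> \<epsilon> m" using d(2)[OF s0] s n q by linarith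
        then have "\<bar>?X / s - q\<bar> * s \<le> \<epsilon> m * s" using s0 by simp
        moreover have "\<bar>?X / s - q\<bar> * s = \<bar>?X - s * q\<bar>"
        proof -
          have "?X - s * q = (?X / s - q) * s" using s0 by (simp only: left_diff_distrib) simp
          then show ?thesis using s0 by (simp add: abs_mult)
        qed
        ultimately show ?thesis by (simp add: scaleR_add_left add.assoc)
      qed simp
      then have "y + t *\<^sub>R i \<in> E i m q n" by (simp add: E_def)
      then show "\<exists>q\<in>\<rat>. \<exists>n. y + t *\<^sub>R i \<in> E i m q n" using q(1) by blast
    qed
    then have "AE t in lebesgue. P i (y + t *\<^sub>R i)"
      using N unfolding eventually_ae_filter_negligible by blast
    then show "AE t in lborel. P i (y + t *\<^sub>R i)" by (simp add: AE_completion_iff)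
  qed
  then have "AE x in lebesgue. \<forall>i\<in>Basis. P i x"
    by (simp add: AE_ball_countable countable_finite AE_completion)
  then obtain N where N: "negligible N" "\<And>x i. x \<notin> N \<Longrightarrow> i \<in> Basis \<Longrightarrow> P i x"
    unfolding eventually_ae_filter_negligible by blast
  define C where "C = (4 * real DIM('a) + 3) * real DIM('a) * (2*L+1)"
  have C0: "0 < C" using L0 unfolding C_def by (intro mult_pos_pos add_nonneg_pos) auto
  define R :: "'a set" where "R = (\<lambda>r. \<Sum>i\<in>Basis. r i *\<^sub>R i) ` (Basis \<rightarrow>\<^sub>E \<rat>)"
  have "countable R" unfolding R_def by (intro countable_image countable_PiE) (auto simp: countable_rat)
  define Z where "Z q m n = {x. (\<forall>i\<in>Basis. \<forall>t\<in>{0..\<epsilon> n}. \<bar>f (x + t *\<^sub>R i) - f x - t * (q \<bullet> i)\<bar> \<le> \<epsilon> m * t) \<and>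
     \<not> (\<exists>d>0. \<forall>h. norm h < d \<longrightarrow> \<bar>f (x + h) - f x - q \<bullet> h\<bar> \<le> C * \<epsilon> m * norm h)}" for q m n
  have Z: "negligible (Z q m n)" for q m n
    unfolding Z_def C_def by (rule uniform_partials_imp_approx_derivative[OF lip \<epsilon> \<epsilon>])
  have "{x. \<not> f differentiable (at x)} \<subseteq> N \<union> (\<Union>q\<in>R. \<Union>m. \<Union>n. Z q m n)"
  proof (rule subsetI, rule ccontr)
    fix x assume "x \<in> {x. \<not> f differentiable (at x)}"
    assume x: "x \<notin> N \<union> (\<Union>q\<in>R. \<Union>m. \<Union>n. Z q m n)"
    have "\<exists>q. \<exists>d>0. \<forall>h. norm h < d \<longrightarrow> \<bar>f (x + h) - f x - q \<bullet> h\<bar> \<le> e * norm h" if "0 < e" for e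
    proof -
      obtain m where m: "\<epsilon> m < e / C" using reals_Archimedean[of "e / C"] \<open>0 < e\<close> C0 by (auto simp: \<epsilon>_def)
      have "\<exists>q n. q \<in> \<rat> \<and> x \<in> E i m q n" if "i \<in> Basis" for i
      proof -
        have "P i x" using N(2)[OF _ that] x by simp
        then have "\<exists>q\<in>\<rat>. \<exists>n. x \<in> E i m q n" unfolding P_def by (rule spec)
        then show ?thesis by blast
      qed
      then obtain r k where rk: "\<And>i. i \<in> Basis \<Longrightarrow> r i \<in> \<rat>" "\<And>i. i \<in> Basis \<Longrightarrow> x \<in> E i m (r i) (k i)"
        by metis
      \<comment> \<open>A common radius for all axes: \<epsilon> is decreasing, so the largest index
        gives the smallest one.\<close>
      define n where "n = Max (k ` Basis)"
      define q where "q = (\<Sum>i\<in>Basis. r i *\<^sub>R i)"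
      have "q = (\<Sum>i\<in>Basis. (restrict r Basis i) *\<^sub>R i)" unfolding q_def by (rule sum.cong) auto
      then have "q \<in> R" unfolding R_def by (rule image_eqI[where x="restrict r Basis"]) (use rk(1) in auto)
      have qi: "q \<bullet> i = r i" if "i \<in> Basis" for i using that by (simp add: q_def inner_sum_left_Basis)
      have "\<epsilon> n \<le> \<epsilon> (k i)" if "i \<in> Basis" for i
        unfolding \<epsilon>_def using that by (intro le_imp_inverse_le) (auto simp: n_def)
      then have "\<bar>f (x + t *\<^sub>R i) - f x - t * (q \<bullet> i)\<bar> \<le> \<epsilon> m * t" if "i \<in> Basis" "t \<in> {0..\<epsilon> n}" for i t
        using rk(2)[OF that(1)] qi[OF that(1)] that order_trans[of t "\<epsilon> n" "\<epsilon> (k i)"] unfolding E_def by simp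
      moreover have "x \<notin> Z q m n" using x \<open>q \<in> R\<close> by blast
      ultimately obtain d where d: "d > 0" "\<And>h. norm h < d \<Longrightarrow> \<bar>f (x + h) - f x - q \<bullet> h\<bar> \<le> C * \<epsilon> m * norm h"
        unfolding Z_def mem_Collect_eq by blast
      have "C * \<epsilon> m \<le> e" using m C0 by (simp add: field_simps)
      then have *: "C * \<epsilon> m * norm h \<le> e * norm h" for h :: 'a
        by (rule mult_right_mono) simp
      have "\<forall>h. norm h < d \<longrightarrow> \<bar>f (x + h) - f x - q \<bullet> h\<bar> \<le> e * norm h"
        by (intro allI impI) (rule order_trans[OF d(2) *])
      then show ?thesis using d(1) by blast
    qed
    then have "f differentiable (at x)" by (rule differentiable_if_approx_derivatives)
    then show False using \<open>x \<in> {x. \<not> f differentiable (at x)}\<close> by simp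
  qed
  moreover have "negligible (N \<union> (\<Union>q\<in>R. \<Union>m. \<Union>n. Z q m n))"
  proof -
    have "negligible (\<Union>m. \<Union>n. Z q m n)" for q
      using Z by (intro negligible_countable_Union) (auto intro!: negligible_countable_Union)
    then show ?thesis
      using N(1) \<open>countable R\<close> by (intro negligible_Un negligible_countable_Union) auto
  qed
  ultimately show ?thesis by (rule negligible_subset[rotated])
qed

theorem rademacher:
  fixes f :: "'a::euclidean_space \<Rightarrow> 'b::euclidean_space"
  assumes lip: "\<And>x y. norm (f x - f y) \<le> L * norm (x - y)"
  shows "negligible {x. \<not> f differentiable (at x)}"
proof -
  have "\<bar>f x \<bullet> i - f y \<bullet> i\<bar> \<le> L * norm (x - y)" if "i \<in> Basis" for i x y
    using Basis_le_norm[OF that, of "f x - f y"] lip[of x y] by (simp add: inner_diff_left)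
  then have "negligible {x. \<not> (\<lambda>x. f x \<bullet> i) differentiable (at x)}" if "i \<in> Basis" for i
    using that by (intro rademacher_real) auto
  moreover have "{x. \<not> f differentiable (at x)} = (\<Union>i\<in>Basis. {x. \<not> (\<lambda>x. f x \<bullet> i) differentiable (at x)})"
    by (subst differentiable_componentwise_within) auto
  ultimately show ?thesis by (auto intro!: negligible_Union)
qed

section \<open>Increments of Lipschitz maps and symmetry of second derivatives\<close>

text \<open>A mean value inequality that sees only points of differentiability. On almost every line
  parallel to d these have full measure, and the increment is the integral of a derivative bounded
  below by K. The line through x itself may miss them all, so the bound is carried over from nearby
  lines by continuity.\<close>

lemma lipschitz_increment_lower_bound:
  fixes f :: "'a::euclidean_space \<Rightarrow> 'b::euclidean_space"
  assumes lip: "\<And>x y. norm (f x - f y) \<le> L * norm (x - y)"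
    and deriv: "\<And>x f'. (f has_derivative f') (at x) \<Longrightarrow> K \<le> f' d \<bullet> z"
  shows "K \<le> (f (x + d) - f x) \<bullet> z"
proof -
  obtain b :: 'a where "b \<in> Basis" using nonempty_Basis by blast
  then have L0: "0 \<le> L" using order_trans[OF norm_ge_zero lip[of b 0]] by simp
  have "AE x in lebesgue. f differentiable (at x)"
    using rademacher[OF lip] unfolding eventually_ae_filter_negligible by blast
  then have "AE x in lborel. f differentiable (at x)" by (simp add: AE_completion_iff)
  then obtain N where N: "{x \<in> space lborel. \<not> f differentiable (at x)} \<subseteq> N" "N \<in> sets lborel" "emeasure lborel N = 0"
    by (rule AE_E)
  have pm: "Measurable.pred borel (\<lambda>x. x \<notin> N)" using N(2) by simp
  have "AE x in lborel. x \<notin> N" using N by (intro AE_not_in) auto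
  then have lines: "AE y in lborel. AE t in lborel. y + (t::real) *\<^sub>R d \<notin> N"
    by (simp only: AE_lborel_lines[OF pm])
  have *: "K \<le> (f (y + d) - f y) \<bullet> z" if y: "AE t in lborel. y + (t::real) *\<^sub>R d \<notin> N" for y
  proof -
    define g where "g t = f (y + t *\<^sub>R d) \<bullet> z" for t
    have "\<bar>g s - g t\<bar> \<le> (L * norm d * norm z) * \<bar>s - t\<bar>" for s t
    proof -
      have "\<bar>g s - g t\<bar> \<le> norm (f (y + s *\<^sub>R d) - f (y + t *\<^sub>R d)) * norm z"
        unfolding g_def inner_diff_left[symmetric] by (rule Cauchy_Schwarz_ineq2)
      also have "\<dots> \<le> (L * norm (s *\<^sub>R d - t *\<^sub>R d)) * norm z"
        using lip[of "y + s *\<^sub>R d" "y + t *\<^sub>R d"] by (intro mult_right_mono) auto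
      finally show ?thesis by (simp add: scaleR_diff_left[symmetric] mult_ac)
    qed
    then obtain h N1 where N1: "negligible N1" and
      hint: "\<And>a b. a \<le> b \<Longrightarrow> (h has_integral (g b - g a)) {a..b}" and
      h: "\<And>t e. t \<notin> N1 \<Longrightarrow> 0 < e \<Longrightarrow> \<exists>d>0. \<forall>s. 0 < s \<and> s < d \<longrightarrow> \<bar>(g (t + s) - g t) / s - h t\<bar> < e"
      by (rule lipschitz_real_density) metis
    have "AE t in lebesgue. y + (t::real) *\<^sub>R d \<notin> N" using y by (rule AE_completion)
    then obtain N2 where N2: "negligible N2" "\<And>t. t \<notin> N2 \<Longrightarrow> y + t *\<^sub>R d \<notin> N"
      unfolding eventually_ae_filter_negligible by blast
    \<comment> \<open>\<open>h t\<close> is a limit of right-hand quotients, which at a point of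
      differentiability also tend to the directional derivative.\<close>
    have hK: "K \<le> h t" if t: "t \<notin> N1" "t \<notin> N2" for t
    proof (rule ccontr)
      assume c: "\<not> K \<le> h t"
      have "f differentiable (at (y + t *\<^sub>R d))" using N(1) N2(2)[OF t(2)] by auto
      then obtain f' where f': "(f has_derivative f') (at (y + t *\<^sub>R d))" by (auto simp: differentiable_def)
      have lin: "linear f'" using f' by (rule has_derivative_linear)
      have "((\<lambda>t. y + t *\<^sub>R d) has_derivative (\<lambda>s. s *\<^sub>R d)) (at t)"
        by (auto intro!: derivative_eq_intros)
      then have "((\<lambda>t. f (y + t *\<^sub>R d)) has_derivative (\<lambda>s. f' (s *\<^sub>R d))) (at t)"
        using diff_chain_at[of "\<lambda>t. y + t *\<^sub>R d" _ t f f'] f' by (simp add: o_def)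
      then have "(g has_derivative (\<lambda>s. f' (s *\<^sub>R d) \<bullet> z)) (at t)"
        unfolding g_def by (rule has_derivative_inner_left)
      then have "(g has_real_derivative (f' d \<bullet> z)) (at t)"
        using lin by (simp add: has_field_derivative_def linear_cmul mult_commute_abs)
      then have "(\<lambda>s. (g (t + s) - g t) / s) \<midarrow>0\<rightarrow> f' d \<bullet> z" by (simp add: DERIV_def)
      moreover have "(K + h t) / 2 < f' d \<bullet> z" using deriv[OF f'] c by simp
      ultimately have "\<forall>\<^sub>F s in at 0. (K + h t) / 2 < (g (t + s) - g t) / s" by (rule order_tendstoD)
      then obtain d1 where d1: "d1 > 0" "\<And>s. s \<noteq> 0 \<Longrightarrow> \<bar>s\<bar> < d1 \<Longrightarrow> (K + h t) / 2 < (g (t + s) - g t) / s"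
        by (auto simp: eventually_at)
      obtain d2 where d2: "d2 > 0" "\<And>s. 0 < s \<Longrightarrow> s < d2 \<Longrightarrow> \<bar>(g (t + s) - g t) / s - h t\<bar> < (K - h t) / 2"
        using h[OF t(1), of "(K - h t) / 2"] c by auto
      define s where "s = min d1 d2 / 2"
      have "0 < s" "s < d1" "s < d2" using d1 d2 by (auto simp: s_def)
      then show False using d1(2)[of s] d2(2)[of s] by (auto simp: abs_less_iff add_divide_distrib diff_divide_distrib)
    qed
    have h_int: "((\<lambda>t. if t \<in> N1 \<union> N2 then K else h t) has_integral (g 1 - g 0)) {0..1}"
      by (rule has_integral_spike[OF negligible_Un[OF N1 N2(1)] _ hint]) auto
    have K_int: "((\<lambda>t. K) has_integral K) {0..1::real}"
      using has_integral_const_real[of K 0 1] by simp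
    have "K \<le> g 1 - g 0"
      by (rule has_integral_le[OF K_int h_int]) (simp add: hK)
    then show ?thesis by (simp add: g_def inner_diff_left)
  qed
  have "K \<le> (f (x + d) - f x) \<bullet> z + e" if e: "0 < e" for e
  proof -
    \<comment> \<open>Moving from x to y changes the increment by at most 2 L r |z|; the summand 1
      keeps the denominator positive.\<close>
    define r where "r = e / (2 * L * norm z + 1)"
    have den: "0 < 2 * L * norm z + 1" using L0 by (simp add: add_nonneg_pos)
    have r: "0 < r" using e den by (simp add: r_def)
    have "\<not> ball x r \<subseteq> {y. \<not> (AE t in lborel. y + (t::real) *\<^sub>R d \<notin> N)}"
    proof
      assume *: "ball x r \<subseteq> {y. \<not> (AE t in lborel. y + (t::real) *\<^sub>R d \<notin> N)}"
      have "AE y in lebesgue. AE t in lborel. y + (t::real) *\<^sub>R d \<notin> N" using lines by (rule AE_completion)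
      then obtain N3 where "negligible N3" "{y. \<not> (AE t in lborel. y + (t::real) *\<^sub>R d \<notin> N)} \<subseteq> N3"
        unfolding eventually_ae_filter_negligible by blast
      then have "negligible (ball x r)"
        using * by (meson negligible_subset)
      then show False using open_not_negligible[of "ball x r"] r by auto
    qed
    then obtain y where y: "y \<in> ball x r" "AE t in lborel. y + (t::real) *\<^sub>R d \<notin> N" by blast
    have nr: "norm (y - x) \<le> r" using y(1) by (simp add: dist_norm norm_minus_commute)
    have "\<bar>((f (y + d) - f (x + d)) - (f y - f x)) \<bullet> z\<bar> \<le> norm ((f (y + d) - f (x + d)) - (f y - f x)) * norm z"
      by (rule Cauchy_Schwarz_ineq2)
    also have "\<dots> \<le> (L * r + L * r) * norm z"
    proof (rule mult_right_mono[OF order_trans[OF norm_triangle_ineq4 add_mono] norm_ge_zero])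
      show "norm (f (y + d) - f (x + d)) \<le> L * r"
        using lip[of "y+d" "x+d"] mult_left_mono[OF nr L0] by simp
      show "norm (f y - f x) \<le> L * r" using lip[of y x] mult_left_mono[OF nr L0] by simp
    qed
    also have "\<dots> = (2 * L * norm z) * r" by simp
    also have "\<dots> \<le> (2 * L * norm z + 1) * r" using r by simp
    also have "\<dots> = e" using den by (simp add: r_def)
    finally show ?thesis using *[OF y(2)] by (simp add: inner_simps abs_le_iff)
  qed
  then show ?thesis by (rule field_le_epsilon)
qed

lemma gradient_along_line:
  assumes grad: "\<And>w. (\<phi> has_derivative (\<lambda>h. G w \<bullet> h)) (at w)"
  shows "((\<lambda>s. \<phi> (y + s *\<^sub>R a)) has_real_derivative G (y + s *\<^sub>R a) \<bullet> a) (at s)"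
proof -
  have "((\<lambda>s. y + s *\<^sub>R a) has_derivative (\<lambda>s. s *\<^sub>R a)) (at s)"
    by (auto intro!: derivative_eq_intros)
  then have "((\<lambda>s. \<phi> (y + s *\<^sub>R a)) has_derivative (\<lambda>h. G (y + s *\<^sub>R a) \<bullet> (h *\<^sub>R a))) (at s)"
    using diff_chain_at[of "\<lambda>s. y + s *\<^sub>R a" _ s \<phi>] grad by (fastforce simp: o_def)
  then show ?thesis by (simp add: has_field_derivative_def mult_commute_abs)
qed

text \<open>The second difference \<open>D a b t\<close> is symmetric in a and b and equals t^2
  times \<open>W b \<bullet> a\<close> up to o(t^2). Differentiability of \<open>G\<close> at the
  single point x suffices; this matters because it is available only almost everywhere.\<close>

lemma gradient_derivative_symmetric:
  fixes \<phi> :: "'a::euclidean_space \<Rightarrow> real"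
  assumes grad: "\<And>w. (\<phi> has_derivative (\<lambda>h. G w \<bullet> h)) (at w)"
    and G': "(G has_derivative W) (at x)"
  shows "W a \<bullet> b = W b \<bullet> a"
proof -
  have lin: "linear W" using G' by (rule has_derivative_linear)
  define D where "D a b t = \<phi> (x + t *\<^sub>R a + t *\<^sub>R b) - \<phi> (x + t *\<^sub>R a) - \<phi> (x + t *\<^sub>R b) + \<phi> x" for a b t
  have D_sym: "D a b t = D b a t" for a b t by (simp add: D_def add_ac)
  have key: "\<exists>d>0. \<forall>t. 0 < t \<and> t < d \<longrightarrow> \<bar>D a b t - t\<^sup>2 * (W b \<bullet> a)\<bar> \<le> e * t\<^sup>2" if e: "0 < e" for a b e
  proof -
    define M where "M = norm a + norm b"
    have M0: "0 \<le> M" by (simp add: M_def)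
    define e' where "e' = e / (2 * M * norm a + 1)"
    have den: "0 < 2 * M * norm a + 1" using M0 by (simp add: add_nonneg_pos)
    have e': "0 < e'" using e den by (simp add: e'_def)
    obtain d0 where d0: "d0 > 0" "\<And>y. norm (y - x) < d0 \<Longrightarrow> norm (G y - G x - W (y - x)) \<le> e' * norm (y - x)"
      using G' e' unfolding has_derivative_at_alt by blast
    define d where "d = d0 / (M + 1)"
    have "\<bar>D a b t - t\<^sup>2 * (W b \<bullet> a)\<bar> \<le> e * t\<^sup>2" if t: "0 < t" "t < d" for t
    proof -
      have tM: "t * M < d0" using t M0 d0 by (simp add: d_def field_simps)
      \<comment> \<open>The mean value theorem is applied along a only; the step along b then
        appears as a difference of gradients, expanded to first order at x.\<close>
      define \<psi> where "\<psi> s = \<phi> (x + s *\<^sub>R a + t *\<^sub>R b) - \<phi> (x + s *\<^sub>R a)" for s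
      have "(\<psi> has_real_derivative (G (x + s *\<^sub>R a + t *\<^sub>R b) - G (x + s *\<^sub>R a)) \<bullet> a) (at s)" for s
        using DERIV_diff[OF gradient_along_line[OF grad, of "x + t *\<^sub>R b" a s] gradient_along_line[OF grad, of x a s]]
        by (simp add: \<psi>_def[abs_def] inner_diff_left add_ac)
      then obtain s where s: "0 < s" "s < t"
        "\<psi> t - \<psi> 0 = (t - 0) * ((G (x + s *\<^sub>R a + t *\<^sub>R b) - G (x + s *\<^sub>R a)) \<bullet> a)"
        using MVT2[of 0 t \<psi> "\<lambda>s. (G (x + s *\<^sub>R a + t *\<^sub>R b) - G (x + s *\<^sub>R a)) \<bullet> a"] t(1) by blast
      have n1: "norm (s *\<^sub>R a + t *\<^sub>R b) \<le> t * M"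
        using norm_triangle_ineq[of "s *\<^sub>R a" "t *\<^sub>R b"] s t mult_right_mono[of s t "norm a"]
        by (simp add: M_def algebra_simps)
      have n2: "norm (s *\<^sub>R a) \<le> t * M"
        using s t mult_mono[of s t "norm a" M] by (simp add: M_def)
      have "norm (G (x + s *\<^sub>R a + t *\<^sub>R b) - G x - W (s *\<^sub>R a + t *\<^sub>R b)) \<le> e' * (t * M)"
        using order_trans[OF d0(2)[of "x + (s *\<^sub>R a + t *\<^sub>R b)"] mult_left_mono[of _ "t * M" e']] n1 tM e' by (simp add: add.assoc)
      moreover have "norm (G (x + s *\<^sub>R a) - G x - W (s *\<^sub>R a)) \<le> e' * (t * M)"
        using order_trans[OF d0(2)[of "x + s *\<^sub>R a"] mult_left_mono[of _ "t * M" e']] n2 tM e' by simp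
      ultimately have "norm ((G (x + s *\<^sub>R a + t *\<^sub>R b) - G x - W (s *\<^sub>R a + t *\<^sub>R b)) - (G (x + s *\<^sub>R a) - G x - W (s *\<^sub>R a)))
          \<le> e' * (t * M) + e' * (t * M)"
        by (rule order_trans[OF norm_triangle_ineq4 add_mono])
      then have err: "norm (G (x + s *\<^sub>R a + t *\<^sub>R b) - G (x + s *\<^sub>R a) - t *\<^sub>R W b) \<le> 2 * e' * t * M"
        using lin by (simp add: linear_add linear_cmul algebra_simps)
      have "D a b t - t\<^sup>2 * (W b \<bullet> a) = t * ((G (x + s *\<^sub>R a + t *\<^sub>R b) - G (x + s *\<^sub>R a) - t *\<^sub>R W b) \<bullet> a)"
        using s(3) by (simp add: D_def \<psi>_def inner_diff_left power2_eq_square algebra_simps)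
      also have "\<bar>\<dots>\<bar> \<le> t * ((2 * e' * t * M) * norm a)"
        using t(1) order_trans[OF Cauchy_Schwarz_ineq2 mult_right_mono[OF err norm_ge_zero], of a]
        by (simp add: abs_mult mult.assoc)
      also have "\<dots> = (2 * M * norm a) * e' * t\<^sup>2" by (simp add: power2_eq_square)
      also have "\<dots> \<le> (2 * M * norm a + 1) * e' * t\<^sup>2" using e' by (intro mult_right_mono) auto
      also have "(2 * M * norm a + 1) * e' = e" using den by (simp add: e'_def)
      finally show ?thesis .
    qed
    moreover have "d > 0" using d0 M0 by (simp add: d_def)
    ultimately show ?thesis by blast
  qed
  have "\<bar>W a \<bullet> b - W b \<bullet> a\<bar> \<le> 0 + e" if e: "0 < e" for e
  proof -
    obtain d1 d2 where d: "d1 > 0" "d2 > 0"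
       "\<And>t. 0 < t \<Longrightarrow> t < d1 \<Longrightarrow> \<bar>D a b t - t\<^sup>2 * (W b \<bullet> a)\<bar> \<le> e / 2 * t\<^sup>2"
       "\<And>t. 0 < t \<Longrightarrow> t < d2 \<Longrightarrow> \<bar>D b a t - t\<^sup>2 * (W a \<bullet> b)\<bar> \<le> e / 2 * t\<^sup>2"
      using key[of "e/2" a b] key[of "e/2" b a] e by auto
    define t where "t = min d1 d2 / 2"
    have t: "0 < t" "t < d1" "t < d2" using d by (auto simp: t_def)
    have "\<bar>t\<^sup>2 * (W a \<bullet> b) - t\<^sup>2 * (W b \<bullet> a)\<bar> \<le> e * t\<^sup>2"
      using d(3)[OF t(1,2)] d(4)[OF t(1,3)] D_sym[of a b t] by linarith
    then have "t\<^sup>2 * \<bar>W a \<bullet> b - W b \<bullet> a\<bar> \<le> t\<^sup>2 * e"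
      by (simp only: right_diff_distrib[symmetric] abs_mult mult.commute[of e]) simp
    then show ?thesis using t(1) by simp
  qed
  then show ?thesis using field_le_epsilon[of "\<bar>W a \<bullet> b - W b \<bullet> a\<bar>" 0] by simp
qed

section \<open>Lagrange multipliers and optimality conditions\<close>

text \<open>Separation of 0 from the pairs (constraint value, level above f - m). The normal is
  taken inside \<open>span K\<close>: if its last component b vanished, the relative interior point
  would force it to annihilate \<open>K\<close>, hence itself. Dividing by b gives the
  multiplier.\<close>

lemma lagrange_multiplier_rel_interior:
  fixes f :: "'a::euclidean_space \<Rightarrow> real" and \<Lambda> :: "'a \<Rightarrow> 'x::euclidean_space"
  assumes "convex S" and cf: "convex_on S f" and lin: "linear \<Lambda>"
    and w0: "w0 \<in> rel_interior S" "\<Lambda> w0 = c"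
    and opt: "\<And>w. w \<in> S \<Longrightarrow> \<Lambda> w = c \<Longrightarrow> m \<le> f w"
  obtains y where "\<And>w. w \<in> S \<Longrightarrow> m \<le> f w + y \<bullet> (\<Lambda> w - c)"
proof -
  have w0S: "w0 \<in> S" using w0(1) rel_interior_subset by blast
  define K where "K = {(\<Lambda> w - c, t) | w t. w \<in> S \<and> f w - m < t}"
  have "convex K"
    unfolding convex_def
  proof (intro ballI allI impI)
    fix k1 k2 and a b :: real assume k: "k1 \<in> K" "k2 \<in> K" and ab: "0 \<le> a" "0 \<le> b" "a + b = 1"
    obtain w1 t1 where 1: "k1 = (\<Lambda> w1 - c, t1)" "w1 \<in> S" "f w1 - m < t1" using k(1) by (auto simp: K_def)
    obtain w2 t2 where 2: "k2 = (\<Lambda> w2 - c, t2)" "w2 \<in> S" "f w2 - m < t2" using k(2) by (auto simp: K_def)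
    have "a *\<^sub>R w1 + b *\<^sub>R w2 \<in> S" using 1 2 ab \<open>convex S\<close> by (simp add: convexD)
    moreover have "f (a *\<^sub>R w1 + b *\<^sub>R w2) \<le> a * f w1 + b * f w2"
      using cf 1 2 ab by (auto simp: convex_on_def)
    moreover have "a * f w1 + b * f w2 - m < a * t1 + b * t2"
    proof -
      have m: "m = a * m + b * m" using ab by (metis distrib_right mult_1)
      have "a * (f w1 - m) + b * (f w2 - m) < a * t1 + b * t2"
      proof (cases "a = 0")
        case True then show ?thesis using ab 2(3) by simp
      next
        case False
        then show ?thesis using ab 1(3) 2(3) by (intro add_less_le_mono mult_strict_left_mono mult_left_mono) auto
      qed
      then show ?thesis using m by (simp add: right_diff_distrib)
    qed
    moreover have "a *\<^sub>R k1 + b *\<^sub>R k2 = (\<Lambda> (a *\<^sub>R w1 + b *\<^sub>R w2) - c, a * t1 + b * t2)"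
    proof -
      have "a *\<^sub>R c + b *\<^sub>R c = c" using ab by (metis scaleR_left_distrib scaleR_one)
      moreover have "a *\<^sub>R (\<Lambda> w1 - c) + b *\<^sub>R (\<Lambda> w2 - c) = a *\<^sub>R \<Lambda> w1 + b *\<^sub>R \<Lambda> w2 - (a *\<^sub>R c + b *\<^sub>R c)"
        by (simp add: algebra_simps)
      ultimately show ?thesis using 1 2 by (simp add: linear_add[OF lin] linear_cmul[OF lin])
    qed
    ultimately show "a *\<^sub>R k1 + b *\<^sub>R k2 \<in> K" unfolding K_def by force
  qed
  moreover have "K \<noteq> {}"
  proof -
    have "(\<Lambda> w0 - c, f w0 - m + 1) \<in> K" unfolding K_def using w0S by force
    then show ?thesis by blast
  qed
  moreover have "0 \<notin> K" using opt by (force simp: K_def zero_prod_def)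
  ultimately obtain k where k: "k \<in> span K" "k \<noteq> 0" "\<And>z. z \<in> K \<Longrightarrow> 0 \<le> k \<bullet> z"
    by (rule separating_hyperplane_set_0_inspan) blast
  obtain a b where ab: "k = (a, b)" by (cases k)
  have sep: "0 \<le> a \<bullet> (\<Lambda> w - c) + b * t" if "w \<in> S" "f w - m < t" for w t
    using k(3)[of "(\<Lambda> w - c, t)"] that by (auto simp: K_def ab)
  have "0 \<le> b"
  proof (rule ccontr)
    assume "\<not> 0 \<le> b"
    then have "b < 0" by simp
    define t where "t = max 1 (f w0 - m + 1)"
    have "0 \<le> b * t" using sep[OF w0S, of t] w0(2) by (simp add: t_def)
    then show False using \<open>b < 0\<close> by (simp add: t_def zero_le_mult_iff)
  qed
  have "b \<noteq> 0"
  proof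
    assume b: "b = 0"
    have pos: "0 \<le> a \<bullet> (\<Lambda> w - c)" if "w \<in> S" for w using sep[OF that, of "f w - m + 1"] b by simp
    have "a \<bullet> (\<Lambda> w - c) = 0" if w: "w \<in> S" for w
    proof -
      \<comment> \<open>The segment from w through w0 can be prolonged inside \<open>S\<close>, and
        beyond w0 the constraint value has the opposite sign.\<close>
      have "w \<in> affine hull S" using w by (rule hull_inc)
      then obtain \<mu> where \<mu>: "\<mu> > 1" "\<And>e. e > 1 \<Longrightarrow> e \<le> \<mu> \<Longrightarrow> (1 - e) *\<^sub>R w + e *\<^sub>R w0 \<in> S"
        using convex_rel_interior_if[OF \<open>convex S\<close> w0(1)] by blast
      have "0 \<le> a \<bullet> (\<Lambda> ((1 - \<mu>) *\<^sub>R w + \<mu> *\<^sub>R w0) - c)" using \<mu> by (intro pos) auto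
      also have "\<Lambda> ((1 - \<mu>) *\<^sub>R w + \<mu> *\<^sub>R w0) - c = (1 - \<mu>) *\<^sub>R (\<Lambda> w - c)"
        unfolding linear_add[OF lin] linear_cmul[OF lin] w0(2) by (simp add: algebra_simps)
      finally have "0 \<le> (1 - \<mu>) * (a \<bullet> (\<Lambda> w - c))" by simp
      then show ?thesis using pos[OF w] \<mu>(1) by (simp add: zero_le_mult_iff)
    qed
    then have "k \<bullet> z = 0" if "z \<in> K" for z using that b by (auto simp: K_def ab)
    then have "k \<bullet> k = 0"
      using k(1) orthogonal_to_span[of k K k] by (auto simp: orthogonal_def)
    then show False using k(2) by simp
  qed
  with \<open>0 \<le> b\<close> have b: "0 < b" by simp
  show thesis
  proof
    fix w assume w: "w \<in> S"
    have "0 \<le> a \<bullet> (\<Lambda> w - c) + b * (f w - m) + e" if "0 < e" for e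
    proof -
      have "0 \<le> a \<bullet> (\<Lambda> w - c) + b * (f w - m + e / b)" using that b by (intro sep w) auto
      then show ?thesis using b by (simp add: distrib_left)
    qed
    then have "0 \<le> a \<bullet> (\<Lambda> w - c) + b * (f w - m)" by (rule field_le_epsilon)
    then have "0 \<le> (a \<bullet> (\<Lambda> w - c) + b * (f w - m)) / b" using b by simp
    then show "m \<le> f w + ((1/b) *\<^sub>R a) \<bullet> (\<Lambda> w - c)" using b by (simp add: add_divide_distrib)
  qed
qed

text \<open>Comparison with the points of the segment from w to z: convexity makes the change of f
  at most linear in t, and dividing by t before t tends to 0 leaves the derivative of g.\<close>

lemma convex_plus_smooth_min_VI:
  fixes f :: "'a::euclidean_space \<Rightarrow> real"
  assumes "convex S" "convex_on S f" and w: "w \<in> S"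
    and g: "(g has_derivative g') (at w)"
    and min: "\<And>z. z \<in> S \<Longrightarrow> f w + g w \<le> f z + g z"
    and z: "z \<in> S"
  shows "0 \<le> f z - f w + g' (z - w)"
proof -
  have lin: "linear g'" using g by (rule has_derivative_linear)
  have "((\<lambda>t. w + t *\<^sub>R (z - w)) has_derivative (\<lambda>t. t *\<^sub>R (z - w))) (at 0)"
    by (auto intro!: derivative_eq_intros)
  then have "((\<lambda>t. g (w + t *\<^sub>R (z - w))) has_derivative (\<lambda>t. g' (t *\<^sub>R (z - w)))) (at 0)"
    using diff_chain_at[of "\<lambda>t. w + t *\<^sub>R (z - w)" _ "0::real" g g'] g by (simp add: o_def)
  then have "((\<lambda>t. g (w + t *\<^sub>R (z - w))) has_real_derivative g' (z - w)) (at 0)"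
    using lin by (simp add: has_field_derivative_def linear_cmul mult_commute_abs)
  then have "(\<lambda>t. (g (w + t *\<^sub>R (z - w)) - g w) / t) \<midarrow>0\<rightarrow> g' (z - w)" by (simp add: DERIV_def)
  then have lim: "((\<lambda>t. (g (w + t *\<^sub>R (z - w)) - g w) / t) \<longlongrightarrow> g' (z - w)) (at_right 0)"
    by (rule tendsto_mono[OF at_le, rotated]) auto
  have "f w - f z \<le> g' (z - w)"
  proof (rule tendsto_lowerbound[OF lim])
    have "f w - f z \<le> (g (w + t *\<^sub>R (z - w)) - g w) / t" if t: "0 < t" "t < 1" for t
    proof -
      have eq: "w + t *\<^sub>R (z - w) = (1 - t) *\<^sub>R w + t *\<^sub>R z" by (simp add: algebra_simps)
      have "w + t *\<^sub>R (z - w) \<in> S" unfolding eq using assms(1) w z t by (intro convexD) auto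
      then have "f w + g w \<le> f (w + t *\<^sub>R (z - w)) + g (w + t *\<^sub>R (z - w))" by (rule min)
      moreover have "f (w + t *\<^sub>R (z - w)) \<le> (1 - t) * f w + t * f z"
        unfolding eq using assms(2) w z t by (auto simp: convex_on_def)
      ultimately have "t * (f w - f z) \<le> g (w + t *\<^sub>R (z - w)) - g w" by (simp add: algebra_simps)
      then show ?thesis using t by (simp add: field_simps)
    qed
    then show "\<forall>\<^sub>F t in at_right 0. f w - f z \<le> (g (w + t *\<^sub>R (z - w)) - g w) / t"
      unfolding eventually_at_right_field by (intro exI[of _ 1]) auto
  qed auto
  then show ?thesis by simp
qed

section \<open>Quadratic forms and generalized Hessians\<close>

lemma self_adj_linear: "self_adj M \<Longrightarrow> linear M"
  by (simp add: self_adj_def)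

lemma self_adj_commute: "self_adj M \<Longrightarrow> M a \<bullet> b = M b \<bullet> a"
  by (simp add: self_adj_def inner_commute)

lemma self_adj_add_op: "self_adj M \<Longrightarrow> self_adj N \<Longrightarrow> self_adj (\<lambda>w. M w + N w)"
  by (auto simp: self_adj_def inner_simps intro: linear_compose_add)

lemma self_adj_Diag: "self_adj M \<Longrightarrow> self_adj N \<Longrightarrow> self_adj (Diag M N)"
  by (auto simp: self_adj_def Diag_def linear_iff)

lemma sqn_Diag [simp]: "sqn (Diag M N) (a, b) = sqn M a + sqn N b"
  by (simp add: sqn_def Diag_def)

lemma sqn_nonneg: "psd M \<Longrightarrow> 0 \<le> sqn M z"
  by (simp add: psd_def sqn_def)

lemma sqn_diff: "self_adj M \<Longrightarrow> sqn M (a - b) = sqn M a - 2 * (M a \<bullet> b) + sqn M b"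
  using self_adj_commute[of M b a]
  by (simp add: sqn_def linear_diff[OF self_adj_linear] inner_simps inner_commute)

lemma sqn_add: "self_adj M \<Longrightarrow> sqn M (a + b) = sqn M a + 2 * (M a \<bullet> b) + sqn M b"
  using self_adj_commute[of M b a]
  by (simp add: sqn_def linear_add[OF self_adj_linear] inner_simps inner_commute)

lemma sqn_parallelogram: "self_adj M \<Longrightarrow> sqn M (a - b) + sqn M (a + b) = 2 * sqn M a + 2 * sqn M b"
  by (simp add: sqn_add sqn_diff)

lemma sqn_scaleR: "linear M \<Longrightarrow> sqn M (t *\<^sub>R a) = t\<^sup>2 * sqn M a"
  by (simp add: sqn_def linear_cmul power2_eq_square)

lemma psd_Young:
  assumes "self_adj M" "psd M"
  shows "M a \<bullet> b \<le> 1/2 * sqn M a + 1/2 * sqn M b"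
  using sqn_nonneg[OF assms(2), of "a - b"] sqn_diff[OF assms(1), of a b] by simp

lemma sqn_three_point:
  assumes "self_adj M"
  shows "M (a - b) \<bullet> a = 1/2 * (sqn M a - sqn M b + sqn M (a - b))"
  using sqn_diff[OF assms, of a b] self_adj_commute[OF assms, of b a]
  by (simp add: linear_diff[OF self_adj_linear[OF assms]] inner_simps sqn_def inner_commute)

lemma norm_three_point:
  fixes a b :: "'a::real_inner"
  shows "(a - b) \<bullet> a = 1/2 * ((norm a)\<^sup>2 - (norm b)\<^sup>2 + (norm (a - b))\<^sup>2)"
  by (simp add: power2_norm_eq_inner inner_simps inner_commute)

lemma norm_add_scaleR_sq:
  fixes a b :: "'a::real_inner"
  shows "(norm (a + t *\<^sub>R b))\<^sup>2 = (norm a)\<^sup>2 + 2 * t * (a \<bullet> b) + t\<^sup>2 * (norm b)\<^sup>2"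
  unfolding power2_norm_eq_inner
  by (simp add: inner_simps inner_commute[of b a] power2_eq_square algebra_simps)

lemma derivative_in_clarke_hessian:
  assumes "(G has_derivative W) (at w)"
  shows "Blinfun W \<in> clarke_hessian G w" "blinfun_apply (Blinfun W) = W"
proof -
  show *: "blinfun_apply (Blinfun W) = W"
    using assms by (intro bounded_linear_Blinfun_apply has_derivative_bounded_linear)
  show "Blinfun W \<in> clarke_hessian G w"
    unfolding clarke_hessian_def
    by (rule hull_inc) (use assms * in \<open>auto intro!: exI[of _ "\<lambda>_. w"] exI[of _ "\<lambda>_. Blinfun W"]\<close>)
qed

text \<open>Variant for the ADMM subproblems, whose smooth part is a polynomial of degree two along
  segments; the exact expansion replaces differentiation.\<close>

lemma convex_plus_quadratic_min_VI:
  fixes f :: "'a::euclidean_space \<Rightarrow> real"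
  assumes "convex S" "convex_on S f" and w: "w \<in> S"
    and min: "\<And>z. z \<in> S \<Longrightarrow> f w + g w \<le> f z + g z"
    and z: "z \<in> S"
    and expand: "\<And>t. g (w + t *\<^sub>R (z - w)) = g w + t * \<alpha> + t\<^sup>2 * \<beta>"
  shows "0 \<le> f z - f w + \<alpha>"
proof -
  have *: "f w - f z \<le> \<alpha> + t * \<beta>" if t: "0 < t" "t < 1" for t
  proof -
    have eq: "w + t *\<^sub>R (z - w) = (1 - t) *\<^sub>R w + t *\<^sub>R z" by (simp add: algebra_simps)
    have "w + t *\<^sub>R (z - w) \<in> S" unfolding eq using assms(1) w z t by (intro convexD) auto
    then have "f w + g w \<le> f (w + t *\<^sub>R (z - w)) + g (w + t *\<^sub>R (z - w))" by (rule min)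
    moreover have "f (w + t *\<^sub>R (z - w)) \<le> (1 - t) * f w + t * f z"
      unfolding eq using assms(2) w z t by (auto simp: convex_on_def)
    moreover have "t * (f w - f z) = f w - ((1 - t) * f w + t * f z)" "t * (\<alpha> + t * \<beta>) = t * \<alpha> + t\<^sup>2 * \<beta>"
      by (simp_all add: algebra_simps power2_eq_square)
    ultimately have "t * (f w - f z) \<le> t * (\<alpha> + t * \<beta>)"
      unfolding expand by linarith
    then show ?thesis using t by simp
  qed
  have "((\<lambda>t. \<alpha> + t * \<beta>) \<longlongrightarrow> \<alpha> + 0 * \<beta>) (at_right 0)" by (intro tendsto_intros)
  then have "f w - f z \<le> \<alpha> + 0 * \<beta>"
    by (rule tendsto_lowerbound) (use * in \<open>auto simp: eventually_at_right_field intro!: exI[of _ 1]\<close>)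
  then show ?thesis by simp
qed

section \<open>From Hessian bounds to quadratic bounds\<close>

context
  fixes \<phi> :: "'a::euclidean_space \<Rightarrow> real" and G :: "'a \<Rightarrow> 'a"
  assumes grad: "\<And>w. (\<phi> has_derivative (\<lambda>h. G w \<bullet> h)) (at w)"
    and lip: "\<exists>L. \<forall>w w'. norm (G w - G w') \<le> L * norm (w - w')"
begin

text \<open>Derivatives of \<open>G\<close> belong to the generalized Hessian through constant
  sequences, and they are symmetric; so a bound for its symmetric members controls all
  increments.\<close>

lemma gradient_increment_lower_bound:
  assumes "\<And>w W. W \<in> clarke_hessian G w \<Longrightarrow> (\<And>a b. blinfun_apply W a \<bullet> b = blinfun_apply W b \<bullet> a) \<Longrightarrow> K \<le> blinfun_apply W d \<bullet> z"
  shows "K \<le> (G (x + d) - G x) \<bullet> z"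
proof -
  obtain L where L: "\<And>w w'. norm (G w - G w') \<le> L * norm (w - w')" using lip by blast
  show ?thesis
  proof (rule lipschitz_increment_lower_bound[OF L])
    fix w W assume W: "(G has_derivative W) (at w)"
    show "K \<le> W d \<bullet> z"
      using assms[OF derivative_in_clarke_hessian(1)[OF W]] gradient_derivative_symmetric[OF grad W]
      by (simp add: derivative_in_clarke_hessian(2)[OF W])
  qed
qed

text \<open>The derivative of \<open>\<psi>\<close> compares an increment of \<open>G\<close> along
  t d with t times the form, so the Hessian bound is applied once for each t and integrated by
  monotonicity.\<close>

lemma quadratic_lower_bound_of_hessian:
  assumes bd: "\<And>w W z. W \<in> clarke_hessian G w \<Longrightarrow> sqn M z \<le> z \<bullet> blinfun_apply W z"
  shows "\<phi> x + G x \<bullet> (y - x) + 1/2 * sqn M (y - x) \<le> \<phi> y"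
proof -
  define d where "d = y - x"
  define \<psi> where "\<psi> t = \<phi> (x + t *\<^sub>R d) - t * (G x \<bullet> d) - t\<^sup>2 * (1/2 * sqn M d)" for t
  have "\<psi> 0 \<le> \<psi> 1"
  proof (rule DERIV_nonneg_imp_nondecreasing[where f=\<psi>])
    fix t :: real assume t: "0 \<le> t" "t \<le> 1"
    have "(\<psi> has_real_derivative (G (x + t *\<^sub>R d) \<bullet> d - G x \<bullet> d - t * sqn M d)) (at t)"
      unfolding \<psi>_def
      by (rule derivative_eq_intros gradient_along_line[OF grad] refl)+ simp
    moreover have "0 \<le> G (x + t *\<^sub>R d) \<bullet> d - G x \<bullet> d - t * sqn M d"
    proof -
      have "t * sqn M d \<le> (G (x + t *\<^sub>R d) - G x) \<bullet> d"
      proof (rule gradient_increment_lower_bound)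
        fix w W assume "W \<in> clarke_hessian G w"
        from mult_left_mono[OF bd[OF this, of d] t(1)] show "t * sqn M d \<le> blinfun_apply W (t *\<^sub>R d) \<bullet> d"
          by (simp add: blinfun.scaleR_right inner_commute)
      qed
      then show ?thesis by (simp add: inner_diff_left)
    qed
    ultimately show "\<exists>y. (\<psi> has_real_derivative y) (at t) \<and> 0 \<le> y" by blast
  qed simp
  then show ?thesis by (simp add: \<psi>_def d_def)
qed

lemma quadratic_upper_bound_of_hessian:
  assumes bd: "\<And>w W z. W \<in> clarke_hessian G w \<Longrightarrow> z \<bullet> blinfun_apply W z \<le> sqn M z"
  shows "\<phi> y \<le> \<phi> x + G x \<bullet> (y - x) + 1/2 * sqn M (y - x)"
proof -
  define d where "d = y - x"
  define \<psi> where "\<psi> t = t * (G x \<bullet> d) + t\<^sup>2 * (1/2 * sqn M d) - \<phi> (x + t *\<^sub>R d)" for t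
  have "\<psi> 0 \<le> \<psi> 1"
  proof (rule DERIV_nonneg_imp_nondecreasing[where f=\<psi>])
    fix t :: real assume t: "0 \<le> t" "t \<le> 1"
    have "(\<psi> has_real_derivative (G x \<bullet> d + t * sqn M d - G (x + t *\<^sub>R d) \<bullet> d)) (at t)"
      unfolding \<psi>_def
      by (rule derivative_eq_intros gradient_along_line[OF grad] refl)+ simp
    moreover have "0 \<le> G x \<bullet> d + t * sqn M d - G (x + t *\<^sub>R d) \<bullet> d"
    proof -
      have "- (t * sqn M d) \<le> (G (x + t *\<^sub>R d) - G x) \<bullet> (- d)"
      proof (rule gradient_increment_lower_bound)
        fix w W assume "W \<in> clarke_hessian G w"
        from mult_left_mono[OF bd[OF this, of d] t(1)] show "- (t * sqn M d) \<le> blinfun_apply W (t *\<^sub>R d) \<bullet> (- d)"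
          by (simp add: blinfun.scaleR_right inner_commute)
      qed
      then show ?thesis by (simp add: inner_diff_left)
    qed
    ultimately show "\<exists>y. (\<psi> has_real_derivative y) (at t) \<and> 0 \<le> y" by blast
  qed simp
  then show ?thesis by (simp add: \<psi>_def d_def)
qed

end

text \<open>The diagonal block \<open>Q\<^sub>2\<^sub>2 + D2 - W\<^sub>2\<^sub>2\<close> lies between \<open>0\<close> and \<open>D2\<close>, so Young's inequality
  applies to it; the off-diagonal block is controlled by \<open>\<eta>\<close>.\<close>

lemma partial_gradient_increment_bound:
  fixes \<phi> :: "'u::euclidean_space \<times> 'v::euclidean_space \<Rightarrow> real"
  assumes grad: "\<And>w. (\<phi> has_derivative (\<lambda>h. G w \<bullet> h)) (at w)"
    and lip: "\<exists>L. \<forall>w w'. norm (G w - G w') \<le> L * norm (w - w')"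
    and Q: "self_adj Q" and D1: "self_adj D1" and D2: "self_adj D2"
    and hess_bounds: "\<And>w W z. W \<in> clarke_hessian G w \<Longrightarrow>
        sqn Q z \<le> z \<bullet> blinfun_apply W z \<and>
        z \<bullet> blinfun_apply W z \<le> sqn Q z + sqn (Diag D1 D2) z"
    and eta_bound: "\<And>z W a b. W \<in> clarke_hessian G z \<Longrightarrow>
        \<bar>a \<bullet> (blk12 (blinfun_apply W) b - blk12 Q b)\<bar> \<le> \<eta> / 2 * (sqn D1 a + sqn D2 b)"
  shows "(Q d + Diag D1 D2 d) \<bullet> (0, b) - \<eta> / 2 * (sqn D1 (fst d) + sqn D2 b)
      - 1/2 * (sqn D2 b + sqn D2 (snd d)) \<le> (G (x + d) - G x) \<bullet> (0, b)"
proof (rule gradient_increment_lower_bound[OF grad lip])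
  fix w W assume W: "W \<in> clarke_hessian G w"
    and sym: "\<And>a b. blinfun_apply W a \<bullet> b = blinfun_apply W b \<bullet> a"
  obtain d1 d2 where d: "d = (d1, d2)" by (cases d)
  have dsum: "d = (d1, 0) + (0, d2)" by (simp add: d)
  define N where "N z = Q (0, z) + (0, D2 z) - blinfun_apply W (0, z)" for z
  have N_diff: "N (y - z) = N y - N z" for y z
  proof -
    have pair: "(0 :: 'u, y - z) = (0, y) - (0, z)" by simp
    have pair_D2: "(0 :: 'u, D2 (y - z)) = (0, D2 y) - (0, D2 z)"
      using linear_diff[OF self_adj_linear[OF D2]] by simp
    show ?thesis
      unfolding N_def pair_D2 unfolding pair linear_diff[OF self_adj_linear[OF Q]] blinfun.diff_right
      by (simp only: algebra_simps)
  qed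
  have N_sym: "N y \<bullet> (0, z) = N z \<bullet> (0, y)" for y z
    using self_adj_commute[OF Q, of "(0,y)" "(0,z)"] self_adj_commute[OF D2, of y z] sym[of "(0,y)" "(0,z)"]
    by (simp add: N_def inner_simps)
  have N_bd: "0 \<le> N z \<bullet> (0, z)" "N z \<bullet> (0, z) \<le> sqn D2 z" for z
  proof -
    have "N z \<bullet> (0, z) = sqn Q (0, z) + sqn D2 z - (0, z) \<bullet> blinfun_apply W (0, z)"
      unfolding N_def inner_diff_left inner_add_left by (simp add: sqn_def inner_commute)
    moreover have "sqn D1 0 = 0" by (simp add: sqn_def)
    ultimately show "0 \<le> N z \<bullet> (0, z)" "N z \<bullet> (0, z) \<le> sqn D2 z"
      using hess_bounds[OF W, of "(0,z)"] by auto
  qed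
  have "0 \<le> N (d2 - b) \<bullet> (0, d2 - b)" by (rule N_bd)
  also have "\<dots> = N d2 \<bullet> (0, d2) - 2 * (N d2 \<bullet> (0, b)) + N b \<bullet> (0, b)"
  proof -
    have "(0 :: 'u, d2 - b) = (0, d2) - (0, b)" by simp
    then show ?thesis using N_sym[of d2 b] by (simp only: N_diff inner_diff_left inner_diff_right)
  qed
  finally have N2: "N d2 \<bullet> (0, b) \<le> 1/2 * (sqn D2 b + sqn D2 d2)"
    using N_bd(2)[of d2] N_bd(2)[of b] by argo
  \<comment> \<open>By symmetry of W and \<open>Q\<close>, the lower left block occurring here is
    the transpose of the block that \<eta> controls.\<close>
  have off: "(blinfun_apply W (d1, 0) - Q (d1, 0)) \<bullet> (0, b) = d1 \<bullet> (blk12 (blinfun_apply W) b - blk12 Q b)"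
  proof -
    have "d1 \<bullet> fst X = X \<bullet> (d1, 0)" for X :: "'u \<times> 'v" by (simp add: inner_prod_def inner_commute)
    then show ?thesis
      using self_adj_commute[OF Q, of "(d1,0)" "(0,b)"] sym[of "(d1,0)" "(0,b)"]
      by (simp add: blk12_def inner_diff_left inner_diff_right)
  qed
  have "(Q d + Diag D1 D2 d - blinfun_apply W d) \<bullet> (0, b)
      = N d2 \<bullet> (0, b) - (blinfun_apply W (d1, 0) - Q (d1, 0)) \<bullet> (0, b)"
  proof -
    have "Diag D1 D2 d \<bullet> (0, b) = (0, D2 d2) \<bullet> (0, b)" by (simp add: Diag_def d)
    then show ?thesis
      using linear_add[OF self_adj_linear[OF Q], of "(d1,0)" "(0,d2)"] blinfun.add_right[of W "(d1,0)" "(0,d2)"]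
      by (simp only: dsum[symmetric] N_def inner_diff_left inner_add_left) simp
  qed
  moreover have "- (\<eta> / 2 * (sqn D1 d1 + sqn D2 b)) \<le> d1 \<bullet> (blk12 (blinfun_apply W) b - blk12 Q b)"
    using eta_bound[OF W, of d1 b] unfolding abs_le_iff by argo
  ultimately show "(Q d + Diag D1 D2 d) \<bullet> (0, b) - \<eta> / 2 * (sqn D1 (fst d) + sqn D2 b)
      - 1/2 * (sqn D2 b + sqn D2 (snd d)) \<le> blinfun_apply W d \<bullet> (0, b)"
    using N2 unfolding off d fst_conv snd_conv inner_diff_left[of _ "blinfun_apply W (d1, d2)"] by argo
qed

section \<open>Energy estimates for the majorized ADMM\<close>

definition average :: "(nat \<Rightarrow> 'a::real_vector) \<Rightarrow> nat \<Rightarrow> 'a" where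
  "average y k = (1 / real k) *\<^sub>R (\<Sum>i = 1..k. y i)"

lemma average_mem:
  assumes "convex C" "1 \<le> k" "\<And>i. 1 \<le> i \<Longrightarrow> y i \<in> C"
  shows "average y k \<in> C"
  unfolding average_def scaleR_sum_right using assms by (intro convex_sum) auto

lemma convex_on_average:
  assumes "convex_on C f" "1 \<le> k" "\<And>i. 1 \<le> i \<Longrightarrow> y i \<in> C"
  shows "real k * f (average y k) \<le> (\<Sum>i = 1..k. f (y i))"
proof -
  have "f (average y k) \<le> (\<Sum>i = 1..k. 1 / real k * f (y i))"
    unfolding average_def scaleR_sum_right using assms by (intro convex_on_sum) auto
  also have "\<dots> = 1 / real k * (\<Sum>i = 1..k. f (y i))" by (rule sum_distrib_left[symmetric])
  finally show ?thesis using assms(2) by (simp add: field_simps)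
qed

lemma scaleR_average: "1 \<le> k \<Longrightarrow> real k *\<^sub>R average y k = (\<Sum>i = 1..k. y i)"
  by (simp add: average_def)

lemma average_Pair: "average (\<lambda>i. (y i, z i)) k = (average y k, average z k)"
  by (simp add: average_def sum_prod fst_sum snd_sum prod_eq_iff)

lemma sum_le_telescope:
  fixes f g :: "nat \<Rightarrow> real"
  assumes "\<And>i. g (Suc i) \<le> f (Suc i) - f (Suc (Suc i))"
  shows "(\<Sum>i = 1..k. g i) \<le> f 1 - f (Suc k)"
proof (induction k)
  case (Suc k) then show ?case using assms[of k] by simp
qed simp

lemma continuous_on_linear_compose:
  fixes L :: "'a::euclidean_space \<Rightarrow> 'b::real_normed_vector"
  assumes "linear L" "continuous_on U h"
  shows "continuous_on U (\<lambda>t. L (h t))"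
  by (rule bounded_linear.continuous_on[OF _ assms(2)]) (use assms(1) in \<open>simp add: linear_conv_bounded_linear\<close>)

lemma pd_coercive:
  fixes M :: "'a::euclidean_space \<Rightarrow> 'a"
  assumes "linear M" "pd M"
  obtains m where "0 < m" "\<And>z. m * (norm z)\<^sup>2 \<le> z \<bullet> M z"
proof -
  have "continuous_on (sphere 0 1) (\<lambda>z. z \<bullet> M z)"
    by (intro continuous_on_inner continuous_on_id continuous_on_linear_compose[OF assms(1)])
  moreover have "sphere (0::'a) 1 \<noteq> {}" by simp
  ultimately obtain z0 where z0: "z0 \<in> sphere 0 1" "\<And>z. z \<in> sphere 0 1 \<Longrightarrow> z0 \<bullet> M z0 \<le> z \<bullet> M z"
    using continuous_attains_inf[OF compact_sphere] by blast
  have "z0 \<noteq> 0" using z0(1) by auto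
  then have m: "0 < z0 \<bullet> M z0" using assms(2) by (simp add: pd_def)
  have "(z0 \<bullet> M z0) * (norm z)\<^sup>2 \<le> z \<bullet> M z" for z
  proof (cases "z = 0")
    case False
    define t where "t = (1 / norm z) *\<^sub>R z"
    have "t \<in> sphere 0 1" using False by (simp add: t_def)
    then have "(z0 \<bullet> M z0) * (norm z)\<^sup>2 \<le> (t \<bullet> M t) * (norm z)\<^sup>2" using z0(2) by (intro mult_right_mono) auto
    also have "\<dots> = z \<bullet> M z"
      using False by (simp add: t_def linear_cmul[OF assms(1)] power2_eq_square)
    finally show ?thesis .
  qed simp
  then show thesis using m that by blast
qed

lemma norm_le_if_coercive:
  assumes "0 < m" "m * (norm z)\<^sup>2 \<le> E"
  shows "norm z \<le> sqrt (E / m)"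
  using assms by (intro real_le_rsqrt) (simp add: field_simps)

text \<open>Standing assumptions on the data and the iteration. Optimality, the relative interior
  condition, positive definiteness and the restrictions of the two cases are assumed lemma by
  lemma.\<close>

locale majorized_admm =
  fixes p :: "'u::euclidean_space \<Rightarrow> real" and Dp :: "'u set"
    and q :: "'v::euclidean_space \<Rightarrow> real" and Dq :: "'v set"
    and phi :: "'u \<times> 'v \<Rightarrow> real" and G :: "'u \<times> 'v \<Rightarrow> 'u \<times> 'v"
    and A :: "'x::euclidean_space \<Rightarrow> 'u" and B :: "'x \<Rightarrow> 'v" and c :: 'x
    and Q :: "'u \<times> 'v \<Rightarrow> 'u \<times> 'v" and D1 :: "'u \<Rightarrow> 'u" and D2 :: "'v \<Rightarrow> 'v"
    and S :: "'u \<Rightarrow> 'u" and T :: "'v \<Rightarrow> 'v"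
    and \<eta> \<sigma> \<tau> :: real
    and u :: "nat \<Rightarrow> 'u" and v :: "nat \<Rightarrow> 'v" and x :: "nat \<Rightarrow> 'x"
  assumes p_cpc: "closed_proper_convex Dp p"
    and q_cpc: "closed_proper_convex Dq q"
    and phi_convex: "convex_on UNIV phi"
    and phi_grad: "\<And>w. (phi has_derivative (\<lambda>h. G w \<bullet> h)) (at w)"
    and G_lipschitz: "\<exists>L. \<forall>w w'. norm (G w - G w') \<le> L * norm (w - w')"
    and A_lin: "linear A" and B_lin: "linear B"
    and Q_sa: "self_adj Q" and Q_psd: "psd Q"
    and D1_sa: "self_adj D1" and D1_psd: "psd D1"
    and D2_sa: "self_adj D2" and D2_psd: "psd D2"
    and hess_bounds: "\<And>w W z. W \<in> clarke_hessian G w \<Longrightarrow>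
        sqn Q z \<le> z \<bullet> blinfun_apply W z \<and>
        z \<bullet> blinfun_apply W z \<le> sqn Q z + sqn (Diag D1 D2) z"
    and eta_nonneg: "0 \<le> \<eta>"
    and eta_bound: "\<And>z W a b. W \<in> clarke_hessian G z \<Longrightarrow>
        \<bar>a \<bullet> (blk12 (blinfun_apply W) b - blk12 Q b)\<bar> \<le> \<eta> / 2 * (sqn D1 a + sqn D2 b)"
    and sigma_pos: "\<sigma> > 0" and tau_pos: "\<tau> > 0"
    and S_sa: "self_adj S" and S_psd: "psd S"
    and T_sa: "self_adj T" and T_psd: "psd T"
    and u_step: "\<And>k. u (Suc k) \<in> Dp \<and>
        (\<forall>a\<in>Dp. Lhat p q phi G (\<lambda>w. Q w + Diag D1 D2 w) A B c \<sigma> (u (Suc k), v k) (x k) (u k, v k)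
                   + 1/2 * sqn S (u (Suc k) - u k)
                 \<le> Lhat p q phi G (\<lambda>w. Q w + Diag D1 D2 w) A B c \<sigma> (a, v k) (x k) (u k, v k)
                   + 1/2 * sqn S (a - u k))"
    and v_step: "\<And>k. v (Suc k) \<in> Dq \<and>
        (\<forall>b\<in>Dq. Lhat p q phi G (\<lambda>w. Q w + Diag D1 D2 w) A B c \<sigma> (u (Suc k), v (Suc k)) (x k) (u k, v k)
                   + 1/2 * sqn T (v (Suc k) - v k)
                 \<le> Lhat p q phi G (\<lambda>w. Q w + Diag D1 D2 w) A B c \<sigma> (u (Suc k), b) (x k) (u k, v k)
                   + 1/2 * sqn T (b - v k))"
    and x_step: "\<And>k. x (Suc k) = x k + (\<tau> * \<sigma>) *\<^sub>R (adjoint A (u (Suc k)) + adjoint B (v (Suc k)) - c)"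
begin

abbreviation "As \<equiv> adjoint A"
abbreviation "Bs \<equiv> adjoint B"
abbreviation "w k \<equiv> (u k, v k)"
abbreviation "QH z \<equiv> Q z + Diag D1 D2 z"

definition resid :: "'u \<times> 'v \<Rightarrow> 'x" where
  "resid z = As (fst z) + Bs (snd z) - c"

lemma As_lin: "linear As" and Bs_lin: "linear Bs"
  using A_lin B_lin by (simp_all add: adjoint_linear)

lemmas Q_lin = self_adj_linear[OF Q_sa]

lemma H_sa: "self_adj (Diag D1 D2)"
  by (rule self_adj_Diag[OF D1_sa D2_sa])

lemma QH_sa: "self_adj QH"
  by (rule self_adj_add_op[OF Q_sa H_sa])

lemma sqn_QH: "sqn QH z = sqn Q z + sqn (Diag D1 D2) z"
  by (simp add: sqn_def inner_simps)

lemma Dp_convex: "convex Dp" "convex_on Dp p" and Dq_convex: "convex Dq" "convex_on Dq q"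
  using p_cpc q_cpc by (auto simp: closed_proper_convex_def)

lemma phi_lower: "phi z + G z \<bullet> (y - z) + 1/2 * sqn Q (y - z) \<le> phi y"
  using quadratic_lower_bound_of_hessian[OF phi_grad G_lipschitz] hess_bounds by blast

lemma phi_upper: "phi y \<le> phi z + G z \<bullet> (y - z) + 1/2 * sqn Q (y - z) + 1/2 * sqn (Diag D1 D2) (y - z)"
  using quadratic_upper_bound_of_hessian[OF phi_grad G_lipschitz, of QH y z] hess_bounds
  by (force simp: sqn_QH distrib_left)

section \<open>Optimality conditions of the two subproblems\<close>

text \<open>The residual combines the new u with the old v, and the majorant sees only the u-part of
  the increment. Both defects return as cross terms when the conditions are added.\<close>

lemma u_VI:
  fixes k :: nat
  assumes a: "a \<in> Dp"
  defines "d \<equiv> a - u (Suc k)"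
  shows "0 \<le> p a - p (u (Suc k)) + (G (w k) \<bullet> (d, 0) + QH (u (Suc k) - u k, 0) \<bullet> (d, 0) + S (u (Suc k) - u k) \<bullet> d
      + (x k + \<sigma> *\<^sub>R resid (u (Suc k), v k)) \<bullet> As d)"
proof -
  define g where "g a = phihat phi G QH (a, v k) (w k) + x k \<bullet> resid (a, v k)
     + \<sigma> / 2 * (norm (resid (a, v k)))\<^sup>2 + 1/2 * sqn S (a - u k)" for a
  show ?thesis
  proof (rule convex_plus_quadratic_min_VI[OF Dp_convex, where g=g])
    show "u (Suc k) \<in> Dp" using u_step by simp
    show "p (u (Suc k)) + g (u (Suc k)) \<le> p z + g z" if "z \<in> Dp" for z
      using u_step[of k] that by (force simp: Lhat_def g_def resid_def)
    show "a \<in> Dp" by (rule a)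
    fix t
    have 1: "(u (Suc k) + t *\<^sub>R d, v k) - w k = (u (Suc k) - u k, 0) + t *\<^sub>R (d, 0)" by (simp add: algebra_simps)
    have 2: "resid (u (Suc k) + t *\<^sub>R d, v k) = resid (u (Suc k), v k) + t *\<^sub>R As d"
      using As_lin by (simp add: resid_def linear_add linear_cmul algebra_simps)
    have 3: "u (Suc k) + t *\<^sub>R d - u k = (u (Suc k) - u k) + t *\<^sub>R d" by (simp add: algebra_simps)
    have 4: "(u (Suc k), v k) - w k = (u (Suc k) - u k, 0)" by simp
    show "g (u (Suc k) + t *\<^sub>R (a - u (Suc k))) = g (u (Suc k)) + t *
        (G (w k) \<bullet> (d, 0) + QH (u (Suc k) - u k, 0) \<bullet> (d, 0) + S (u (Suc k) - u k) \<bullet> d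
          + (x k + \<sigma> *\<^sub>R resid (u (Suc k), v k)) \<bullet> As d)
        + t\<^sup>2 * (1/2 * sqn QH (d, 0) + \<sigma> / 2 * (norm (As d))\<^sup>2 + 1/2 * sqn S d)"
      unfolding g_def phihat_def d_def[symmetric] 1 2 3 4 norm_add_scaleR_sq
        sqn_add[OF QH_sa] sqn_scaleR[OF self_adj_linear[OF QH_sa]]
        sqn_add[OF S_sa] sqn_scaleR[OF self_adj_linear[OF S_sa]]
      by (simp only: inner_add_right inner_add_left inner_scaleR_right inner_scaleR_left) (simp add: field_simps)
  qed
qed

text \<open>The residual now uses both new blocks, so
  \<open>x k + \<sigma> *\<^sub>R resid (w (Suc k))\<close> is exactly the multiplier that is
  averaged in \<open>xh\<close>.\<close>

lemma v_VI:
  fixes k :: nat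
  assumes b: "b \<in> Dq"
  defines "d \<equiv> b - v (Suc k)"
  shows "0 \<le> q b - q (v (Suc k)) + (G (w k) \<bullet> (0, d) + QH (w (Suc k) - w k) \<bullet> (0, d) + T (v (Suc k) - v k) \<bullet> d
      + (x k + \<sigma> *\<^sub>R resid (w (Suc k))) \<bullet> Bs d)"
proof -
  define g where "g b = phihat phi G QH (u (Suc k), b) (w k) + x k \<bullet> resid (u (Suc k), b)
     + \<sigma> / 2 * (norm (resid (u (Suc k), b)))\<^sup>2 + 1/2 * sqn T (b - v k)" for b
  show ?thesis
  proof (rule convex_plus_quadratic_min_VI[OF Dq_convex, where g=g])
    show "v (Suc k) \<in> Dq" using v_step by simp
    show "q (v (Suc k)) + g (v (Suc k)) \<le> q z + g z" if "z \<in> Dq" for z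
      using v_step[of k] that by (force simp: Lhat_def g_def resid_def)
    show "b \<in> Dq" by (rule b)
    fix t
    have 1: "(u (Suc k), v (Suc k) + t *\<^sub>R d) - w k = (w (Suc k) - w k) + t *\<^sub>R (0, d)" by (simp add: algebra_simps)
    have 2: "resid (u (Suc k), v (Suc k) + t *\<^sub>R d) = resid (w (Suc k)) + t *\<^sub>R Bs d"
      using Bs_lin by (simp add: resid_def linear_add linear_cmul algebra_simps)
    have 3: "v (Suc k) + t *\<^sub>R d - v k = (v (Suc k) - v k) + t *\<^sub>R d" by (simp add: algebra_simps)
    show "g (v (Suc k) + t *\<^sub>R (b - v (Suc k))) = g (v (Suc k)) + t *
        (G (w k) \<bullet> (0, d) + QH (w (Suc k) - w k) \<bullet> (0, d) + T (v (Suc k) - v k) \<bullet> d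
          + (x k + \<sigma> *\<^sub>R resid (w (Suc k))) \<bullet> Bs d)
        + t\<^sup>2 * (1/2 * sqn QH (0, d) + \<sigma> / 2 * (norm (Bs d))\<^sup>2 + 1/2 * sqn T d)"
      unfolding g_def phihat_def d_def[symmetric] 1 2 3 norm_add_scaleR_sq
        sqn_add[OF QH_sa] sqn_scaleR[OF self_adj_linear[OF QH_sa]]
        sqn_add[OF T_sa] sqn_scaleR[OF self_adj_linear[OF T_sa]]
      by (simp only: inner_add_right inner_add_left inner_scaleR_right inner_scaleR_left) (simp add: field_simps)
  qed
qed

section \<open>Gaps, energy and the one-step inequality\<close>

definition gap_theta :: "nat \<Rightarrow> 'u \<times> 'v \<Rightarrow> real" where
  "gap_theta k z = p (u k) + q (v k) + phi (w k) - (p (fst z) + q (snd z) + phi z)"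

text \<open>Linearising \<phi> at z makes the smooth part affine in the iterate, so it passes to
  averages exactly; this is the gap of (ii), whereas \<open>gap_theta\<close> serves (iii).\<close>

definition gap_VI :: "nat \<Rightarrow> 'u \<times> 'v \<Rightarrow> real" where
  "gap_VI k z = p (u k) + q (v k) - (p (fst z) + q (snd z)) + G z \<bullet> (w k - z)"

text \<open>The multiplier part of the gap: averaged over k it becomes the terms of (ii) with
  \<open>A y\<close>, \<open>B y\<close> and \<open>xh\<close>.\<close>

definition mult_gap :: "nat \<Rightarrow> 'u \<times> 'v \<Rightarrow> 'x \<Rightarrow> real" where
  "mult_gap k z y = resid (w (Suc k)) \<bullet> y - resid z \<bullet> (x k + \<sigma> *\<^sub>R resid (w (Suc k)))"

text \<open>The term with \<open>Q\<close> on the v-block lets the off-diagonal product telescope.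
  The last term is linear in v and has no sign; it vanishes at feasible z and stems from centres
  that violate the constraint.\<close>

definition energy :: "'u \<times> 'v \<Rightarrow> 'x \<Rightarrow> nat \<Rightarrow> real" where
  "energy z y k = 1/2 * sqn (Diag D1 D2) (w k - z) + 1/2 * sqn S (u k - fst z) + 1/2 * sqn T (v k - snd z)
     + \<sigma> / 2 * (norm (Bs (v k - snd z)))\<^sup>2 + 1 / (2 * \<tau> * \<sigma>) * (norm (x k - y))\<^sup>2
     + 1/2 * sqn Q (0, v k - snd z) + \<sigma> * (resid z \<bullet> Bs (v k))"

text \<open>Convexity of \<phi> relative to \<open>Q\<close>; the quadratic gain is what pays for
  the quarter of \<open>Q\<close> in case (b).\<close>

lemma gap_VI_le_gap_theta: "gap_VI k z + 1/2 * sqn Q (w k - z) \<le> gap_theta k z"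
  using phi_lower[of z "w k"] by (simp add: gap_VI_def gap_theta_def)

lemma resid_diff: "resid z - resid y = As (fst (z - y)) + Bs (snd (z - y))"
  using As_lin Bs_lin by (simp add: resid_def linear_diff algebra_simps)

text \<open>Sum of the two variational inequalities tested at z. Around the old iterate, \<phi> is
  bounded above at the new iterate with \<open>Q\<close> plus \<open>Diag D1 D2\<close> and below at
  z with \<open>Q\<close>. After the three-point identities the \<open>Diag D1 D2\<close> terms
  telescope and the \<open>Q\<close> terms leave half of |a|_Q^2 on the left.\<close>

lemma step_estimate:
  fixes k :: nat
  assumes z: "fst z \<in> Dp" "snd z \<in> Dq"
  defines "\<Delta> \<equiv> w (Suc k) - w k" and "a \<equiv> w (Suc k) - z" and "b \<equiv> w k - z"
    and "r \<equiv> resid (w (Suc k))" and "s \<equiv> resid z"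
  shows "gap_theta (Suc k) z + r \<bullet> (x k + \<sigma> *\<^sub>R r) - s \<bullet> (x k + \<sigma> *\<^sub>R r) + 1/2 * sqn Q a
      + 1/2 * sqn S (fst \<Delta>) + 1/2 * sqn T (snd \<Delta>)
    \<le> 1/2 * (sqn (Diag D1 D2) b - sqn (Diag D1 D2) a) + 1/2 * (sqn S (fst b) - sqn S (fst a))
      + 1/2 * (sqn T (snd b) - sqn T (snd a)) + Q (0, snd \<Delta>) \<bullet> (fst a, 0) + \<sigma> * (Bs (snd \<Delta>) \<bullet> As (fst a))"
proof -
  have ab: "a - b = \<Delta>" "fst a - fst b = fst \<Delta>" "snd a - snd b = snd \<Delta>" by (auto simp: a_def b_def \<Delta>_def)
  have U: "0 \<le> p (fst z) - p (u (Suc k)) + (- (G (w k) \<bullet> (fst a, 0)) - QH (fst \<Delta>, 0) \<bullet> (fst a, 0) - S (fst \<Delta>) \<bullet> fst a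
      - (x k + \<sigma> *\<^sub>R r - \<sigma> *\<^sub>R Bs (snd \<Delta>)) \<bullet> As (fst a))"
  proof -
    have d: "fst z - u (Suc k) = - fst a" by (simp add: a_def)
    have pair: "(- fst a, 0) = - (fst a, 0::'v)" by simp
    have res: "resid (u (Suc k), v k) = r - Bs (snd \<Delta>)"
      using Bs_lin by (simp add: r_def \<Delta>_def resid_def linear_diff algebra_simps)
    have Du: "u (Suc k) - u k = fst \<Delta>" by (simp add: \<Delta>_def)
    show ?thesis
      using u_VI[OF z(1), of k] unfolding d pair res Du
      by (simp only: inner_minus_right linear_neg[OF As_lin] scaleR_diff_right add_diff_eq)
  qed
  have V: "0 \<le> q (snd z) - q (v (Suc k)) + (- (G (w k) \<bullet> (0, snd a)) - QH \<Delta> \<bullet> (0, snd a) - T (snd \<Delta>) \<bullet> snd a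
      - (x k + \<sigma> *\<^sub>R r) \<bullet> Bs (snd a))"
  proof -
    have d: "snd z - v (Suc k) = - snd a" by (simp add: a_def)
    have pair: "(0, - snd a) = - (0::'u, snd a)" by simp
    have Dv: "v (Suc k) - v k = snd \<Delta>" by (simp add: \<Delta>_def)
    show ?thesis
      using v_VI[OF z(2), of k] unfolding d pair Dv
      by (simp only: inner_minus_right linear_neg[OF Bs_lin] \<Delta>_def[symmetric] r_def[symmetric])
  qed
  have asum: "a = (fst a, 0) + (0, snd a)" by simp
  have Ga: "G (w k) \<bullet> a = G (w k) \<bullet> (fst a, 0) + G (w k) \<bullet> (0, snd a)"
    by (subst asum) (rule inner_add_right)
  \<comment> \<open>The u-condition lacks the v-increment; completing it to the full increment
    leaves an off-diagonal product of \<open>Q\<close> as correction.\<close>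
  have QHa: "QH (fst \<Delta>, 0) \<bullet> (fst a, 0) + QH \<Delta> \<bullet> (0, snd a)
      = Q \<Delta> \<bullet> a + Diag D1 D2 \<Delta> \<bullet> a - Q (0, snd \<Delta>) \<bullet> (fst a, 0)"
  proof -
    have "Q \<Delta> = Q (fst \<Delta>, 0) + Q (0, snd \<Delta>)"
      using linear_add[OF Q_lin, of "(fst \<Delta>, 0)" "(0, snd \<Delta>)"] by simp
    then have "Q (fst \<Delta>, 0) \<bullet> (fst a, 0) = Q \<Delta> \<bullet> (fst a, 0) - Q (0, snd \<Delta>) \<bullet> (fst a, 0)"
      by (simp add: inner_add_left)
    moreover have "Diag D1 D2 (fst \<Delta>, 0) \<bullet> (fst a, 0) = Diag D1 D2 \<Delta> \<bullet> (fst a, 0)"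
      by (cases \<Delta>) (simp add: Diag_def)
    moreover have "Q \<Delta> \<bullet> a = Q \<Delta> \<bullet> (fst a, 0) + Q \<Delta> \<bullet> (0, snd a)"
        "Diag D1 D2 \<Delta> \<bullet> a = Diag D1 D2 \<Delta> \<bullet> (fst a, 0) + Diag D1 D2 \<Delta> \<bullet> (0, snd a)"
      by (subst asum, rule inner_add_right)+
    ultimately show ?thesis by (simp only: inner_add_left)
  qed
  have x1: "(x k + \<sigma> *\<^sub>R r - \<sigma> *\<^sub>R Bs (snd \<Delta>)) \<bullet> As (fst a) + (x k + \<sigma> *\<^sub>R r) \<bullet> Bs (snd a)
      = (r - s) \<bullet> (x k + \<sigma> *\<^sub>R r) - \<sigma> * (Bs (snd \<Delta>) \<bullet> As (fst a))"
    using resid_diff[of "w (Suc k)" z] unfolding r_def[symmetric] s_def[symmetric] a_def[symmetric]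
    by (simp add: inner_simps inner_commute)
  have phi1: "phi (w (Suc k)) - phi z \<le> G (w k) \<bullet> a - 1/2 * sqn Q b + 1/2 * sqn Q \<Delta> + 1/2 * sqn (Diag D1 D2) \<Delta>"
  proof -
    have "z - w k = - b" by (simp add: b_def)
    then have "phi (w k) - G (w k) \<bullet> b + 1/2 * sqn Q b \<le> phi z"
      using phi_lower[of "w k" z] by (simp add: sqn_def linear_neg[OF Q_lin])
    moreover have "G (w k) \<bullet> a = G (w k) \<bullet> b + G (w k) \<bullet> \<Delta>"
      using ab(1) by (metis inner_add_right add_diff_cancel_left' diff_add_cancel add.commute)
    ultimately show ?thesis using phi_upper[of "w (Suc k)" "w k"] by (simp add: \<Delta>_def)
  qed
  have t1: "Q \<Delta> \<bullet> a = 1/2 * (sqn Q a - sqn Q b + sqn Q \<Delta>)"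
    using sqn_three_point[OF Q_sa, of a b] by (simp only: ab)
  have t2: "Diag D1 D2 \<Delta> \<bullet> a = 1/2 * (sqn (Diag D1 D2) a - sqn (Diag D1 D2) b + sqn (Diag D1 D2) \<Delta>)"
    using sqn_three_point[OF H_sa, of a b] by (simp only: ab)
  have t3: "S (fst \<Delta>) \<bullet> fst a = 1/2 * (sqn S (fst a) - sqn S (fst b) + sqn S (fst \<Delta>))"
    using sqn_three_point[OF S_sa, of "fst a" "fst b"] by (simp only: ab)
  have t4: "T (snd \<Delta>) \<bullet> snd a = 1/2 * (sqn T (snd a) - sqn T (snd b) + sqn T (snd \<Delta>))"
    using sqn_three_point[OF T_sa, of "snd a" "snd b"] by (simp only: ab)
  show ?thesis
    using U V Ga QHa x1 phi1 t1 t2 t3 t4 unfolding gap_theta_def inner_diff_left[of r s] by argo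
qed

text \<open>\<open>As (fst a)\<close> is eliminated through the residual, and the multiplier update
  yields the difference of |x - y|^2. The latter consumes \<tau>\<sigma>/2 of the available \<sigma>
  |r|^2, whence the weight (1 - \<tau>/2)\<sigma>.\<close>

lemma step_energy:
  fixes k :: nat
  assumes z: "fst z \<in> Dp" "snd z \<in> Dq"
  defines "\<Delta> \<equiv> w (Suc k) - w k" and "a \<equiv> w (Suc k) - z" and "b \<equiv> w k - z"
    and "r \<equiv> resid (w (Suc k))"
  shows "gap_theta (Suc k) z + mult_gap k z y + 1/2 * sqn Q a
      + 1/2 * sqn S (fst \<Delta>) + 1/2 * sqn T (snd \<Delta>) + \<sigma> / 2 * (norm (Bs (snd \<Delta>)))\<^sup>2 + (1 - \<tau> / 2) * \<sigma> * (norm r)\<^sup>2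
    \<le> energy z y k - energy z y (Suc k) - 1/2 * (sqn Q (0, snd b) - sqn Q (0, snd a))
      + \<sigma> * (r \<bullet> Bs (snd \<Delta>)) + Q (0, snd \<Delta>) \<bullet> (fst a, 0)"
proof -
  let ?s = "resid z" and ?Y = "Bs (snd \<Delta>)"
  have ba: "Bs (snd a) - Bs (snd b) = ?Y"
    using Bs_lin by (simp add: a_def b_def \<Delta>_def linear_diff)
  have "?Y \<bullet> As (fst a) = r \<bullet> ?Y - ?s \<bullet> ?Y - ?Y \<bullet> Bs (snd a)"
    using resid_diff[of "w (Suc k)" z] unfolding r_def[symmetric] a_def[symmetric]
    by (metis add_diff_cancel_right' inner_diff_left inner_commute)
  moreover have "?Y \<bullet> Bs (snd a) = 1/2 * ((norm (Bs (snd a)))\<^sup>2 - (norm (Bs (snd b)))\<^sup>2 + (norm ?Y)\<^sup>2)"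
    using norm_three_point[of "Bs (snd a)" "Bs (snd b)"] by (simp only: ba)
  moreover have "?s \<bullet> ?Y = ?s \<bullet> Bs (v (Suc k)) - ?s \<bullet> Bs (v k)"
    using Bs_lin by (simp add: \<Delta>_def linear_diff inner_diff_right)
  ultimately have "\<sigma> * (?Y \<bullet> As (fst a)) = \<sigma> * (r \<bullet> ?Y - (?s \<bullet> Bs (v (Suc k)) - ?s \<bullet> Bs (v k))
      - 1/2 * ((norm (Bs (snd a)))\<^sup>2 - (norm (Bs (snd b)))\<^sup>2 + (norm ?Y)\<^sup>2))" by simp
  then have 1: "\<sigma> * (?Y \<bullet> As (fst a)) = \<sigma> * (r \<bullet> ?Y) - \<sigma> * (?s \<bullet> Bs (v (Suc k))) + \<sigma> * (?s \<bullet> Bs (v k))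
      - \<sigma> / 2 * (norm (Bs (snd a)))\<^sup>2 + \<sigma> / 2 * (norm (Bs (snd b)))\<^sup>2 - \<sigma> / 2 * (norm ?Y)\<^sup>2"
    by (simp add: algebra_simps)
  have xs: "x (Suc k) - y = (x k - y) + (\<tau> * \<sigma>) *\<^sub>R r"
    by (simp add: x_step r_def resid_def algebra_simps)
  have "1 / (2 * \<tau> * \<sigma>) * (norm (x (Suc k) - y))\<^sup>2
    = 1 / (2 * \<tau> * \<sigma>) * ((norm (x k - y))\<^sup>2 + 2 * (\<tau> * \<sigma>) * ((x k - y) \<bullet> r) + (\<tau> * \<sigma>)\<^sup>2 * (norm r)\<^sup>2)"
    unfolding xs norm_add_scaleR_sq ..
  also have "\<dots> = 1 / (2 * \<tau> * \<sigma>) * (norm (x k - y))\<^sup>2 + (x k \<bullet> r - y \<bullet> r) + \<tau> * \<sigma> / 2 * (norm r)\<^sup>2"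
    using sigma_pos tau_pos by (simp add: field_simps power2_eq_square inner_diff_left)
  finally have 2: "1 / (2 * \<tau> * \<sigma>) * (norm (x (Suc k) - y))\<^sup>2
      = 1 / (2 * \<tau> * \<sigma>) * (norm (x k - y))\<^sup>2 + (x k \<bullet> r - y \<bullet> r) + \<tau> * \<sigma> / 2 * (norm r)\<^sup>2" .
  have 3: "r \<bullet> (x k + \<sigma> *\<^sub>R r) = x k \<bullet> r + \<sigma> * (norm r)\<^sup>2"
    by (simp add: inner_simps power2_norm_eq_inner inner_commute)
  have 4: "(1 - \<tau> / 2) * \<sigma> * (norm r)\<^sup>2 = \<sigma> * (norm r)\<^sup>2 - \<tau> * \<sigma> / 2 * (norm r)\<^sup>2"
    by (simp add: algebra_simps)
  have proj: "fst a = u (Suc k) - fst z" "snd a = v (Suc k) - snd z" "fst b = u k - fst z" "snd b = v k - snd z"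
    by (simp_all add: a_def b_def)
  have 5: "mult_gap k z y = y \<bullet> r - ?s \<bullet> (x k + \<sigma> *\<^sub>R r)"
    by (simp add: mult_gap_def r_def inner_commute)
  show ?thesis
    using step_estimate[OF z, of k, folded \<Delta>_def a_def b_def r_def] 1 2 3 4
    unfolding 5 energy_def a_def[symmetric] b_def[symmetric] proj[symmetric] right_diff_distrib by linarith
qed

text \<open>Young's inequality for the seminorm of \<open>Q\<close>, after completing
  \<open>(fst a, 0)\<close> to a. The first form spends the |a|_Q^2 provided by
  \<open>step_energy\<close>; the second, aided by the product subtracted on the left, spends
  |b|_Q^2, so that the two telescope.\<close>

lemma cross_term_bound:
  assumes "d = a - b"
  shows "Q (0, snd d) \<bullet> (fst a, 0) \<le> 1/2 * sqn Q a + 1/2 * (sqn Q (0, snd b) - sqn Q (0, snd a))"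
    and "Q (0, snd d) \<bullet> (fst a, 0) - Q d \<bullet> (0, snd d) \<le> 1/2 * sqn Q b + 1/2 * (sqn Q (0, snd b) - sqn Q (0, snd a))"
proof -
  let ?d = "(0 :: 'u, snd d)" and ?a = "(0 :: 'u, snd a)" and ?b = "(0 :: 'u, snd b)"
  have ab: "?a - ?b = ?d" using assms by simp
  have tp: "Q ?d \<bullet> ?a = 1/2 * (sqn Q ?a - sqn Q ?b + sqn Q ?d)"
    using sqn_three_point[OF Q_sa, of ?a ?b] unfolding ab .
  have "(fst a, 0) = a - ?a" by (cases a) simp
  then have X: "Q ?d \<bullet> (fst a, 0) = Q ?d \<bullet> a - Q ?d \<bullet> ?a" by (simp only: inner_diff_right)
  show "Q ?d \<bullet> (fst a, 0) \<le> 1/2 * sqn Q a + 1/2 * (sqn Q ?b - sqn Q ?a)"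
    using psd_Young[OF Q_sa Q_psd, of ?d a] X tp by argo
  have "Q d \<bullet> ?d = Q ?d \<bullet> d" by (rule self_adj_commute[OF Q_sa])
  moreover have "Q ?d \<bullet> d = Q ?d \<bullet> a - Q ?d \<bullet> b" using assms by (simp add: inner_diff_right)
  ultimately show "Q ?d \<bullet> (fst a, 0) - Q d \<bullet> ?d \<le> 1/2 * sqn Q b + 1/2 * (sqn Q ?b - sqn Q ?a)"
    using psd_Young[OF Q_sa Q_psd, of ?d b] X tp by argo
qed

section \<open>Comparison of consecutive v-subproblems\<close>

text \<open>Each of two successive v-conditions is tested at the solution of the other, so the
  values of q cancel. The gradient difference is bounded by
  \<open>partial_gradient_increment_bound\<close>, and the multiplier update leaves the old residual
  with factor (1 - \<tau>)\<sigma>.\<close>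

lemma dual_increment_bound:
  fixes k :: nat
  defines "\<Delta> \<equiv> w (Suc (Suc k)) - w (Suc k)" and "\<Delta>' \<equiv> w (Suc k) - w k"
  shows "\<sigma> * (resid (w (Suc (Suc k))) \<bullet> Bs (snd \<Delta>)) \<le> (1 - \<tau>) * \<sigma> * (Bs (snd \<Delta>) \<bullet> resid (w (Suc k)))
    + 1/2 * (sqn T (snd \<Delta>') + sqn D2 (snd \<Delta>') - sqn T (snd \<Delta>) - sqn D2 (snd \<Delta>))
    + \<eta> / 2 * (sqn D1 (fst \<Delta>') + sqn D2 (snd \<Delta>)) - Q \<Delta> \<bullet> (0, snd \<Delta>)"
proof -
  let ?b = "snd \<Delta>" and ?r = "resid (w (Suc k))" and ?r' = "resid (w (Suc (Suc k)))"
  have V1: "0 \<le> q (v (Suc k)) - q (v (Suc (Suc k))) - (G (w (Suc k)) \<bullet> (0, ?b) + QH \<Delta> \<bullet> (0, ?b) + T ?b \<bullet> ?b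
      + (x (Suc k) + \<sigma> *\<^sub>R ?r') \<bullet> Bs ?b)"
  proof -
    have d: "v (Suc k) - v (Suc (Suc k)) = - ?b" "v (Suc (Suc k)) - v (Suc k) = ?b" by (simp_all add: \<Delta>_def)
    have pair: "(0, - ?b) = - (0 :: 'u, ?b)" by simp
    show ?thesis using v_VI[of "v (Suc k)" "Suc k"] v_step[of k] unfolding d pair \<Delta>_def[symmetric]
      by (simp only: inner_minus_right linear_neg[OF Bs_lin]) simp
  qed
  have V2: "0 \<le> q (v (Suc (Suc k))) - q (v (Suc k)) + (G (w k) \<bullet> (0, ?b) + QH \<Delta>' \<bullet> (0, ?b) + T (snd \<Delta>') \<bullet> ?b
      + (x k + \<sigma> *\<^sub>R ?r) \<bullet> Bs ?b)"
  proof -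
    have d: "v (Suc (Suc k)) - v (Suc k) = ?b" "v (Suc k) - v k = snd \<Delta>'" by (simp_all add: \<Delta>_def \<Delta>'_def)
    show ?thesis using v_VI[of "v (Suc (Suc k))" k] v_step[of "Suc k"] unfolding d \<Delta>'_def[symmetric] by simp
  qed
  have "QH \<Delta>' \<bullet> (0, ?b) - \<eta> / 2 * (sqn D1 (fst \<Delta>') + sqn D2 ?b) - 1/2 * (sqn D2 ?b + sqn D2 (snd \<Delta>'))
      \<le> (G (w k + \<Delta>') - G (w k)) \<bullet> (0, ?b)"
    by (rule partial_gradient_increment_bound[OF phi_grad G_lipschitz Q_sa D1_sa D2_sa hess_bounds eta_bound])
  moreover have "w k + \<Delta>' = w (Suc k)" by (simp add: \<Delta>'_def)
  ultimately have Gd: "QH \<Delta>' \<bullet> (0, ?b) - \<eta> / 2 * (sqn D1 (fst \<Delta>') + sqn D2 ?b) - 1/2 * (sqn D2 ?b + sqn D2 (snd \<Delta>'))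
      \<le> G (w (Suc k)) \<bullet> (0, ?b) - G (w k) \<bullet> (0, ?b)" by (simp only: inner_diff_left)
  have QHd: "QH \<Delta> \<bullet> (0, ?b) = Q \<Delta> \<bullet> (0, ?b) + sqn D2 ?b"
  proof -
    have "Diag D1 D2 \<Delta> \<bullet> (0, ?b) = sqn D2 ?b" by (cases \<Delta>) (simp add: Diag_def sqn_def inner_commute)
    then show ?thesis by (simp only: inner_add_left)
  qed
  have Tb: "T ?b \<bullet> ?b = sqn T ?b" by (simp add: sqn_def inner_commute)
  have xb: "(x (Suc k) + \<sigma> *\<^sub>R ?r') \<bullet> Bs ?b - (x k + \<sigma> *\<^sub>R ?r) \<bullet> Bs ?b
      = \<sigma> * (?r' \<bullet> Bs ?b) - (1 - \<tau>) * \<sigma> * (Bs ?b \<bullet> ?r)"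
    unfolding x_step resid_def[of "w (Suc k)", simplified, symmetric]
    by (simp add: inner_add_left inner_commute algebra_simps)
  show ?thesis
    using V1 V2 Gd QHd Tb xb psd_Young[OF T_sa T_psd, of "snd \<Delta>'" ?b] by argo
qed

text \<open>For \<open>\<tau> > 1\<close> the cross term \<open>\<langle>r, B\<^sup>* \<Delta>v\<rangle>\<close> is controlled by comparing two consecutive
  \<open>v\<close>-subproblems, which leaves the following terms to telescope.\<close>

definition increment_energy :: "nat \<Rightarrow> real" where
  "increment_energy k = (if \<tau> \<le> 1 then 0 else
     1/2 * (sqn T (v k - v (k - 1)) + sqn D2 (v k - v (k - 1))) + \<eta> / 2 * sqn D1 (u k - u (k - 1))
     + (1 - \<tau> / 2) * \<sigma> * (norm (resid (w k)))\<^sup>2)"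

text \<open>Divided by \<sigma>/2, the form is |Y|^2 + 2 (\<tau> - 1) \<open>Y \<bullet> r\<close> +
  (2 - \<tau>) |r|^2. Completing the square needs (\<tau> - 1)^2 \<le> 2 - \<tau>, that is \<tau>^2
  \<le> \<tau> + 1.\<close>

lemma golden_form_nonneg:
  fixes Y r :: "'x"
  assumes "1 < \<tau>" "\<tau> < (1 + sqrt 5) / 2"
  shows "0 \<le> \<sigma> / 2 * (norm Y)\<^sup>2 + (1 - \<tau> / 2) * \<sigma> * (norm r)\<^sup>2 - (1 - \<tau>) * \<sigma> * (Y \<bullet> r)" and "\<tau> < 2"
proof -
  have "2 * \<tau> - 1 \<le> sqrt 5" using assms by simp
  then have "(2 * \<tau> - 1)\<^sup>2 \<le> (sqrt 5)\<^sup>2" using assms(1) by (intro power_mono) auto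
  then have g: "(\<tau> - 1)\<^sup>2 \<le> 2 - \<tau>" by (simp add: power2_eq_square algebra_simps)
  then show "\<tau> < 2" using assms(1) by (smt (verit) zero_less_power2)
  have "0 \<le> (norm (Y + (\<tau> - 1) *\<^sub>R r))\<^sup>2" by simp
  also have "\<dots> = (norm Y)\<^sup>2 + 2 * (\<tau> - 1) * (Y \<bullet> r) + (\<tau> - 1)\<^sup>2 * (norm r)\<^sup>2" by (rule norm_add_scaleR_sq)
  also have "\<dots> \<le> (norm Y)\<^sup>2 + 2 * (\<tau> - 1) * (Y \<bullet> r) + (2 - \<tau>) * (norm r)\<^sup>2"
    using g by (simp add: mult_right_mono)
  finally have "0 \<le> \<sigma> / 2 * \<dots>" using sigma_pos by simp
  then show "0 \<le> \<sigma> / 2 * (norm Y)\<^sup>2 + (1 - \<tau> / 2) * \<sigma> * (norm r)\<^sup>2 - (1 - \<tau>) * \<sigma> * (Y \<bullet> r)"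
    by (simp add: algebra_simps)
qed

lemma increment_energy_nonneg:
  assumes "\<tau> \<le> 1 \<or> \<tau> < (1 + sqrt 5) / 2"
  shows "0 \<le> increment_energy k"
proof (cases "\<tau> \<le> 1")
  case False
  then have "\<tau> < 2" using golden_form_nonneg(2) assms by auto
  then show ?thesis unfolding increment_energy_def using sigma_pos eta_nonneg
    by (auto intro!: add_nonneg_nonneg mult_nonneg_nonneg sqn_nonneg T_psd D1_psd D2_psd)
qed (simp add: increment_energy_def)

lemma Young_resid: "\<sigma> * (r \<bullet> Y) \<le> \<sigma> / 2 * (norm r)\<^sup>2 + \<sigma> / 2 * (norm Y)\<^sup>2"
proof -
  have "r \<bullet> Y \<le> ((norm r)\<^sup>2 + (norm Y)\<^sup>2) / 2"
    using zero_le_power2[of "norm (r - Y)"] by (simp add: power2_norm_eq_inner inner_simps inner_commute)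
  from mult_left_mono[OF this, of \<sigma>] show ?thesis using sigma_pos by (simp add: field_simps)
qed

section \<open>Descent of the Lyapunov functions\<close>

text \<open>Here (1 - \<tau>/2)\<sigma> is at least \<sigma>/2, so Young's inequality absorbs the
  residual product within a single step.\<close>

lemma descent_tau_le_1:
  assumes z: "fst z \<in> Dp" "snd z \<in> Dq" and tau: "\<tau> \<le> 1"
  shows "gap_theta (Suc k) z + mult_gap k z y \<le> energy z y k - energy z y (Suc k)"
proof -
  let ?\<Delta> = "w (Suc k) - w k" and ?r = "resid (w (Suc k))"
  have "\<sigma> / 2 * (norm ?r)\<^sup>2 \<le> (1 - \<tau> / 2) * \<sigma> * (norm ?r)\<^sup>2"
    using tau sigma_pos by (intro mult_right_mono) (auto simp: field_simps)
  moreover have "?\<Delta> = (w (Suc k) - z) - (w k - z)" by simp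
  note cross_term_bound(1)[OF this]
  ultimately show ?thesis
    using step_energy[OF z, of k y] Young_resid[of ?r "Bs (snd ?\<Delta>)"]
      sqn_nonneg[OF S_psd, of "fst ?\<Delta>"] sqn_nonneg[OF T_psd, of "snd ?\<Delta>"] by argo
qed

text \<open>The residual product is traded for one with the previous residual, which the golden
  ratio form absorbs. Two v-subproblems take part, so the inequality starts one step later. The
  terms with -\<eta> remain and must be paid by \<open>S\<close>, \<open>T\<close> and
  \<open>Q\<close>.\<close>

lemma descent_tau_gt_1:
  fixes k :: nat
  assumes z: "fst z \<in> Dp" "snd z \<in> Dq" and tau: "1 < \<tau>" "\<tau> < (1 + sqrt 5) / 2"
  defines "\<Delta> \<equiv> w (Suc (Suc k)) - w (Suc k)"
  shows "gap_theta (Suc (Suc k)) z + mult_gap (Suc k) z y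
      + 1/2 * (sqn S (fst \<Delta>) + sqn T (snd \<Delta>) - \<eta> * (sqn D1 (fst \<Delta>) + sqn D2 (snd \<Delta>)))
     \<le> (energy z y (Suc k) + 1/2 * sqn Q (w (Suc k) - z) + increment_energy (Suc k))
        - (energy z y (Suc (Suc k)) + 1/2 * sqn Q (w (Suc (Suc k)) - z) + increment_energy (Suc (Suc k)))"
proof -
  let ?\<Delta>' = "w (Suc k) - w k" and ?r = "resid (w (Suc k))" and ?r' = "resid (w (Suc (Suc k)))"
  have "\<Delta> = (w (Suc (Suc k)) - z) - (w (Suc k) - z)" by (simp add: \<Delta>_def)
  note cross = cross_term_bound(2)[OF this]
  have aux1: "increment_energy (Suc k) = 1/2 * (sqn T (snd ?\<Delta>') + sqn D2 (snd ?\<Delta>')) + \<eta> / 2 * sqn D1 (fst ?\<Delta>')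
       + (1 - \<tau> / 2) * \<sigma> * (norm ?r)\<^sup>2"
    and aux2: "increment_energy (Suc (Suc k)) = 1/2 * (sqn T (snd \<Delta>) + sqn D2 (snd \<Delta>)) + \<eta> / 2 * sqn D1 (fst \<Delta>)
       + (1 - \<tau> / 2) * \<sigma> * (norm ?r')\<^sup>2"
    using tau by (simp_all add: increment_energy_def \<Delta>_def)
  show ?thesis
    using step_energy[OF z, of "Suc k" y, folded \<Delta>_def] dual_increment_bound[of k, folded \<Delta>_def] cross
      golden_form_nonneg(1)[OF tau, of "Bs (snd \<Delta>)" ?r]
    unfolding aux1 aux2 by (simp only: distrib_left right_diff_distrib)
qed

definition lyapunov :: "real \<Rightarrow> 'u \<times> 'v \<Rightarrow> 'x \<Rightarrow> nat \<Rightarrow> real" where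
  "lyapunov \<kappa> z y k = energy z y k + \<kappa> * sqn Q (w k - z) + increment_energy k"

text \<open>For \<tau> > 1 the descent inequality carries |w - z|_Q^2 with coefficient 1/2 at both
  ends, and linearisation gains another 1/2 at the new iterate. Raising the coefficient to 3/4 uses
  half of this gain and leaves 1/4 (|a|_Q^2 + |b|_Q^2), which dominates 1/8 |a - b|_Q^2.\<close>

definition coeff_VI :: real where "coeff_VI = (if \<tau> \<le> 1 then 1/2 else 3/4)"
definition coeff_theta :: real where "coeff_theta = (if \<tau> \<le> 1 then 0 else 1/2)"

lemma descent_VI:
  assumes z: "fst z \<in> Dp" "snd z \<in> Dq"
    and tau: "\<tau> \<le> 1 \<or> \<tau> < (1 + sqrt 5) / 2 \<and>
       psd (\<lambda>w. (1/4) *\<^sub>R Q w + Diag (\<lambda>a. S a - \<eta> *\<^sub>R D1 a) (\<lambda>b. T b - \<eta> *\<^sub>R D2 b) w)"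
  shows "gap_VI (Suc (Suc k)) z + mult_gap (Suc k) z y \<le> lyapunov coeff_VI z y (Suc k) - lyapunov coeff_VI z y (Suc (Suc k))"
proof (cases "\<tau> \<le> 1")
  case True
  then show ?thesis
    using descent_tau_le_1[OF z True, of "Suc k" y] gap_VI_le_gap_theta[of "Suc (Suc k)" z]
      sqn_nonneg[OF Q_psd, of "w (Suc k) - z"]
    by (simp add: lyapunov_def coeff_VI_def increment_energy_def)
next
  case False
  let ?\<Delta> = "w (Suc (Suc k)) - w (Suc k)" and ?a = "w (Suc (Suc k)) - z" and ?b = "w (Suc k) - z"
  have "0 \<le> 1/4 * sqn Q ?\<Delta> + (sqn S (fst ?\<Delta>) + sqn T (snd ?\<Delta>) - \<eta> * (sqn D1 (fst ?\<Delta>) + sqn D2 (snd ?\<Delta>)))"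
  proof -
    have "0 \<le> ?\<Delta> \<bullet> ((1/4) *\<^sub>R Q ?\<Delta> + Diag (\<lambda>a. S a - \<eta> *\<^sub>R D1 a) (\<lambda>b. T b - \<eta> *\<^sub>R D2 b) ?\<Delta>)"
      using tau False unfolding psd_def by blast
    also have "\<dots> = 1/4 * sqn Q ?\<Delta> + (sqn S (fst ?\<Delta>) + sqn T (snd ?\<Delta>) - \<eta> * (sqn D1 (fst ?\<Delta>) + sqn D2 (snd ?\<Delta>)))"
      by (simp only: sqn_def inner_add_right inner_scaleR_right) (simp add: Diag_def inner_simps algebra_simps)
    finally show ?thesis .
  qed
  \<comment> \<open>Half of the quarter of \<open>Q\<close> in case (b), since the increment terms
    enter the descent inequality with factor 1/2.\<close>
  moreover have "1/8 * sqn Q ?\<Delta> \<le> 1/4 * sqn Q ?a + 1/4 * sqn Q ?b"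
  proof -
    have "?\<Delta> = ?a - ?b" by simp
    then have "sqn Q ?\<Delta> + sqn Q (?a + ?b) = 2 * sqn Q ?a + 2 * sqn Q ?b"
      using sqn_parallelogram[OF Q_sa, of ?a ?b] by (simp only:)
    then show ?thesis using sqn_nonneg[OF Q_psd, of "?a + ?b"] by linarith
  qed
  moreover have t: "1 < \<tau>" "\<tau> < (1 + sqrt 5) / 2" and coeff_VI: "coeff_VI = 3/4" using False tau by (auto simp: coeff_VI_def)
  ultimately show ?thesis
    using descent_tau_gt_1[OF z t, of k y] gap_VI_le_gap_theta[of "Suc (Suc k)" z]
    unfolding lyapunov_def coeff_VI by argo
qed

lemma descent_theta:
  assumes z: "fst z \<in> Dp" "snd z \<in> Dq"
    and tau: "\<tau> \<le> 1 \<or> \<tau> < (1 + sqrt 5) / 2 \<and> psd (\<lambda>a. S a - \<eta> *\<^sub>R D1 a) \<and> psd (\<lambda>b. T b - \<eta> *\<^sub>R D2 b)"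
  shows "gap_theta (Suc (Suc k)) z + mult_gap (Suc k) z y \<le> lyapunov coeff_theta z y (Suc k) - lyapunov coeff_theta z y (Suc (Suc k))"
proof (cases "\<tau> \<le> 1")
  case True
  then show ?thesis
    using descent_tau_le_1[OF z True, of "Suc k" y] by (simp add: lyapunov_def coeff_theta_def increment_energy_def)
next
  case False
  let ?\<Delta> = "w (Suc (Suc k)) - w (Suc k)"
  have "0 \<le> fst ?\<Delta> \<bullet> (S (fst ?\<Delta>) - \<eta> *\<^sub>R D1 (fst ?\<Delta>))" "0 \<le> snd ?\<Delta> \<bullet> (T (snd ?\<Delta>) - \<eta> *\<^sub>R D2 (snd ?\<Delta>))"
    using tau False unfolding psd_def by blast+
  then have "0 \<le> sqn S (fst ?\<Delta>) + sqn T (snd ?\<Delta>) - \<eta> * (sqn D1 (fst ?\<Delta>) + sqn D2 (snd ?\<Delta>))"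
    by (simp add: sqn_def inner_diff_right algebra_simps)
  moreover have t: "1 < \<tau>" "\<tau> < (1 + sqrt 5) / 2" and coeff_theta: "coeff_theta = 1/2" using False tau by (auto simp: coeff_theta_def)
  ultimately show ?thesis
    using descent_tau_gt_1[OF z t, of k y] unfolding lyapunov_def coeff_theta by argo
qed

section \<open>Ergodic rates\<close>

lemma iterates_mem: "u (Suc k) \<in> Dp" "v (Suc k) \<in> Dq"
  using u_step v_step by auto

lemma coeff_VI_nonneg: "0 \<le> coeff_VI" and coeff_theta_nonneg: "0 \<le> coeff_theta"
  by (simp_all add: coeff_VI_def coeff_theta_def)

lemma energy_ge:
  assumes "0 \<le> \<kappa>" "\<tau> \<le> 1 \<or> \<tau> < (1 + sqrt 5) / 2"
  shows "1/2 * sqn S (u k - fst z) + 1/2 * sqn T (v k - snd z)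
     + \<sigma> / 2 * (norm (Bs (v k - snd z)))\<^sup>2 + 1 / (2 * \<tau> * \<sigma>) * (norm (x k - y))\<^sup>2
     + 1/2 * sqn Q (0, v k - snd z) + \<sigma> * (resid z \<bullet> Bs (v k)) + \<kappa> * sqn Q (w k - z) \<le> lyapunov \<kappa> z y k"
proof -
  have "0 \<le> sqn (Diag D1 D2) (w k - z)"
    using sqn_nonneg[OF D1_psd] sqn_nonneg[OF D2_psd] by (cases z) simp
  then show ?thesis using increment_energy_nonneg[OF assms(2), of k] by (simp add: lyapunov_def energy_def)
qed

text \<open>All terms except the linear one are nonnegative; for a feasible centre the left side is
  zero and the Lyapunov function is nonnegative.\<close>

lemma lyapunov_ge:
  assumes "0 \<le> \<kappa>" "\<tau> \<le> 1 \<or> \<tau> < (1 + sqrt 5) / 2"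
  shows "\<sigma> * (resid z \<bullet> Bs (v k)) \<le> lyapunov \<kappa> z y k"
proof -
  have "0 \<le> \<sigma> / 2 * (norm (Bs (v k - snd z)))\<^sup>2" "0 \<le> 1 / (2 * \<tau> * \<sigma>) * (norm (x k - y))\<^sup>2"
    "0 \<le> \<kappa> * sqn Q (w k - z)"
    using sigma_pos tau_pos assms(1) sqn_nonneg[OF Q_psd] by auto
  then show ?thesis
    using energy_ge[OF assms, of k z y] sqn_nonneg[OF S_psd, of "u k - fst z"] sqn_nonneg[OF T_psd, of "v k - snd z"]
      sqn_nonneg[OF Q_psd, of "(0, v k - snd z)"] by argo
qed

lemma x_Suc: "x (Suc k) = x k + (\<tau> * \<sigma>) *\<^sub>R resid (w (Suc k))"
  by (simp add: x_step resid_def)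

definition uh where "uh = average (\<lambda>i. u (Suc i))"
definition vh where "vh = average (\<lambda>i. v (Suc i))"
definition xh where "xh = average (\<lambda>i. x i + \<sigma> *\<^sub>R resid (w (Suc i)))"

lemma resid_average: "1 \<le> k \<Longrightarrow> real k *\<^sub>R resid (uh k, vh k) = (\<Sum>i = 1..k. resid (w (Suc i)))"
proof -
  assume k: "1 \<le> k"
  have "real k *\<^sub>R resid (uh k, vh k) = As (real k *\<^sub>R uh k) + Bs (real k *\<^sub>R vh k) - real k *\<^sub>R c"
    using As_lin Bs_lin by (simp add: resid_def linear_cmul algebra_simps)
  also have "\<dots> = As (\<Sum>i = 1..k. u (Suc i)) + Bs (\<Sum>i = 1..k. v (Suc i)) - (\<Sum>i = 1..k. c)"
    unfolding uh_def vh_def scaleR_average[OF k] by (simp add: scaleR_conv_of_real sum_constant_scaleR)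
  also have "\<dots> = (\<Sum>i = 1..k. resid (w (Suc i)))"
    using As_lin Bs_lin by (simp add: resid_def linear_sum sum.distrib sum_subtractf)
  finally show ?thesis .
qed

text \<open>The multiplier update telescopes, so bounded multipliers already give the rate
  (i).\<close>

lemma sum_resid: "(\<tau> * \<sigma>) *\<^sub>R (\<Sum>i = 1..k. resid (w (Suc i))) = x (Suc k) - x 1"
proof (induction k)
  case (Suc k)
  then show ?case by (simp add: scaleR_add_right x_Suc[of "Suc k"])
qed simp

text \<open>The descent inequality is summed from index 1. Jensen's inequality handles p and q; the
  linearised smooth part and the multiplier part are affine in the iterates and average without
  loss.\<close>

lemma ergodic_VI:
  assumes k: "1 \<le> k" and z: "a \<in> Dp" "b \<in> Dq"
    and tau: "\<tau> \<le> 1 \<or> \<tau> < (1 + sqrt 5) / 2 \<and>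
       psd (\<lambda>w. (1/4) *\<^sub>R Q w + Diag (\<lambda>a. S a - \<eta> *\<^sub>R D1 a) (\<lambda>b. T b - \<eta> *\<^sub>R D2 b) w)"
  shows "real k * ((p (uh k) + q (vh k)) - (p a + q b) + ((uh k, vh k) - (a, b)) \<bullet> G (a, b)
        + (uh k - a) \<bullet> A y + (vh k - b) \<bullet> B y - (xh k - y) \<bullet> resid (a, b))
     \<le> lyapunov coeff_VI (a, b) y 1 - lyapunov coeff_VI (a, b) y (Suc k)"
proof -
  let ?z = "(a, b)" and ?s = "resid (a, b)"
  have p: "real k * p (uh k) \<le> (\<Sum>i = 1..k. p (u (Suc i)))" and q: "real k * q (vh k) \<le> (\<Sum>i = 1..k. q (v (Suc i)))"
    unfolding uh_def vh_def
    by (rule convex_on_average[OF Dp_convex(2) k, where y="\<lambda>i. u (Suc i)"]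
          convex_on_average[OF Dq_convex(2) k, where y="\<lambda>i. v (Suc i)"], rule iterates_mem)+
  have wsum: "real k *\<^sub>R (uh k, vh k) = (\<Sum>i = 1..k. w (Suc i))"
    unfolding uh_def vh_def average_Pair[symmetric] scaleR_average[OF k] ..
  have G: "real k * (((uh k, vh k) - ?z) \<bullet> G ?z) = (\<Sum>i = 1..k. G ?z \<bullet> (w (Suc i) - ?z))"
  proof -
    have "real k * (((uh k, vh k) - ?z) \<bullet> G ?z) = (real k *\<^sub>R (uh k, vh k)) \<bullet> G ?z - real k * (?z \<bullet> G ?z)"
      by (simp only: inner_diff_left right_diff_distrib inner_scaleR_left)
    also have "\<dots> = (\<Sum>i = 1..k. G ?z \<bullet> (w (Suc i) - ?z))"
      unfolding wsum by (simp only: inner_diff_right inner_sum_left sum_subtractf inner_commute[of "G ?z"]) simp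
    finally show ?thesis .
  qed
  have AB: "(uh k - a) \<bullet> A y + (vh k - b) \<bullet> B y - (xh k - y) \<bullet> ?s = resid (uh k, vh k) \<bullet> y - ?s \<bullet> xh k"
  proof -
    have "(uh k - a) \<bullet> A y = As (uh k - a) \<bullet> y" "(vh k - b) \<bullet> B y = Bs (vh k - b) \<bullet> y"
      using adjoint_works[OF A_lin, of y] adjoint_works[OF B_lin, of y] by (simp_all add: inner_commute)
    moreover have "resid (uh k, vh k) = ?s + As (uh k - a) + Bs (vh k - b)"
      using resid_diff[of "(uh k, vh k)" ?z] by (simp add: algebra_simps)
    ultimately show ?thesis by (simp add: inner_simps inner_commute)
  qed
  have M: "real k * (resid (uh k, vh k) \<bullet> y - ?s \<bullet> xh k) = (\<Sum>i = 1..k. mult_gap i ?z y)"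
  proof -
    have xs: "real k *\<^sub>R xh k = (\<Sum>i = 1..k. x i + \<sigma> *\<^sub>R resid (w (Suc i)))"
      unfolding xh_def by (rule scaleR_average[OF k])
    have "real k * (?s \<bullet> xh k) = (\<Sum>i = 1..k. ?s \<bullet> (x i + \<sigma> *\<^sub>R resid (w (Suc i))))"
      unfolding inner_scaleR_right[symmetric] xs inner_sum_right ..
    moreover have "real k * (resid (uh k, vh k) \<bullet> y) = (\<Sum>i = 1..k. resid (w (Suc i)) \<bullet> y)"
      unfolding inner_scaleR_left[symmetric] resid_average[OF k] inner_sum_left ..
    ultimately show ?thesis by (simp only: mult_gap_def sum_subtractf right_diff_distrib)
  qed
  have "(\<Sum>i = 1..k. gap_VI (Suc i) ?z + mult_gap i ?z y) \<le> lyapunov coeff_VI ?z y 1 - lyapunov coeff_VI ?z y (Suc k)"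
    by (rule sum_le_telescope) (use descent_VI[of ?z] z tau in auto)
  moreover have "(\<Sum>i = 1..k. gap_VI (Suc i) ?z + mult_gap i ?z y)
     = (\<Sum>i = 1..k. p (u (Suc i))) + (\<Sum>i = 1..k. q (v (Suc i))) - real k * (p a + q b)
      + (\<Sum>i = 1..k. G ?z \<bullet> (w (Suc i) - ?z)) + (\<Sum>i = 1..k. mult_gap i ?z y)"
    unfolding gap_VI_def sum.distrib sum_subtractf by (simp add: distrib_left)
  moreover have "real k * ((p (uh k) + q (vh k)) - (p a + q b) + ((uh k, vh k) - ?z) \<bullet> G ?z
        + (uh k - a) \<bullet> A y + (vh k - b) \<bullet> B y - (xh k - y) \<bullet> ?s)
     = real k * p (uh k) + real k * q (vh k) - real k * (p a + q b) + real k * (((uh k, vh k) - ?z) \<bullet> G ?z)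
        + real k * ((uh k - a) \<bullet> A y + (vh k - b) \<bullet> B y - (xh k - y) \<bullet> ?s)"
    by (simp only: distrib_left right_diff_distrib)
  ultimately show ?thesis using p q unfolding AB G M by argo
qed

text \<open>At a feasible centre with y = 0 the multiplier gap vanishes. This gives the upper half
  of (iii); the lower half comes from a saddle point inequality.\<close>

lemma ergodic_theta:
  assumes k: "1 \<le> k" and z: "a \<in> Dp" "b \<in> Dq" "As a + Bs b = c"
    and tau: "\<tau> \<le> 1 \<or> \<tau> < (1 + sqrt 5) / 2 \<and> psd (\<lambda>a. S a - \<eta> *\<^sub>R D1 a) \<and> psd (\<lambda>b. T b - \<eta> *\<^sub>R D2 b)"
  shows "real k * ((p (uh k) + q (vh k) + phi (uh k, vh k)) - (p a + q b + phi (a, b))) \<le> lyapunov coeff_theta (a, b) 0 1"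
proof -
  let ?z = "(a, b)"
  have s: "resid ?z = 0" using z(3) by (simp add: resid_def)
  have p: "real k * p (uh k) \<le> (\<Sum>i = 1..k. p (u (Suc i)))" and q: "real k * q (vh k) \<le> (\<Sum>i = 1..k. q (v (Suc i)))"
    unfolding uh_def vh_def
    by (rule convex_on_average[OF Dp_convex(2) k, where y="\<lambda>i. u (Suc i)"]
          convex_on_average[OF Dq_convex(2) k, where y="\<lambda>i. v (Suc i)"], rule iterates_mem)+
  have phi: "real k * phi (uh k, vh k) \<le> (\<Sum>i = 1..k. phi (w (Suc i)))"
    unfolding uh_def vh_def average_Pair[symmetric] by (rule convex_on_average[OF phi_convex k]) auto
  have "(\<Sum>i = 1..k. gap_theta (Suc i) ?z + mult_gap i ?z 0) \<le> lyapunov coeff_theta ?z 0 1 - lyapunov coeff_theta ?z 0 (Suc k)"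
    by (rule sum_le_telescope) (use descent_theta[of ?z] z tau in auto)
  moreover have "0 \<le> lyapunov coeff_theta ?z 0 (Suc k)"
    using lyapunov_ge[OF coeff_theta_nonneg, of ?z "Suc k" 0] tau s by auto
  moreover have "(\<Sum>i = 1..k. gap_theta (Suc i) ?z + mult_gap i ?z 0) = (\<Sum>i = 1..k. p (u (Suc i)))
     + (\<Sum>i = 1..k. q (v (Suc i))) + (\<Sum>i = 1..k. phi (w (Suc i))) - real k * (p a + q b + phi ?z)"
    by (simp add: gap_theta_def mult_gap_def s sum.distrib sum_subtractf)
  ultimately show ?thesis using p q phi by (simp only: distrib_left right_diff_distrib)
qed

section \<open>The KKT multiplier and boundedness of the iterates\<close>

text \<open>One multiplier in two forms: the inequality for values bounds \<theta> from below in
  (iii), and its linearised form makes \<open>gap_VI\<close> plus \<open>mult_gap\<close>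
  nonnegative at the optimal centre.\<close>

lemma KKT_multiplier:
  assumes opt: "ubar \<in> Dp" "vbar \<in> Dq" "As ubar + Bs vbar = c"
        "\<And>a b. a \<in> Dp \<Longrightarrow> b \<in> Dq \<Longrightarrow> As a + Bs b = c \<Longrightarrow>
           p ubar + q vbar + phi (ubar, vbar) \<le> p a + q b + phi (a, b)"
    and slater: "(ur, vr) \<in> rel_interior (Dp \<times> Dq)" "As ur + Bs vr = c"
  obtains xbar where
    "\<And>a b. a \<in> Dp \<Longrightarrow> b \<in> Dq \<Longrightarrow> p ubar + q vbar + phi (ubar, vbar) \<le> p a + q b + phi (a, b) + xbar \<bullet> resid (a, b)"
    "\<And>a b. a \<in> Dp \<Longrightarrow> b \<in> Dq \<Longrightarrow> 0 \<le> p a + q b - (p ubar + q vbar) + G (ubar, vbar) \<bullet> ((a, b) - (ubar, vbar)) + resid (a, b) \<bullet> xbar"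
proof -
  let ?f = "\<lambda>z. p (fst z) + q (snd z)" and ?\<Lambda> = "\<lambda>z. As (fst z) + Bs (snd z)" and ?zb = "(ubar, vbar)"
  have cS: "convex (Dp \<times> Dq)" using Dp_convex Dq_convex by (simp add: convex_Times)
  have cf: "convex_on (Dp \<times> Dq) ?f"
  proof (rule convex_onI[OF _ cS])
    fix t :: real and y z assume t: "0 < t" "t < 1" and yz: "y \<in> Dp \<times> Dq" "z \<in> Dp \<times> Dq"
    have "p ((1 - t) *\<^sub>R fst y + t *\<^sub>R fst z) \<le> (1 - t) * p (fst y) + t * p (fst z)"
      "q ((1 - t) *\<^sub>R snd y + t *\<^sub>R snd z) \<le> (1 - t) * q (snd y) + t * q (snd z)"
      using t yz by (auto intro!: convex_onD[OF Dp_convex(2)] convex_onD[OF Dq_convex(2)])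
    then show "?f ((1 - t) *\<^sub>R y + t *\<^sub>R z) \<le> (1 - t) * ?f y + t * ?f z" by (simp add: algebra_simps)
  qed
  have cphi: "convex_on (Dp \<times> Dq) (\<lambda>z. ?f z + phi z)"
    by (rule convex_on_add[OF cf convex_on_subset[OF phi_convex _ cS]]) simp
  have lin: "linear ?\<Lambda>"
    using As_lin Bs_lin by (auto simp: linear_iff algebra_simps)
  obtain xbar where xbar: "\<And>z. z \<in> Dp \<times> Dq \<Longrightarrow> p ubar + q vbar + phi ?zb \<le> ?f z + phi z + xbar \<bullet> (?\<Lambda> z - c)"
  proof (rule lagrange_multiplier_rel_interior[OF cS cphi lin slater(1), where c=c and m="p ubar + q vbar + phi ?zb"])
    show "?\<Lambda> (ur, vr) = c" using slater(2) by simp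
    show "p ubar + q vbar + phi ?zb \<le> ?f z + phi z" if "z \<in> Dp \<times> Dq" "?\<Lambda> z = c" for z
      using opt(4)[of "fst z" "snd z"] that by (simp add: mem_Times_iff)
  qed blast
  have sum0: "?\<Lambda> ?zb - c = 0" using opt(3) by simp
  show thesis
  proof
    show "p ubar + q vbar + phi (ubar, vbar) \<le> p a + q b + phi (a, b) + xbar \<bullet> resid (a, b)"
      if "a \<in> Dp" "b \<in> Dq" for a b using xbar[of "(a,b)"] that by (simp add: resid_def)
    show "0 \<le> p a + q b - (p ubar + q vbar) + G (ubar, vbar) \<bullet> ((a, b) - (ubar, vbar)) + resid (a, b) \<bullet> xbar"
      if ab: "a \<in> Dp" "b \<in> Dq" for a b
    proof -
      have bl: "bounded_linear ?\<Lambda>" using lin by (simp add: linear_conv_bounded_linear)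
      have "((\<lambda>z. phi z + xbar \<bullet> (?\<Lambda> z - c)) has_derivative (\<lambda>h. G ?zb \<bullet> h + xbar \<bullet> (?\<Lambda> h - 0))) (at ?zb)"
        by (intro has_derivative_add phi_grad has_derivative_inner_right has_derivative_diff has_derivative_const
            bounded_linear_imp_has_derivative[OF bl])
      then have "0 \<le> ?f (a, b) - ?f ?zb + (G ?zb \<bullet> ((a, b) - ?zb) + xbar \<bullet> (?\<Lambda> ((a, b) - ?zb) - 0))"
      proof (rule convex_plus_smooth_min_VI[OF cS cf, rotated])
        show "?f ?zb + (phi ?zb + xbar \<bullet> (?\<Lambda> ?zb - c)) \<le> ?f z + (phi z + xbar \<bullet> (?\<Lambda> z - c))"
          if "z \<in> Dp \<times> Dq" for z
          using xbar[OF that] unfolding sum0 by simp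
      qed (use ab opt(1,2) in auto)
      moreover have "?\<Lambda> ((a, b) - ?zb) = resid (a, b)"
        using resid_diff[of "(a, b)" ?zb] opt(3) by (simp add: resid_def)
      ultimately show ?thesis by (simp add: inner_commute[of xbar])
    qed
  qed
qed

text \<open>Expresses the definiteness hypotheses through the seminorms that the energy
  controls.\<close>

lemma quadratic_forms:
  "a \<bullet> (blk11 Q a + \<sigma> *\<^sub>R A (As a) + S a) = sqn Q (a, 0) + \<sigma> * (norm (As a))\<^sup>2 + sqn S a"
  "b \<bullet> (blk22 Q b + \<sigma> *\<^sub>R B (Bs b) + T b) = sqn Q (0, b) + \<sigma> * (norm (Bs b))\<^sup>2 + sqn T b"
proof -
  have "a \<bullet> fst (Q (a, 0)) = (a, 0) \<bullet> Q (a, 0)" "b \<bullet> snd (Q (0, b)) = (0, b) \<bullet> Q (0, b)"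
    by (simp_all add: inner_prod_def)
  moreover have "a \<bullet> A (As a) = (norm (As a))\<^sup>2" "b \<bullet> B (Bs b) = (norm (Bs b))\<^sup>2"
    using adjoint_works[OF A_lin, of "As a" a] adjoint_works[OF B_lin, of "Bs b" b]
    by (simp_all add: power2_norm_eq_inner inner_commute)
  ultimately show "a \<bullet> (blk11 Q a + \<sigma> *\<^sub>R A (As a) + S a) = sqn Q (a, 0) + \<sigma> * (norm (As a))\<^sup>2 + sqn S a"
    "b \<bullet> (blk22 Q b + \<sigma> *\<^sub>R B (Bs b) + T b) = sqn Q (0, b) + \<sigma> * (norm (Bs b))\<^sup>2 + sqn T b"
    by (simp_all add: inner_add_right sqn_def blk11_def blk22_def)
qed

lemma quadratic_forms_linear:
  "linear (\<lambda>a. blk11 Q a + \<sigma> *\<^sub>R A (As a) + S a)" "linear (\<lambda>b. blk22 Q b + \<sigma> *\<^sub>R B (Bs b) + T b)"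
proof -
  have "Q (a + a', 0) = Q (a, 0) + Q (a', 0)" "Q (t *\<^sub>R a, 0) = t *\<^sub>R Q (a, 0)" for a a' t
    using linear_add[OF Q_lin, of "(a, 0)" "(a', 0)"] linear_cmul[OF Q_lin, of t "(a, 0)"] by simp_all
  then have 1: "linear (blk11 Q)" by (simp add: linear_iff blk11_def)
  have "Q (0, b + b') = Q (0, b) + Q (0, b')" "Q (0, t *\<^sub>R b) = t *\<^sub>R Q (0, b)" for b b' t
    using linear_add[OF Q_lin, of "(0, b)" "(0, b')"] linear_cmul[OF Q_lin, of t "(0, b)"] by simp_all
  then have 2: "linear (blk22 Q)" by (simp add: linear_iff blk22_def)
  show "linear (\<lambda>a. blk11 Q a + \<sigma> *\<^sub>R A (As a) + S a)"
    by (intro linear_compose_add linear_compose_scale_right 1 self_adj_linear[OF S_sa]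
        linear_compose[OF As_lin A_lin, unfolded o_def])
  show "linear (\<lambda>b. blk22 Q b + \<sigma> *\<^sub>R B (Bs b) + T b)"
    by (intro linear_compose_add linear_compose_scale_right 2 self_adj_linear[OF T_sa]
        linear_compose[OF Bs_lin B_lin, unfolded o_def])
qed

text \<open>Centred at the KKT point the Lyapunov function does not increase. It bounds x directly
  and v through definiteness of the second block; the residual follows from consecutive x, and u
  from the residual, v and the full \<open>Q\<close> seminorm. The residual bound needs x at two
  indices from 1 on, so it and the bound for u start at index 2.\<close>

lemma iterates_bounded:
  assumes tau: "\<tau> \<le> 1 \<or> \<tau> < (1 + sqrt 5) / 2 \<and>
       psd (\<lambda>w. (1/4) *\<^sub>R Q w + Diag (\<lambda>a. S a - \<eta> *\<^sub>R D1 a) (\<lambda>b. T b - \<eta> *\<^sub>R D2 b) w)"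
    and bar: "ubar \<in> Dp" "vbar \<in> Dq" "As ubar + Bs vbar = c"
    and KKT: "\<And>a b. a \<in> Dp \<Longrightarrow> b \<in> Dq \<Longrightarrow>
       0 \<le> p a + q b - (p ubar + q vbar) + G (ubar, vbar) \<bullet> ((a, b) - (ubar, vbar)) + resid (a, b) \<bullet> xbar"
    and pd1: "pd (\<lambda>a. blk11 Q a + \<sigma> *\<^sub>R A (As a) + S a)"
    and pd2: "pd (\<lambda>b. blk22 Q b + \<sigma> *\<^sub>R B (Bs b) + T b)"
  obtains R where "\<And>k. norm (u (Suc (Suc k)) - ubar) \<le> R" "\<And>k. norm (v (Suc k) - vbar) \<le> R"
    "\<And>k. norm (x (Suc k) - xbar) \<le> R" "\<And>k. norm (resid (w (Suc (Suc k)))) \<le> R"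
proof -
  let ?z = "(ubar, vbar)"
  have s: "resid ?z = 0" using bar(3) by (simp add: resid_def)
  have tau': "\<tau> \<le> 1 \<or> \<tau> < (1 + sqrt 5) / 2" using tau by blast
  define E where "E = lyapunov coeff_VI ?z xbar 1"
  have lyapunov_le: "lyapunov coeff_VI ?z xbar (Suc k) \<le> E" for k
  proof (induction k)
    case (Suc k)
    have "0 \<le> gap_VI (Suc (Suc k)) ?z + mult_gap (Suc k) ?z xbar"
      using KKT[OF iterates_mem[of "Suc k"]] by (simp add: gap_VI_def mult_gap_def s)
    then show ?case using descent_VI[of ?z k xbar] bar tau Suc by simp
  qed (simp add: E_def)
  have parts: "1/2 * sqn S (u k - ubar) + 1/2 * sqn T (v k - vbar)
     + \<sigma> / 2 * (norm (Bs (v k - vbar)))\<^sup>2 + 1 / (2 * \<tau> * \<sigma>) * (norm (x k - xbar))\<^sup>2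
     + 1/2 * sqn Q (0, v k - vbar) + coeff_VI * sqn Q (w k - ?z) \<le> E" if "1 \<le> k" for k
    using energy_ge[OF coeff_VI_nonneg tau', of k ?z xbar] lyapunov_le[of "k - 1"] that s by simp
  have coeff_VI: "1/2 * sqn Q (w k - ?z) \<le> coeff_VI * sqn Q (w k - ?z)" for k
    using sqn_nonneg[OF Q_psd] by (intro mult_right_mono) (auto simp: coeff_VI_def)
  have nn: "0 \<le> sqn S (u k - ubar)" "0 \<le> sqn T (v k - vbar)" "0 \<le> sqn Q (0, v k - vbar)" "0 \<le> sqn Q (w k - ?z)"
     "0 \<le> \<sigma> / 2 * (norm (Bs (v k - vbar)))\<^sup>2" "0 \<le> 1 / (2 * \<tau> * \<sigma>) * (norm (x k - xbar))\<^sup>2" for k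
    using sqn_nonneg[OF S_psd] sqn_nonneg[OF T_psd] sqn_nonneg[OF Q_psd] sigma_pos tau_pos by auto
  define X where "X = sqrt (E / (1 / (2 * \<tau> * \<sigma>)))"
  have xb: "norm (x k - xbar) \<le> X" if "1 \<le> k" for k
    unfolding X_def
  proof (rule norm_le_if_coercive)
    show "0 < 1 / (2 * \<tau> * \<sigma>)" using sigma_pos tau_pos by simp
    show "1 / (2 * \<tau> * \<sigma>) * (norm (x k - xbar))\<^sup>2 \<le> E"
      using parts[OF that] nn[of k] coeff_VI[of k] by argo
  qed
  obtain m2 where m2: "0 < m2" "\<And>z. m2 * (norm z)\<^sup>2 \<le> z \<bullet> (blk22 Q z + \<sigma> *\<^sub>R B (Bs z) + T z)"
    using pd_coercive[OF quadratic_forms_linear(2) pd2] by blast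
  have vb: "norm (v k - vbar) \<le> sqrt (2 * E / m2)" if "1 \<le> k" for k
  proof (rule norm_le_if_coercive[OF m2(1)])
    show "m2 * (norm (v k - vbar))\<^sup>2 \<le> 2 * E"
      using m2(2)[of "v k - vbar"] parts[OF that] nn[of k] coeff_VI[of k] unfolding quadratic_forms by argo
  qed
  define \<rho> where "\<rho> = 2 * X / (\<tau> * \<sigma>)"
  have rb: "norm (resid (w (Suc k))) \<le> \<rho>" if k: "1 \<le> k" for k
  proof -
    have "(\<tau> * \<sigma>) * norm (resid (w (Suc k))) = norm (x (Suc k) - x k)"
      using sigma_pos tau_pos by (simp add: x_Suc)
    also have "\<dots> \<le> norm (x (Suc k) - xbar) + norm (x k - xbar)"
      using norm_triangle_ineq4[of "x (Suc k) - xbar" "x k - xbar"] by simp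
    also have "\<dots> \<le> 2 * X" using xb[OF k] xb[of "Suc k"] by simp
    finally show ?thesis using sigma_pos tau_pos by (simp add: \<rho>_def field_simps)
  qed
  obtain m1 where m1: "0 < m1" "\<And>z. m1 * (norm z)\<^sup>2 \<le> z \<bullet> (blk11 Q z + \<sigma> *\<^sub>R A (As z) + S z)"
    using pd_coercive[OF quadratic_forms_linear(1) pd1] by blast
  \<comment> \<open>The \<open>Q\<close> part contributes 4 E + 4 E, the \<open>As\<close> part 4 E
    besides the residual term, and the \<open>S\<close> part 2 E.\<close>
  have ub: "norm (u (Suc k) - ubar) \<le> sqrt ((14 * E + 2 * \<sigma> * \<rho>\<^sup>2) / m1)" if k: "1 \<le> k" for k
  proof (rule norm_le_if_coercive[OF m1(1)])
    let ?u = "u (Suc k) - ubar" and ?v = "v (Suc k) - vbar" and ?e = "w (Suc k) - ?z"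
    have k': "1 \<le> Suc k" by simp
    have "(?u, 0) = ?e - (0, ?v)" by simp
    then have 1: "sqn Q (?u, 0) \<le> 2 * sqn Q ?e + 2 * sqn Q (0, ?v)"
      using sqn_parallelogram[OF Q_sa, of ?e "(0, ?v)"] sqn_nonneg[OF Q_psd, of "?e + (0, ?v)"] by (simp only:)
    have "As ?u = resid (w (Suc k)) - Bs ?v"
      using resid_diff[of "w (Suc k)" ?z] s by simp
    then have "(norm (As ?u))\<^sup>2 \<le> 2 * (norm (resid (w (Suc k))))\<^sup>2 + 2 * (norm (Bs ?v))\<^sup>2"
      using zero_le_power2[of "norm (resid (w (Suc k)) + Bs ?v)"]
      by (simp add: power2_norm_eq_inner inner_simps inner_commute)
    also have "(norm (resid (w (Suc k))))\<^sup>2 \<le> \<rho>\<^sup>2" using rb[OF k] by (intro power_mono) auto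
    finally have "\<sigma> * (norm (As ?u))\<^sup>2 \<le> \<sigma> * (2 * \<rho>\<^sup>2 + 2 * (norm (Bs ?v))\<^sup>2)"
      using sigma_pos by (simp add: mult_left_mono)
    then have 2: "\<sigma> * (norm (As ?u))\<^sup>2 \<le> 2 * \<sigma> * \<rho>\<^sup>2 + 4 * (\<sigma> / 2 * (norm (Bs ?v))\<^sup>2)"
      by (simp add: algebra_simps)
    show "m1 * (norm ?u)\<^sup>2 \<le> 14 * E + 2 * \<sigma> * \<rho>\<^sup>2"
      using m1(2)[of ?u] parts[OF k'] nn[of "Suc k"] coeff_VI[of "Suc k"] 1 2 unfolding quadratic_forms by argo
  qed
  define R where "R = Max {sqrt ((14 * E + 2 * \<sigma> * \<rho>\<^sup>2) / m1), sqrt (2 * E / m2), X, \<rho>}"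
  show thesis
  proof
    show "norm (u (Suc (Suc k)) - ubar) \<le> R" for k using ub[of "Suc k"] by (auto simp: R_def)
    show "norm (v (Suc k) - vbar) \<le> R" for k using vb[of "Suc k"] by (auto simp: R_def)
    show "norm (x (Suc k) - xbar) \<le> R" for k using xb[of "Suc k"] by (auto simp: R_def)
    show "norm (resid (w (Suc (Suc k)))) \<le> R" for k using rb[of "Suc k"] by (auto simp: R_def)
  qed
qed

text \<open>No values of p or q occur in the Lyapunov function at index 1, so it is continuous in
  the centre and bounded on balls. The subtracted term is the lower bound from
  \<open>lyapunov_ge\<close>; treating the iterate in it as a free variable v' makes C independent
  of k.\<close>

lemma lyapunov_difference_bounded:
  obtains C where "\<And>z y v'. norm z \<le> R \<Longrightarrow> norm y \<le> R \<Longrightarrow> norm v' \<le> R \<Longrightarrow>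
    lyapunov \<kappa> z y 1 - \<sigma> * (resid z \<bullet> Bs v') \<le> C"
proof -
  let ?F = "\<lambda>t. lyapunov \<kappa> (fst t) (fst (snd t)) 1 - \<sigma> * (resid (fst t) \<bullet> Bs (snd (snd t)))"
  have "continuous_on (cball 0 (3 * R)) ?F"
    unfolding lyapunov_def energy_def resid_def sqn_def
    by (intro continuous_intros continuous_on_linear_compose[OF As_lin] continuous_on_linear_compose[OF Bs_lin]
        continuous_on_linear_compose[OF Q_lin] continuous_on_linear_compose[OF self_adj_linear[OF H_sa]]
        continuous_on_linear_compose[OF self_adj_linear[OF S_sa]] continuous_on_linear_compose[OF self_adj_linear[OF T_sa]])
  then have "bounded (?F ` cball 0 (3 * R))"
    by (intro compact_imp_bounded compact_continuous_image compact_cball)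
  then obtain C where C: "\<And>t. t \<in> cball 0 (3 * R) \<Longrightarrow> norm (?F t) \<le> C"
    unfolding bounded_iff by blast
  show thesis
  proof
    fix z :: "'u \<times> 'v" and y :: 'x and v' :: 'v assume n: "norm z \<le> R" "norm y \<le> R" "norm v' \<le> R"
    have "norm (z, y, v') \<le> 3 * R"
      using norm_Pair_le[of z "(y, v')"] norm_Pair_le[of y v'] n by linarith
    then show "lyapunov \<kappa> z y 1 - \<sigma> * (resid z \<bullet> Bs v') \<le> C" using C[of "(z, y, v')"] by auto
  qed
qed

theorem ergodic_rates:
  assumes opt: "ubar \<in> Dp" "vbar \<in> Dq" "As ubar + Bs vbar = c"
        "\<And>a b. a \<in> Dp \<Longrightarrow> b \<in> Dq \<Longrightarrow> As a + Bs b = c \<Longrightarrow>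
           p ubar + q vbar + phi (ubar, vbar) \<le> p a + q b + phi (a, b)"
    and slater: "(ur, vr) \<in> rel_interior (Dp \<times> Dq)" "As ur + Bs vr = c"
    and pd1: "pd (\<lambda>a. blk11 Q a + \<sigma> *\<^sub>R A (As a) + S a)"
    and pd2: "pd (\<lambda>b. blk22 Q b + \<sigma> *\<^sub>R B (Bs b) + T b)"
    and tau: "\<tau> \<le> 1 \<or> \<tau> < (1 + sqrt 5) / 2 \<and>
       psd (\<lambda>w. (1/4) *\<^sub>R Q w + Diag (\<lambda>a. S a - \<eta> *\<^sub>R D1 a) (\<lambda>b. T b - \<eta> *\<^sub>R D2 b) w)"
  shows "\<exists>C1 C2 C3. \<forall>k\<ge>1.
     norm (As (uh k) + Bs (vh k) - c) \<le> C1 / real k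
   \<and> (\<forall>a b y. a \<in> Dp \<longrightarrow> b \<in> Dq \<longrightarrow> norm ((a, b, y) - (uh k, vh k, xh k)) \<le> 1 \<longrightarrow>
        (p (uh k) + q (vh k)) - (p a + q b) + ((uh k, vh k) - (a, b)) \<bullet> G (a, b)
        + (uh k - a) \<bullet> A y + (vh k - b) \<bullet> B y
        - (xh k - y) \<bullet> (As a + Bs b - c) \<le> C2 / real k)
   \<and> (\<tau> \<le> 1 \<or> (psd (\<lambda>a. S a - \<eta> *\<^sub>R D1 a) \<and> psd (\<lambda>b. T b - \<eta> *\<^sub>R D2 b))
       \<longrightarrow> \<bar>(p (uh k) + q (vh k) + phi (uh k, vh k)) - (p ubar + q vbar + phi (ubar, vbar))\<bar>
             \<le> C3 / real k)"
proof -
  have tau': "\<tau> \<le> 1 \<or> \<tau> < (1 + sqrt 5) / 2" using tau by blast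
  obtain xbar where
    saddle: "\<And>a b. a \<in> Dp \<Longrightarrow> b \<in> Dq \<Longrightarrow> p ubar + q vbar + phi (ubar, vbar) \<le> p a + q b + phi (a, b) + xbar \<bullet> resid (a, b)" and
    KKT: "\<And>a b. a \<in> Dp \<Longrightarrow> b \<in> Dq \<Longrightarrow> 0 \<le> p a + q b - (p ubar + q vbar) + G (ubar, vbar) \<bullet> ((a, b) - (ubar, vbar)) + resid (a, b) \<bullet> xbar"
    using KKT_multiplier[OF opt slater] by blast
  obtain R where R: "\<And>k. norm (u (Suc (Suc k)) - ubar) \<le> R" "\<And>k. norm (v (Suc k) - vbar) \<le> R"
    "\<And>k. norm (x (Suc k) - xbar) \<le> R" "\<And>k. norm (resid (w (Suc (Suc k)))) \<le> R"
    using iterates_bounded[OF tau opt(1-3) KKT pd1 pd2] by blast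
  have R0: "0 \<le> R" using R(4)[of 0] norm_ge_zero order_trans by blast
  have uhb: "uh k \<in> cball ubar R" and vhb: "vh k \<in> cball vbar R" and xhb: "xh k \<in> cball xbar (R + \<sigma> * R)" if k: "1 \<le> k" for k
  proof -
    show "uh k \<in> cball ubar R" unfolding uh_def
    proof (rule average_mem[OF convex_cball k])
      fix i :: nat assume "1 \<le> i"
      then show "u (Suc i) \<in> cball ubar R" using R(1)[of "i - 1"] by (simp add: dist_norm norm_minus_commute)
    qed
    show "vh k \<in> cball vbar R" unfolding vh_def
      by (rule average_mem[OF convex_cball k]) (use R(2) in \<open>simp add: dist_norm norm_minus_commute\<close>)
    show "xh k \<in> cball xbar (R + \<sigma> * R)" unfolding xh_def
    proof (rule average_mem[OF convex_cball k])
      fix i :: nat assume i: "1 \<le> i"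
      have "norm (x i - xbar) \<le> R" "norm (resid (w (Suc i))) \<le> R" using R(3)[of "i - 1"] R(4)[of "i - 1"] i by simp_all
      then have "norm (x i - xbar) \<le> R" "norm (\<sigma> *\<^sub>R resid (w (Suc i))) \<le> \<sigma> * R" using sigma_pos by simp_all
      then have "norm ((x i - xbar) + \<sigma> *\<^sub>R resid (w (Suc i))) \<le> R + \<sigma> * R"
        by (rule order_trans[OF norm_triangle_ineq add_mono])
      then show "x i + \<sigma> *\<^sub>R resid (w (Suc i)) \<in> cball xbar (R + \<sigma> * R)"
        by (simp add: mem_cball dist_norm norm_minus_commute algebra_simps)
    qed
  qed
  define C1 where "C1 = 2 * R / (\<tau> * \<sigma>)"
  have i: "real k * norm (resid (uh k, vh k)) \<le> C1" if k: "1 \<le> k" for k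
  proof -
    have "(\<tau> * \<sigma>) * (real k * norm (resid (uh k, vh k))) = norm ((\<tau> * \<sigma>) *\<^sub>R (real k *\<^sub>R resid (uh k, vh k)))"
      using sigma_pos tau_pos by simp
    also have "\<dots> = norm (x (Suc k) - x 1)" by (simp only: resid_average[OF k] sum_resid)
    also have "\<dots> \<le> norm (x (Suc k) - xbar) + norm (x 1 - xbar)"
      using norm_triangle_ineq4[of "x (Suc k) - xbar" "x 1 - xbar"] by simp
    also have "\<dots> \<le> 2 * R" using R(3)[of k] R(3)[of 0] by simp
    finally show ?thesis using sigma_pos tau_pos by (simp add: C1_def field_simps)
  qed
  \<comment> \<open>A radius, independent of k, for all centres within distance 1 of the averages
    and for all v-iterates from index 1 on.\<close>
  define R' where "R' = norm ubar + norm vbar + norm xbar + 4 * R + \<sigma> * R + 2"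
  obtain C2 where C2: "\<And>z y v'. norm z \<le> R' \<Longrightarrow> norm y \<le> R' \<Longrightarrow> norm v' \<le> R' \<Longrightarrow>
    lyapunov coeff_VI z y 1 - \<sigma> * (resid z \<bullet> Bs v') \<le> C2"
    using lyapunov_difference_bounded[of R' coeff_VI] by blast
  have ii: "real k * ((p (uh k) + q (vh k)) - (p a + q b) + ((uh k, vh k) - (a, b)) \<bullet> G (a, b)
        + (uh k - a) \<bullet> A y + (vh k - b) \<bullet> B y - (xh k - y) \<bullet> resid (a, b)) \<le> C2"
    if k: "1 \<le> k" and ab: "a \<in> Dp" "b \<in> Dq" and near: "norm ((a, b, y) - (uh k, vh k, xh k)) \<le> 1" for k a b y
  proof -
    have "(a, b, y) - (uh k, vh k, xh k) = (a - uh k, b - vh k, y - xh k)" by simp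
    then have na: "norm (a - uh k) \<le> 1" and nby: "norm (b - vh k, y - xh k) \<le> 1"
      using near norm_fst_le[of "a - uh k" "(b - vh k, y - xh k)"] norm_snd_le[of "(b - vh k, y - xh k)" "a - uh k"] by auto
    have nb: "norm (b - vh k) \<le> 1" and ny: "norm (y - xh k) \<le> 1"
      using nby norm_fst_le[of "b - vh k" "y - xh k"] norm_snd_le[of "y - xh k" "b - vh k"] by auto
    have "norm (uh k - ubar) \<le> R" "norm (vh k - vbar) \<le> R" "norm (xh k - xbar) \<le> R + \<sigma> * R"
      using uhb[OF k] vhb[OF k] xhb[OF k] by (simp_all add: mem_cball dist_norm norm_minus_commute)
    then have "norm a \<le> norm ubar + R + 1" "norm b \<le> norm vbar + R + 1" "norm y \<le> norm xbar + R + \<sigma> * R + 1"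
      using na nb ny norm_triangle_sub[of a "uh k"] norm_triangle_sub[of "uh k" ubar] norm_triangle_sub[of b "vh k"]
        norm_triangle_sub[of "vh k" vbar] norm_triangle_sub[of y "xh k"] norm_triangle_sub[of "xh k" xbar] by linarith+
    moreover have "norm (v (Suc k)) \<le> norm vbar + R" using R(2)[of k] norm_triangle_sub[of "v (Suc k)" vbar] by linarith
    moreover have "0 \<le> \<sigma> * R" using R0 sigma_pos by simp
    ultimately have "norm (a, b) \<le> R'" "norm y \<le> R'" "norm (v (Suc k)) \<le> R'"
      using norm_Pair_le[of a b] R0 unfolding R'_def
      by (smt (verit) norm_ge_zero)+
    from C2[OF this] show ?thesis
      using ergodic_VI[OF k ab tau, of y] lyapunov_ge[OF coeff_VI_nonneg tau', of "(a, b)" "Suc k" y] by linarith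
  qed
  \<comment> \<open>The first summand bounds the excess of \<theta> from above; the second bounds it
    from below, through the multiplier and the rate (i).\<close>
  define C3 where "C3 = \<bar>lyapunov coeff_theta (ubar, vbar) 0 1\<bar> + norm xbar * C1"
  have iii: "real k * \<bar>(p (uh k) + q (vh k) + phi (uh k, vh k)) - (p ubar + q vbar + phi (ubar, vbar))\<bar> \<le> C3"
    if k: "1 \<le> k" and cond: "\<tau> \<le> 1 \<or> (psd (\<lambda>a. S a - \<eta> *\<^sub>R D1 a) \<and> psd (\<lambda>b. T b - \<eta> *\<^sub>R D2 b))" for k
  proof -
    let ?d = "(p (uh k) + q (vh k) + phi (uh k, vh k)) - (p ubar + q vbar + phi (ubar, vbar))"
    have mem: "uh k \<in> Dp" "vh k \<in> Dq"
      unfolding uh_def vh_def using average_mem[OF Dp_convex(1) k] average_mem[OF Dq_convex(1) k] iterates_mem by auto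
    have up: "real k * ?d \<le> lyapunov coeff_theta (ubar, vbar) 0 1"
      by (rule ergodic_theta[OF k opt(1-3)]) (use cond tau in blast)
    have nx: "norm xbar * (real k * norm (resid (uh k, vh k))) \<le> norm xbar * C1"
      by (rule mult_left_mono[OF i[OF k] norm_ge_zero])
    have "- ?d \<le> norm xbar * norm (resid (uh k, vh k))"
      using saddle[OF mem] norm_cauchy_schwarz[of xbar "resid (uh k, vh k)"] by linarith
    then have "real k * (- ?d) \<le> real k * (norm xbar * norm (resid (uh k, vh k)))"
      by (rule mult_left_mono) simp
    then have low: "- (real k * ?d) \<le> norm xbar * C1" using nx by (simp add: algebra_simps)
    have "0 \<le> norm xbar * C1" using nx by (smt (verit) mult_nonneg_nonneg norm_ge_zero of_nat_0_le_iff)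
    then have "\<bar>real k * ?d\<bar> \<le> C3" using up low unfolding C3_def by linarith
    then show ?thesis by (simp add: abs_mult)
  qed
  have div: "t \<le> C / real k" if "1 \<le> k" "real k * t \<le> C" for t C :: real and k :: nat
    using that by (simp add: field_simps)
  show ?thesis
  proof (rule exI[of _ C1], rule exI[of _ C2], rule exI[of _ C3], intro allI impI conjI)
    fix k :: nat assume k: "1 \<le> k"
    show "norm (As (uh k) + Bs (vh k) - c) \<le> C1 / real k"
      by (rule div[OF k i[OF k, unfolded resid_def fst_conv snd_conv]])
    show "(p (uh k) + q (vh k)) - (p a + q b) + ((uh k, vh k) - (a, b)) \<bullet> G (a, b)
        + (uh k - a) \<bullet> A y + (vh k - b) \<bullet> B y - (xh k - y) \<bullet> (As a + Bs b - c) \<le> C2 / real k"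
      if "a \<in> Dp" "b \<in> Dq" "norm ((a, b, y) - (uh k, vh k, xh k)) \<le> 1" for a b y
      by (rule div[OF k ii[OF k that, unfolded resid_def fst_conv snd_conv]])
    show "\<bar>(p (uh k) + q (vh k) + phi (uh k, vh k)) - (p ubar + q vbar + phi (ubar, vbar))\<bar> \<le> C3 / real k"
      if "\<tau> \<le> 1 \<or> (psd (\<lambda>a. S a - \<eta> *\<^sub>R D1 a) \<and> psd (\<lambda>b. T b - \<eta> *\<^sub>R D2 b))"
      by (rule div[OF k iii[OF k that]])
  qed
qed

end

theorem theorem4p3:
  fixes p :: "'u::euclidean_space \<Rightarrow> real" and Dp :: "'u set"
    and q :: "'v::euclidean_space \<Rightarrow> real" and Dq :: "'v set"
    and phi :: "'u \<times> 'v \<Rightarrow> real" and G :: "'u \<times> 'v \<Rightarrow> 'u \<times> 'v"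
    and A :: "'x::euclidean_space \<Rightarrow> 'u" and B :: "'x \<Rightarrow> 'v" and c :: 'x
    and Q :: "'u \<times> 'v \<Rightarrow> 'u \<times> 'v" and D1 :: "'u \<Rightarrow> 'u" and D2 :: "'v \<Rightarrow> 'v"
    and S :: "'u \<Rightarrow> 'u" and T :: "'v \<Rightarrow> 'v"
    and \<eta> \<sigma> \<tau> :: real
    and u :: "nat \<Rightarrow> 'u" and v :: "nat \<Rightarrow> 'v" and x :: "nat \<Rightarrow> 'x"
    and ubar :: 'u and vbar :: 'v and ur :: 'u and vr :: 'v
    and uh :: "nat \<Rightarrow> 'u" and vh :: "nat \<Rightarrow> 'v" and xh :: "nat \<Rightarrow> 'x"
  assumes p_cpc: "closed_proper_convex Dp p"
    and q_cpc: "closed_proper_convex Dq q"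
    and phi_convex: "convex_on UNIV phi"
    and phi_grad: "\<And>w. (phi has_derivative (\<lambda>h. G w \<bullet> h)) (at w)"
    and G_lipschitz: "\<exists>L. \<forall>w w'. norm (G w - G w') \<le> L * norm (w - w')"
    and A_lin: "linear A" and B_lin: "linear B"
    and Q_sa: "self_adj Q" and Q_psd: "psd Q"
    and D1_sa: "self_adj D1" and D1_psd: "psd D1"
    and D2_sa: "self_adj D2" and D2_psd: "psd D2"
    and hess_bounds: "\<And>w W z. W \<in> clarke_hessian G w \<Longrightarrow>
        sqn Q z \<le> z \<bullet> blinfun_apply W z \<and>
        z \<bullet> blinfun_apply W z \<le> sqn Q z + sqn (Diag D1 D2) z"
    and eta_range: "0 \<le> \<eta>" "\<eta> \<le> 1"
    and eta_bound: "\<And>z W a b. W \<in> clarke_hessian G z \<Longrightarrow>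
        \<bar>a \<bullet> (blk12 (blinfun_apply W) b - blk12 Q b)\<bar> \<le> \<eta> / 2 * (sqn D1 a + sqn D2 b)"
    and sigma_pos: "\<sigma> > 0" and tau_pos: "\<tau> > 0"
    and S_sa: "self_adj S" and S_psd: "psd S"
    and T_sa: "self_adj T" and T_psd: "psd T"
    and init: "u 0 \<in> Dp" "v 0 \<in> Dq"
    and u_step: "\<And>k. u (Suc k) \<in> Dp \<and>
        (\<forall>a\<in>Dp. Lhat p q phi G (\<lambda>w. Q w + Diag D1 D2 w) A B c \<sigma> (u (Suc k), v k) (x k) (u k, v k)
                   + 1/2 * sqn S (u (Suc k) - u k)
                 \<le> Lhat p q phi G (\<lambda>w. Q w + Diag D1 D2 w) A B c \<sigma> (a, v k) (x k) (u k, v k)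
                   + 1/2 * sqn S (a - u k))"
    and v_step: "\<And>k. v (Suc k) \<in> Dq \<and>
        (\<forall>b\<in>Dq. Lhat p q phi G (\<lambda>w. Q w + Diag D1 D2 w) A B c \<sigma> (u (Suc k), v (Suc k)) (x k) (u k, v k)
                   + 1/2 * sqn T (v (Suc k) - v k)
                 \<le> Lhat p q phi G (\<lambda>w. Q w + Diag D1 D2 w) A B c \<sigma> (u (Suc k), b) (x k) (u k, v k)
                   + 1/2 * sqn T (b - v k))"
    and x_step: "\<And>k. x (Suc k) = x k + (\<tau> * \<sigma>) *\<^sub>R (adjoint A (u (Suc k)) + adjoint B (v (Suc k)) - c)"
    and uh_def: "uh = (\<lambda>k. (1 / real k) *\<^sub>R (\<Sum>i = 1..k. u (Suc i)))"
    and vh_def: "vh = (\<lambda>k. (1 / real k) *\<^sub>R (\<Sum>i = 1..k. v (Suc i)))"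
    and xh_def: "xh = (\<lambda>k. (1 / real k) *\<^sub>R
        (\<Sum>i = 1..k. x i + \<sigma> *\<^sub>R (adjoint A (u (Suc i)) + adjoint B (v (Suc i)) - c)))"
    and opt: "ubar \<in> Dp" "vbar \<in> Dq" "adjoint A ubar + adjoint B vbar = c"
        "\<And>a b. a \<in> Dp \<Longrightarrow> b \<in> Dq \<Longrightarrow> adjoint A a + adjoint B b = c \<Longrightarrow>
           p ubar + q vbar + phi (ubar, vbar) \<le> p a + q b + phi (a, b)"
    and slater: "(ur, vr) \<in> rel_interior (Dp \<times> Dq)" "adjoint A ur + adjoint B vr = c"
    and pd1: "pd (\<lambda>a. blk11 Q a + \<sigma> *\<^sub>R A (adjoint A a) + S a)"
    and pd2: "pd (\<lambda>b. blk22 Q b + \<sigma> *\<^sub>R B (adjoint B b) + T b)"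
    and cases_ab: "(\<tau> \<le> 1 \<and>
          (\<forall>a b. (a, b) \<bullet> (Q (a, b) + Diag (\<lambda>a'. S a' + ((1 - \<tau>) * \<sigma>) *\<^sub>R A (adjoint A a'))
                                           (\<lambda>b'. T b' + ((1 - \<tau>) * \<sigma>) *\<^sub>R B (adjoint B b')) (a, b)) = 0
                 \<longrightarrow> norm a * norm b = 0))
      \<or> (\<tau> < (1 + sqrt 5) / 2 \<and>
          psd (\<lambda>w. (1/4) *\<^sub>R Q w + Diag (\<lambda>a. S a - \<eta> *\<^sub>R D1 a) (\<lambda>b. T b - \<eta> *\<^sub>R D2 b) w) \<and>
          pd (\<lambda>a. (1/4) *\<^sub>R blk11 Q a + S a + \<sigma> *\<^sub>R A (adjoint A a) - \<eta> *\<^sub>R D1 a) \<and>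
          pd (\<lambda>b. (1/4) *\<^sub>R blk22 Q b + T b + \<sigma> *\<^sub>R B (adjoint B b) - \<eta> *\<^sub>R D2 b) \<and>
          (\<forall>a b. (a, b) \<bullet> ((1/4) *\<^sub>R Q (a, b)
                     + Diag (\<lambda>a. S a - \<eta> *\<^sub>R D1 a) (\<lambda>b. T b - \<eta> *\<^sub>R D2 b) (a, b)
                     + \<sigma> *\<^sub>R Diag (\<lambda>a. A (adjoint A a)) (\<lambda>b. B (adjoint B b)) (a, b)) = 0
                 \<longrightarrow> norm a * norm b = 0))"
  shows "\<exists>C1 C2 C3. \<forall>k\<ge>1.
     norm (adjoint A (uh k) + adjoint B (vh k) - c) \<le> C1 / real k
   \<and> (\<forall>a b y. a \<in> Dp \<longrightarrow> b \<in> Dq \<longrightarrow> norm ((a, b, y) - (uh k, vh k, xh k)) \<le> 1 \<longrightarrow>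
        (p (uh k) + q (vh k)) - (p a + q b) + ((uh k, vh k) - (a, b)) \<bullet> G (a, b)
        + (uh k - a) \<bullet> A y + (vh k - b) \<bullet> B y
        - (xh k - y) \<bullet> (adjoint A a + adjoint B b - c) \<le> C2 / real k)
   \<and> ((\<tau> \<le> 1 \<and>
          (\<forall>a b. (a, b) \<bullet> (Q (a, b) + Diag (\<lambda>a'. S a' + ((1 - \<tau>) * \<sigma>) *\<^sub>R A (adjoint A a'))
                                           (\<lambda>b'. T b' + ((1 - \<tau>) * \<sigma>) *\<^sub>R B (adjoint B b')) (a, b)) = 0
                 \<longrightarrow> norm a * norm b = 0))
       \<or> (psd (\<lambda>a. S a - \<eta> *\<^sub>R D1 a) \<and> psd (\<lambda>b. T b - \<eta> *\<^sub>R D2 b))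
       \<longrightarrow> \<bar>(p (uh k) + q (vh k) + phi (uh k, vh k)) - (p ubar + q vbar + phi (ubar, vbar))\<bar>
             \<le> C3 / real k)"
proof -
  interpret M: majorized_admm p Dp q Dq phi G A B c Q D1 D2 S T \<eta> \<sigma> \<tau> u v x
    by (rule majorized_admm.intro; fact)
  have avg: "uh = M.uh" "vh = M.vh" "xh = M.xh"
    by (simp_all add: fun_eq_iff uh_def vh_def xh_def M.uh_def M.vh_def M.xh_def average_def M.resid_def)
  \<comment> \<open>Case (a) supplies the first disjunct, case (b) the golden ratio bound with the
    semidefiniteness.\<close>
  have tau: "\<tau> \<le> 1 \<or> \<tau> < (1 + sqrt 5) / 2 \<and>
      psd (\<lambda>w. (1/4) *\<^sub>R Q w + Diag (\<lambda>a. S a - \<eta> *\<^sub>R D1 a) (\<lambda>b. T b - \<eta> *\<^sub>R D2 b) w)"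
    using cases_ab by blast
  obtain C1 C2 C3 where C: "\<And>k. 1 \<le> k \<Longrightarrow>
     norm (adjoint A (uh k) + adjoint B (vh k) - c) \<le> C1 / real k
   \<and> (\<forall>a b y. a \<in> Dp \<longrightarrow> b \<in> Dq \<longrightarrow> norm ((a, b, y) - (uh k, vh k, xh k)) \<le> 1 \<longrightarrow>
        (p (uh k) + q (vh k)) - (p a + q b) + ((uh k, vh k) - (a, b)) \<bullet> G (a, b)
        + (uh k - a) \<bullet> A y + (vh k - b) \<bullet> B y
        - (xh k - y) \<bullet> (adjoint A a + adjoint B b - c) \<le> C2 / real k)
   \<and> (\<tau> \<le> 1 \<or> (psd (\<lambda>a. S a - \<eta> *\<^sub>R D1 a) \<and> psd (\<lambda>b. T b - \<eta> *\<^sub>R D2 b))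
       \<longrightarrow> \<bar>(p (uh k) + q (vh k) + phi (uh k, vh k)) - (p ubar + q vbar + phi (ubar, vbar))\<bar>
             \<le> C3 / real k)"
    using M.ergodic_rates[OF opt slater pd1 pd2 tau] unfolding avg by blast
  show ?thesis
  proof (rule exI[of _ C1], rule exI[of _ C2], rule exI[of _ C3], intro allI impI)
    fix k :: nat assume "1 \<le> k"
    note Ck = C[OF this]
    show "norm (adjoint A (uh k) + adjoint B (vh k) - c) \<le> C1 / real k
   \<and> (\<forall>a b y. a \<in> Dp \<longrightarrow> b \<in> Dq \<longrightarrow> norm ((a, b, y) - (uh k, vh k, xh k)) \<le> 1 \<longrightarrow>
        (p (uh k) + q (vh k)) - (p a + q b) + ((uh k, vh k) - (a, b)) \<bullet> G (a, b)
        + (uh k - a) \<bullet> A y + (vh k - b) \<bullet> B y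
        - (xh k - y) \<bullet> (adjoint A a + adjoint B b - c) \<le> C2 / real k)
   \<and> ((\<tau> \<le> 1 \<and>
          (\<forall>a b. (a, b) \<bullet> (Q (a, b) + Diag (\<lambda>a'. S a' + ((1 - \<tau>) * \<sigma>) *\<^sub>R A (adjoint A a'))
                                           (\<lambda>b'. T b' + ((1 - \<tau>) * \<sigma>) *\<^sub>R B (adjoint B b')) (a, b)) = 0
                 \<longrightarrow> norm a * norm b = 0))
       \<or> (psd (\<lambda>a. S a - \<eta> *\<^sub>R D1 a) \<and> psd (\<lambda>b. T b - \<eta> *\<^sub>R D2 b))
       \<longrightarrow> \<bar>(p (uh k) + q (vh k) + phi (uh k, vh k)) - (p ubar + q vbar + phi (ubar, vbar))\<bar>
             \<le> C3 / real k)"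
      using conjunct1[OF Ck] conjunct1[OF conjunct2[OF Ck]] conjunct2[OF conjunct2[OF Ck]]
      by (intro conjI impI) (assumption | erule disjE conjE | simp)+
  qed
qed

end
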